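(* Let $\mathcal{H}_1,\mathcal{H}_2$ be Hilbert spaces and let $T=\begin{bmatrix}A&X\\0&B\end{bmatrix}$ be a contraction on $\mathcal{H}_1\oplus\mathcal{H}_2$, with $X=D_{A^*}LD_B$ where $L\in B(\mathcal{D}_B,\mathcal{D}_{A^*})$ is the coupling operator (a contraction). Let $\tau\in B(\mathcal{D}_T,\mathcal{D}_A\oplus\mathcal{D}_L)$ and $\tau_*\in B(\mathcal{D}_{T^*},\mathcal{D}_{B^*}\oplus\mathcal{D}_{L^*})$ be unitary operators such that $\Theta_T(z)=\Theta_3'(z)\Theta_2'(z)\Theta_1'(z)$ for all $z\in\mathbb{D}$, where $$\Theta_3'(z)=\tau_*^{-1}\begin{bmatrix}\Theta_B(z)&0\\0&I_{\mathcal{D}_{L^*}}\end{bmatrix},\quad \Theta_2'(z)=\begin{bmatrix}L^*&D_L\\ D_{L^*}&-L\end{bmatrix},\quad \Theta_1'(z)=\begin{bmatrix}\Theta_A(z)&0\\0&I_{\mathcal{D}_L}\end{bmatrix}\tau .$$ Then, in each of the following cases, the factorization $\Theta_T(z)=\Theta_3'(z)\Theta_2'(z)\Theta_1'(z)$ is a $3$-regular factorization: (i) the operator $A^*$ or $B$ is a pure contraction; (ii) the operator $T$ is a pure contraction; (iii) the coupling operator $L$ is a proper contraction, i.e., $\|L^*x\|<\|x\|$ for all nonzero $x\in\mathcal{D}_{A^*}$, or $\|Ly\|<\|y\|$ for all nonzero $y\in\mathcal{D}_B$.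
   Context: All Hilbert spaces are complex and separable; $\mathbb{D}$ is the open unit disc. A contraction $T$ on $\mathcal{H}$ is pure if $\lim_{n\to\infty}\|T^{*n}x\|=0$ for all $x\in\mathcal{H}$. For a contraction $T$ between Hilbert spaces, $D_T=(I-T^*T)^{1/2}$, $D_{T^*}=(I-TT^* )^{1/2}$, $\mathcal{D}_T=\overline{\mathrm{range}(D_T)}$, $\mathcal{D}_{T^*}=\overline{\mathrm{range}(D_{T^*})}$. The characteristic function of a contraction $T$ on $\mathcal{H}$ is $\Theta_T:\mathbb{D}\to B(\mathcal{D}_T,\mathcal{D}_{T^*})$, $\Theta_T(z)=(-T+zD_{T^*}(I-zT^* )^{-1}D_T)|_{\mathcal{D}_T}$. By a theorem of Sz.-Nagy and Foiaş, every contraction $\begin{bmatrix}A&X\\0&B\end{bmatrix}$ on $\mathcal{H}_1\oplus\mathcal{H}_2$ has $X=D_{A^*}LD_B$ for some contraction $L\in B(\mathcal{D}_B,\mathcal{D}_{A^*})$ (the coupling operator), and unitaries $\tau,\tau_*$ giving the stated factorization exist. Here $\Theta_1'(z):\mathcal{D}_T\to\mathcal{D}_{A^*}\oplus\mathcal{D}_L$, $\Theta_2'(z):\mathcal{D}_{A^*}\oplus\mathcal{D}_L\to\mathcal{D}_B\oplus\mathcal{D}_{L^*}$ (a constant unitary), and $\Theta_3'(z):\mathcal{D}_B\oplus\mathcal{D}_{L^*}\to\mathcal{D}_{T^*}$. A contractive analytic function $\{\mathcal{E},\mathcal{E}_*,\Theta(z)\}$ consists of Hilbert spaces $\mathcal{E},\mathcal{E}_*$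 and an analytic function $\Theta:\mathbb{D}\to B(\mathcal{E},\mathcal{E}_* )$ with $\|\Theta(z)\|\le1$ for all $z\in\mathbb{D}$. The boundary values $\Theta(e^{it})=\lim_{r\to1^-}\Theta(re^{it})$ exist a.e. in the strong operator topology, and $\Theta$ also denotes the multiplication operator $L^2(\mathcal{E})\to L^2(\mathcal{E}_* )$, $(\Theta v)(t)=\Theta(e^{it})v(t)$, where $L^2(\mathcal{E})$ is the space of square-integrable $\mathcal{E}$-valued functions on $[0,2\pi]$. Let $\{\mathcal{E},\mathcal{E}_*,\Theta(z)\}$ and $\{\mathcal{E}_i,\mathcal{E}_{i+1},\Theta_i(z)\}$, $i=1,2,3$, be contractive analytic functions with $\mathcal{E}_1=\mathcal{E}$, $\mathcal{E}_4=\mathcal{E}_*$ and $\Theta(z)=\Theta_3(z)\Theta_2(z)\Theta_1(z)$ for all $z\in\mathbb{D}$. Put $\Delta_\Theta=(I-\Theta^*\Theta)^{1/2}$ and $\Delta_i=(I-\Theta_i^*\Theta_i)^{1/2}$ (operators on $L^2(\mathcal{E})$ and $L^2(\mathcal{E}_i)$). The factorization is $3$-regular if the isometry $Z_3:\overline{\Delta_\Theta L^2(\mathcal{E}_1)}\to\overline{\Delta_3L^2(\mathcal{E}_3)}\oplus\overline{\Delta_2L^2(\mathcal{E}_2)}\oplus\overline{\Delta_1L^2(\mathcal{E}_1)}$ obtained by continuous extension of $Z_3(\Delta_\Theta f)=\Delta_3\Theta_2\Theta_1f\oplus\Delta_2\Theta_1f\oplus\Delta_1f$, $f\in L^2(\mathcal{E}_1)$,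 is unitary. *)

theory Defs
  imports "HOL-Analysis.Analysis"
begin

section \<open>Complex inner product spaces and separable complex Hilbert spaces\<close>

text \<open>The complex structure sits on top of the real one of the library: the real inner product
  is the real part of the complex one, so norm and topology are the library's. The complex inner
  product is linear in its first argument.\<close>

class complex_inner = real_inner +
  fixes scaleC :: "complex \<Rightarrow> 'a \<Rightarrow> 'a" (infixr "*\<^sub>C" 75)
    and cinner :: "'a \<Rightarrow> 'a \<Rightarrow> complex"
  assumes scaleC_add_right: "c *\<^sub>C (x + y) = c *\<^sub>C x + c *\<^sub>C y"
    and scaleC_add_left: "(c + d) *\<^sub>C x = c *\<^sub>C x + d *\<^sub>C x"
    and scaleC_scaleC: "c *\<^sub>C d *\<^sub>C x = (c * d) *\<^sub>C x"
    and scaleR_scaleC: "r *\<^sub>R x = complex_of_real r *\<^sub>C x"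
    and cinner_commute: "cinner x y = cnj (cinner y x)"
    and cinner_add_left: "cinner (x + y) z = cinner x z + cinner y z"
    and cinner_scaleC_left: "cinner (c *\<^sub>C x) y = c * cinner x y"
    and inner_eq_Re_cinner: "inner x y = Re (cinner x y)"

class chilbert_space = complex_inner + complete_space + second_countable_topology

instantiation complex :: chilbert_space
begin

definition scaleC_complex :: "complex \<Rightarrow> complex \<Rightarrow> complex" where
  "scaleC_complex c x = c * x"

definition cinner_complex :: "complex \<Rightarrow> complex \<Rightarrow> complex" where
  "cinner_complex x y = x * cnj y"

instance
  by standard
    (auto simp: scaleC_complex_def cinner_complex_def algebra_simps scaleR_conv_of_real
      inner_complex_def)

end

instantiation prod :: (complex_inner, complex_inner) complex_inner
begin

definition scaleC_prod :: "complex \<Rightarrow> 'a \<times> 'b \<Rightarrow> 'a \<times> 'b" where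
  "scaleC_prod c x = (c *\<^sub>C fst x, c *\<^sub>C snd x)"

definition cinner_prod :: "'a \<times> 'b \<Rightarrow> 'a \<times> 'b \<Rightarrow> complex" where
  "cinner_prod x y = cinner (fst x) (fst y) + cinner (snd x) (snd y)"

instance
proof
  fix x y :: "'a \<times> 'b"
  show "cinner x y = cnj (cinner y x)"
    using cinner_commute[of "fst x" "fst y"] cinner_commute[of "snd x" "snd y"]
    by (simp add: cinner_prod_def)
qed (auto simp: scaleC_prod_def cinner_prod_def scaleC_add_right scaleC_add_left scaleC_scaleC
      scaleR_scaleC scaleR_prod_def cinner_add_left cinner_scaleC_left inner_prod_def
      inner_eq_Re_cinner algebra_simps)

end

instance prod :: (chilbert_space, chilbert_space) chilbert_space ..

lemma cinner_scaleC_right: "cinner x (c *\<^sub>C y) = cnj c * cinner x y"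
  by (metis cinner_commute cinner_scaleC_left complex_cnj_mult)

lemma cinner_eq_inner: "cinner x y = Complex (inner x y) (inner x (\<i> *\<^sub>C y))"
  by (simp add: inner_eq_Re_cinner cinner_scaleC_right complex_eq_iff)

lemma norm_scaleC: "norm (c *\<^sub>C x) = cmod c * norm (x :: 'a :: complex_inner)"
proof -
  have im: "Im (cinner x x) = 0"
    using arg_cong[OF cinner_commute[of x x], of Im] by simp
  have re: "Re (cinner x x) = norm x * norm x"
    by (simp flip: inner_eq_Re_cinner power2_norm_eq_inner power2_eq_square)
  have "(norm (c *\<^sub>C x))\<^sup>2 = Re (c * cnj c * cinner x x)"
    by (simp add: power2_norm_eq_inner inner_eq_Re_cinner cinner_scaleC_left cinner_scaleC_right
        algebra_simps)
  also have "\<dots> = (cmod c * norm x)\<^sup>2"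
    using im by (simp add: re power_mult_distrib cmod_def power2_eq_square algebra_simps)
  finally show ?thesis
    by (simp add: power2_eq_iff_nonneg)
qed

lemma bounded_linear_scaleC: "bounded_linear (\<lambda>x :: 'a :: complex_inner. c *\<^sub>C x)"
  by (rule bounded_linear_intro[where K = "cmod c"])
    (auto simp: scaleC_add_right scaleR_scaleC scaleC_scaleC norm_scaleC mult.commute)

section \<open>Operators between closed subspaces\<close>

text \<open>The Hilbert spaces in play are closed complex subspaces of ambient types, represented by
  their carrier sets; an operator from \<open>E\<close> to \<open>F\<close> is a function on the ambient types of which
  only the values on \<open>E\<close> matter.\<close>

definition closed_csubspace :: "'a :: complex_inner set \<Rightarrow> bool" where
  "closed_csubspace E \<longleftrightarrow>
     closed E \<and> 0 \<in> E \<and> (\<forall>x\<in>E. \<forall>y\<in>E. x + y \<in> E) \<and> (\<forall>c. \<forall>x\<in>E. c *\<^sub>C x \<in> E)"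

definition clinear_on ::
    "'a :: complex_inner set \<Rightarrow> 'b :: complex_inner set \<Rightarrow> ('a \<Rightarrow> 'b) \<Rightarrow> bool" where
  "clinear_on E F f \<longleftrightarrow>
     f ` E \<subseteq> F \<and> (\<forall>x\<in>E. \<forall>y\<in>E. f (x + y) = f x + f y) \<and> (\<forall>c. \<forall>x\<in>E. f (c *\<^sub>C x) = c *\<^sub>C f x)"

definition bounded_clinear_on ::
    "'a :: complex_inner set \<Rightarrow> 'b :: complex_inner set \<Rightarrow> ('a \<Rightarrow> 'b) \<Rightarrow> bool" where
  "bounded_clinear_on E F f \<longleftrightarrow> clinear_on E F f \<and> (\<exists>K. \<forall>x\<in>E. norm (f x) \<le> K * norm x)"

definition contraction_on ::
    "'a :: complex_inner set \<Rightarrow> 'b :: complex_inner set \<Rightarrow> ('a \<Rightarrow> 'b) \<Rightarrow> bool" where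
  "contraction_on E F f \<longleftrightarrow> clinear_on E F f \<and> (\<forall>x\<in>E. norm (f x) \<le> norm x)"

definition unitary_on ::
    "'a :: complex_inner set \<Rightarrow> 'b :: complex_inner set \<Rightarrow> ('a \<Rightarrow> 'b) \<Rightarrow> bool" where
  "unitary_on E F f \<longleftrightarrow> clinear_on E F f \<and> (\<forall>x\<in>E. norm (f x) = norm x) \<and> f ` E = F"

definition adj_on ::
    "'a :: complex_inner set \<Rightarrow> 'b :: complex_inner set \<Rightarrow> ('a \<Rightarrow> 'b) \<Rightarrow> 'b \<Rightarrow> 'a" where
  "adj_on E F f y = (THE x. x \<in> E \<and> (\<forall>u\<in>E. cinner (f u) y = cinner u x))"

text \<open>The positive square root of a positive operator on \<open>E\<close>; the value \<open>0\<close> off \<open>E\<close> only serves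
  to make the representing function unique.\<close>

definition psqrt_on :: "'a :: complex_inner set \<Rightarrow> ('a \<Rightarrow> 'a) \<Rightarrow> 'a \<Rightarrow> 'a" where
  "psqrt_on E P =
     (THE R. bounded_clinear_on E E R \<and> (\<forall>x\<in>E. cinner (R x) x \<in> \<real>\<^sub>\<ge>\<^sub>0) \<and>
        (\<forall>x\<in>E. R (R x) = P x) \<and> (\<forall>x. x \<notin> E \<longrightarrow> R x = 0))"

text \<open>\<open>D\<^sub>T\<close> and \<open>D\<^bsub>T*\<^esub>\<close> for \<open>T\<close> from \<open>E\<close> to \<open>F\<close>, and the closures of their ranges.\<close>

definition defect_on ::
    "'a :: complex_inner set \<Rightarrow> 'b :: complex_inner set \<Rightarrow> ('a \<Rightarrow> 'b) \<Rightarrow> 'a \<Rightarrow> 'a" where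
  "defect_on E F T = psqrt_on E (\<lambda>x. x - adj_on E F T (T x))"

definition codefect_on ::
    "'a :: complex_inner set \<Rightarrow> 'b :: complex_inner set \<Rightarrow> ('a \<Rightarrow> 'b) \<Rightarrow> 'b \<Rightarrow> 'b" where
  "codefect_on E F T = psqrt_on F (\<lambda>y. y - T (adj_on E F T y))"

definition defect_space_on ::
    "'a :: complex_inner set \<Rightarrow> 'b :: complex_inner set \<Rightarrow> ('a \<Rightarrow> 'b) \<Rightarrow> 'a set" where
  "defect_space_on E F T = closure (defect_on E F T ` E)"

definition codefect_space_on ::
    "'a :: complex_inner set \<Rightarrow> 'b :: complex_inner set \<Rightarrow> ('a \<Rightarrow> 'b) \<Rightarrow> 'b set" where
  "codefect_space_on E F T = closure (codefect_on E F T ` F)"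

text \<open>The case of operators defined on all of an ambient type.\<close>

abbreviation adj :: "('a :: complex_inner \<Rightarrow> 'b :: complex_inner) \<Rightarrow> 'b \<Rightarrow> 'a" where
  "adj \<equiv> adj_on UNIV UNIV"

abbreviation defect :: "('a :: complex_inner \<Rightarrow> 'b :: complex_inner) \<Rightarrow> 'a \<Rightarrow> 'a" where
  "defect \<equiv> defect_on UNIV UNIV"

abbreviation codefect :: "('a :: complex_inner \<Rightarrow> 'b :: complex_inner) \<Rightarrow> 'b \<Rightarrow> 'b" where
  "codefect \<equiv> codefect_on UNIV UNIV"

abbreviation defect_space :: "('a :: complex_inner \<Rightarrow> 'b :: complex_inner) \<Rightarrow> 'a set" where
  "defect_space \<equiv> defect_space_on UNIV UNIV"

abbreviation codefect_space :: "('a :: complex_inner \<Rightarrow> 'b :: complex_inner) \<Rightarrow> 'b set" where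
  "codefect_space \<equiv> codefect_space_on UNIV UNIV"

definition pure_contraction :: "('a :: complex_inner \<Rightarrow> 'a) \<Rightarrow> bool" where
  "pure_contraction T \<longleftrightarrow>
     contraction_on UNIV UNIV T \<and> (\<forall>x. (\<lambda>n. norm ((adj T ^^ n) x)) \<longlonglongrightarrow> 0)"

text \<open>The characteristic function, as an operator from \<^term>\<open>defect_space T\<close> to
  \<^term>\<open>codefect_space T\<close>.\<close>

definition char_fun :: "('a :: complex_inner \<Rightarrow> 'a) \<Rightarrow> complex \<Rightarrow> 'a \<Rightarrow> 'a" where
  "char_fun T z x = - T x + z *\<^sub>C codefect T (inv (\<lambda>u. u - z *\<^sub>C adj T u) (defect T x))"

section \<open>The space of square-integrable functions on the circle\<close>

text \<open>Lebesgue (rather than Borel) measurability makes it harmless to change a function on a null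
  set; boundary values are defined almost everywhere only.\<close>

abbreviation circ :: "real measure" where
  "circ \<equiv> lebesgue_on {0..2 * pi}"

definition sq_integrable :: "(real \<Rightarrow> 'a :: chilbert_space) \<Rightarrow> bool" where
  "sq_integrable f \<longleftrightarrow> f \<in> borel_measurable circ \<and> integrable circ (\<lambda>t. (norm (f t))\<^sup>2)"

definition L2_eq :: "(real \<Rightarrow> 'a :: chilbert_space) \<Rightarrow> (real \<Rightarrow> 'a) \<Rightarrow> bool" where
  "L2_eq f g \<longleftrightarrow> sq_integrable f \<and> sq_integrable g \<and> (AE t in circ. f t = g t)"

lemma sq_integrable_zero: "sq_integrable (\<lambda>t. 0)"
  by (simp add: sq_integrable_def)

quotient_type (overloaded) 'a L2 = "real \<Rightarrow> 'a :: chilbert_space" / partial: L2_eq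
proof (rule part_equivpI)
  show "\<exists>f :: real \<Rightarrow> 'a. L2_eq f f"
    by (rule exI[of _ "\<lambda>t. 0"]) (simp add: L2_eq_def sq_integrable_zero)
  show "symp (L2_eq :: (real \<Rightarrow> 'a) \<Rightarrow> _)"
    by (rule sympI) (auto simp: L2_eq_def eq_commute)
  show "transp (L2_eq :: (real \<Rightarrow> 'a) \<Rightarrow> _)"
    by (rule transpI) (auto simp: L2_eq_def elim: eventually_elim2)
qed

lemma sq_integrable_add:
  assumes "sq_integrable f" "sq_integrable g"
  shows "sq_integrable (\<lambda>t. f t + g t)"
proof -
  have [measurable]: "f \<in> borel_measurable circ" "g \<in> borel_measurable circ"
    using assms by (auto simp: sq_integrable_def)
  have "integrable circ (\<lambda>t. (norm (f t + g t))\<^sup>2)"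
  proof (rule Bochner_Integration.integrable_bound)
    show "integrable circ (\<lambda>t. 2 * (norm (f t))\<^sup>2 + 2 * (norm (g t))\<^sup>2)"
      using assms by (auto simp: sq_integrable_def)
    have "(norm (f t + g t))\<^sup>2 \<le> 2 * (norm (f t))\<^sup>2 + 2 * (norm (g t))\<^sup>2" for t
    proof -
      have "(norm (f t + g t))\<^sup>2 \<le> (norm (f t) + norm (g t))\<^sup>2"
        by (intro power_mono norm_triangle_ineq) auto
      also have "\<dots> \<le> 2 * (norm (f t))\<^sup>2 + 2 * (norm (g t))\<^sup>2"
        using sum_squares_bound[of "norm (f t)" "norm (g t)"] by (simp add: power2_sum)
      finally show ?thesis .
    qed
    then show "AE t in circ. norm ((norm (f t + g t))\<^sup>2)
        \<le> norm (2 * (norm (f t))\<^sup>2 + 2 * (norm (g t))\<^sup>2)"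
      by simp
  qed measurable
  then show ?thesis
    by (simp add: sq_integrable_def)
qed

lemma sq_integrable_scaleC:
  assumes "sq_integrable f"
  shows "sq_integrable (\<lambda>t. c *\<^sub>C f t)"
proof -
  have "(\<lambda>t. c *\<^sub>C f t) \<in> borel_measurable circ"
    using assms
    by (intro borel_measurable_continuous_on[OF linear_continuous_on[OF bounded_linear_scaleC]])
      (auto simp: sq_integrable_def)
  with assms show ?thesis
    by (auto simp: sq_integrable_def norm_scaleC power_mult_distrib)
qed

lemma uminus_scaleC: "- x = (- 1) *\<^sub>C (x :: 'a :: complex_inner)"
  using scaleR_scaleC[of "-1" x] by simp

lemma sq_integrable_uminus: "sq_integrable f \<Longrightarrow> sq_integrable (\<lambda>t. - f t)"
  using sq_integrable_scaleC[of f "- 1"] by (simp add: uminus_scaleC[symmetric])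

lemma sq_integrable_diff:
  "sq_integrable f \<Longrightarrow> sq_integrable g \<Longrightarrow> sq_integrable (\<lambda>t. f t - g t)"
  using sq_integrable_add[of f "\<lambda>t. - g t"] sq_integrable_uminus[of g] by simp

lemma sq_integrable_scaleR: "sq_integrable f \<Longrightarrow> sq_integrable (\<lambda>t. r *\<^sub>R f t)"
  unfolding scaleR_scaleC by (rule sq_integrable_scaleC)

lemma integrable_inner:
  assumes "sq_integrable f" "sq_integrable g"
  shows "integrable circ (\<lambda>t. inner (f t) (g t))"
proof -
  have [measurable]: "f \<in> borel_measurable circ" "g \<in> borel_measurable circ"
    using assms by (auto simp: sq_integrable_def)
  show ?thesis
  proof (rule Bochner_Integration.integrable_bound)
    show "integrable circ (\<lambda>t. (norm (f t))\<^sup>2 + (norm (g t))\<^sup>2)"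
      using assms by (auto simp: sq_integrable_def)
    have "\<bar>inner (f t) (g t)\<bar> \<le> (norm (f t))\<^sup>2 + (norm (g t))\<^sup>2" for t
      using Cauchy_Schwarz_ineq2[of "f t" "g t"]
        sum_squares_bound[of "norm (f t)" "norm (g t)"]
        mult_nonneg_nonneg[OF norm_ge_zero[of "f t"] norm_ge_zero[of "g t"]]
      by linarith
    then show "AE t in circ. norm (inner (f t) (g t))
        \<le> norm ((norm (f t))\<^sup>2 + (norm (g t))\<^sup>2)"
      by simp
  qed measurable
qed

lemma integrable_cinner:
  assumes "sq_integrable f" "sq_integrable g"
  shows "integrable circ (\<lambda>t. cinner (f t) (g t))"
proof -
  have "integrable circ (\<lambda>t. complex_of_real (inner (f t) (g t))
      + \<i> * complex_of_real (inner (f t) (\<i> *\<^sub>C g t)))"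
    using assms by (intro Bochner_Integration.integrable_add integrable_mult_right
        integrable_of_real integrable_inner sq_integrable_scaleC)
  then show ?thesis
    by (simp add: cinner_eq_inner Complex_eq)
qed

instantiation L2 :: (chilbert_space) complex_inner
begin

lift_definition zero_L2 :: "'a L2" is "\<lambda>t. 0"
  by (simp add: L2_eq_def sq_integrable_zero)

lift_definition plus_L2 :: "'a L2 \<Rightarrow> 'a L2 \<Rightarrow> 'a L2" is "\<lambda>f g t. f t + g t"
  by (auto simp: L2_eq_def sq_integrable_add elim: eventually_elim2)

lift_definition minus_L2 :: "'a L2 \<Rightarrow> 'a L2 \<Rightarrow> 'a L2" is "\<lambda>f g t. f t - g t"
  by (auto simp: L2_eq_def sq_integrable_diff elim: eventually_elim2)

lift_definition uminus_L2 :: "'a L2 \<Rightarrow> 'a L2" is "\<lambda>f t. - f t"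
  by (auto simp: L2_eq_def sq_integrable_uminus)

lift_definition scaleR_L2 :: "real \<Rightarrow> 'a L2 \<Rightarrow> 'a L2" is "\<lambda>r f t. r *\<^sub>R f t"
  by (auto simp: L2_eq_def sq_integrable_scaleR elim: eventually_mono)

lift_definition scaleC_L2 :: "complex \<Rightarrow> 'a L2 \<Rightarrow> 'a L2" is "\<lambda>c f t. c *\<^sub>C f t"
  by (auto simp: L2_eq_def sq_integrable_scaleC elim: eventually_mono)

lift_definition cinner_L2 :: "'a L2 \<Rightarrow> 'a L2 \<Rightarrow> complex" is
  "\<lambda>f g. LINT t|circ. cinner (f t) (g t)"
  unfolding L2_eq_def
  by (intro integral_cong_AE borel_measurable_integrable integrable_cinner)
    (auto elim: eventually_elim2)

definition inner_L2 :: "'a L2 \<Rightarrow> 'a L2 \<Rightarrow> real" where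
  "inner_L2 f g = Re (cinner f g)"

definition norm_L2 :: "'a L2 \<Rightarrow> real" where
  "norm_L2 f = sqrt (inner f f)"

definition dist_L2 :: "'a L2 \<Rightarrow> 'a L2 \<Rightarrow> real" where
  "dist_L2 f g = norm (f - g)"

definition sgn_L2 :: "'a L2 \<Rightarrow> 'a L2" where
  "sgn_L2 f = inverse (norm f) *\<^sub>R f"

definition uniformity_L2 :: "('a L2 \<times> 'a L2) filter" where
  "uniformity_L2 = (INF e\<in>{0<..}. principal {(f, g). dist f g < e})"

definition open_L2 :: "'a L2 set \<Rightarrow> bool" where
  "open_L2 U \<longleftrightarrow> (\<forall>f\<in>U. \<forall>\<^sub>F (f', g) in uniformity. f' = f \<longrightarrow> g \<in> U)"

instance
proof
  fix f g h :: "'a L2" and r s :: real and c d :: complex and U :: "'a L2 set"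
  show "f + g + h = f + (g + h)"
    by transfer (auto simp: L2_eq_def sq_integrable_add add.assoc)
  show "f + g = g + f"
    by transfer (auto simp: L2_eq_def sq_integrable_add add.commute)
  show "0 + f = f"
    by transfer (auto simp: L2_eq_def)
  show "- f + f = 0"
    by transfer (auto simp: L2_eq_def sq_integrable_zero)
  show "f - g = f + - g"
    by transfer (auto simp: L2_eq_def sq_integrable_diff)
  show "r *\<^sub>R (f + g) = r *\<^sub>R f + r *\<^sub>R g"
    by transfer (auto simp: L2_eq_def scaleR_add_right
        intro!: sq_integrable_add sq_integrable_scaleR)
  show "(r + s) *\<^sub>R f = r *\<^sub>R f + s *\<^sub>R f"
    by transfer (auto simp: L2_eq_def scaleR_add_left
        intro!: sq_integrable_add sq_integrable_scaleR)
  show "r *\<^sub>R s *\<^sub>R f = (r * s) *\<^sub>R f"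
    by transfer (auto simp: L2_eq_def sq_integrable_scaleR)
  show "1 *\<^sub>R f = f"
    by transfer (auto simp: L2_eq_def)
  show "sgn f = inverse (norm f) *\<^sub>R f"
    by (fact sgn_L2_def)
  show "dist f g = norm (f - g)"
    by (fact dist_L2_def)
  show "(uniformity :: ('a L2 \<times> 'a L2) filter)
      = (INF e\<in>{0<..}. principal {(f, g). dist f g < e})"
    by (fact uniformity_L2_def)
  show "open U \<longleftrightarrow> (\<forall>f\<in>U. \<forall>\<^sub>F (f', g) in uniformity. f' = f \<longrightarrow> g \<in> U)"
    by (fact open_L2_def)
  show "norm f = sqrt (inner f f)"
    by (fact norm_L2_def)
  show "c *\<^sub>C (f + g) = c *\<^sub>C f + c *\<^sub>C g"
    by transfer (auto simp: L2_eq_def scaleC_add_right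
        intro!: sq_integrable_add sq_integrable_scaleC)
  show "(c + d) *\<^sub>C f = c *\<^sub>C f + d *\<^sub>C f"
    by transfer (auto simp: L2_eq_def scaleC_add_left
        intro!: sq_integrable_add sq_integrable_scaleC)
  show "c *\<^sub>C d *\<^sub>C f = (c * d) *\<^sub>C f"
    by transfer (auto simp: L2_eq_def scaleC_scaleC intro!: sq_integrable_scaleC)
  show "r *\<^sub>R f = complex_of_real r *\<^sub>C f"
    by transfer (auto simp: L2_eq_def scaleR_scaleC intro!: sq_integrable_scaleC)
  have comm: "cinner f g = cnj (cinner g f)" for f g :: "'a L2"
  proof transfer
    fix u v :: "real \<Rightarrow> 'a"
    have "(LINT t|circ. cinner (u t) (v t)) = (LINT t|circ. cnj (cinner (v t) (u t)))"
      by (rule Bochner_Integration.integral_cong[OF refl]) (rule cinner_commute)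
    then show "(LINT t|circ. cinner (u t) (v t)) = cnj (LINT t|circ. cinner (v t) (u t))"
      by simp
  qed
  show "cinner f g = cnj (cinner g f)"
    by (fact comm)
  have add: "cinner (f + g) h = cinner f h + cinner g h" for f g h :: "'a L2"
    by transfer (simp add: L2_eq_def cinner_add_left integrable_cinner)
  show "cinner (f + g) h = cinner f h + cinner g h"
    by (fact add)
  have scale: "cinner (c *\<^sub>C f) g = c * cinner f g" for f g :: "'a L2" and c
    by transfer (simp add: L2_eq_def cinner_scaleC_left integrable_cinner)
  show "cinner (c *\<^sub>C f) g = c * cinner f g"
    by (fact scale)
  show "inner f g = Re (cinner f g)"
    by (fact inner_L2_def)
  show "inner f g = inner g f"
    unfolding inner_L2_def by (subst comm) simp
  show "inner (f + g) h = inner f h + inner g h"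
    by (simp add: inner_L2_def add)
  have rc: "r *\<^sub>R f = complex_of_real r *\<^sub>C f"
    by transfer (auto simp: L2_eq_def scaleR_scaleC intro!: sq_integrable_scaleC)
  show "inner (r *\<^sub>R f) g = r * inner f g"
    by (simp add: inner_L2_def rc scale)
  have Re: "Re (LINT t|circ. cinner (u t) (u t)) = (LINT t|circ. (norm (u t))\<^sup>2)"
    if "sq_integrable u" for u :: "real \<Rightarrow> 'a"
    using that by (subst integral_Re[symmetric])
      (auto simp: integrable_cinner power2_norm_eq_inner inner_eq_Re_cinner)
  show "0 \<le> inner f f"
    unfolding inner_L2_def by transfer (auto simp: L2_eq_def Re)
  show "inner f f = 0 \<longleftrightarrow> f = 0"
    unfolding inner_L2_def
  proof transfer
    fix u :: "real \<Rightarrow> 'a"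
    assume "L2_eq u u"
    then have u: "sq_integrable u"
      by (simp add: L2_eq_def)
    have "(LINT t|circ. (norm (u t))\<^sup>2) = 0 \<longleftrightarrow> (AE t in circ. (norm (u t))\<^sup>2 = 0)"
      using u by (intro integral_nonneg_eq_0_iff_AE) (auto simp: sq_integrable_def)
    then show "Re (LINT t|circ. cinner (u t) (u t)) = 0 \<longleftrightarrow> L2_eq u (\<lambda>t. 0)"
      using u by (simp add: Re L2_eq_def sq_integrable_zero)
  qed
qed

end

text \<open>The subspace \<open>L\<^sup>2(E)\<close> of the classes of \<open>E\<close>-valued functions.\<close>

definition L2_on :: "'a :: chilbert_space set \<Rightarrow> 'a L2 set" where
  "L2_on E = {f. AE t in circ. rep_L2 f t \<in> E}"

section \<open>Contractive analytic functions and regular factorizations\<close>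

text \<open>Analyticity on the disc is complex differentiability with respect to the operator norm.\<close>

definition analytic_op_fun ::
    "'a :: chilbert_space set \<Rightarrow> 'b :: chilbert_space set \<Rightarrow> (complex \<Rightarrow> 'a \<Rightarrow> 'b) \<Rightarrow> bool" where
  "analytic_op_fun E F \<Theta> \<longleftrightarrow>
     (\<forall>z\<in>ball 0 1. bounded_clinear_on E F (\<Theta> z)) \<and>
     (\<forall>z\<in>ball 0 1. \<exists>G. bounded_clinear_on E F G \<and>
        (\<forall>\<epsilon>>0. \<forall>\<^sub>F w in at z. \<forall>x\<in>E.
           norm (\<Theta> w x - \<Theta> z x - (w - z) *\<^sub>C G x) \<le> \<epsilon> * cmod (w - z) * norm x))"

definition contractive_analytic ::
    "'a :: chilbert_space set \<Rightarrow> 'b :: chilbert_space set \<Rightarrow> (complex \<Rightarrow> 'a \<Rightarrow> 'b) \<Rightarrow> bool" where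
  "contractive_analytic E F \<Theta> \<longleftrightarrow>
     closed_csubspace E \<and> closed_csubspace F \<and> analytic_op_fun E F \<Theta> \<and>
     (\<forall>z\<in>ball 0 1. contraction_on E F (\<Theta> z))"

definition boundary_value ::
    "(complex \<Rightarrow> 'a :: chilbert_space \<Rightarrow> 'b :: chilbert_space) \<Rightarrow> real \<Rightarrow> 'a \<Rightarrow> 'b" where
  "boundary_value \<Theta> t x = Lim (at_left 1) (\<lambda>r. \<Theta> (complex_of_real r * cis t) x)"

definition mult_op ::
    "(complex \<Rightarrow> 'a :: chilbert_space \<Rightarrow> 'b :: chilbert_space) \<Rightarrow> 'a L2 \<Rightarrow> 'b L2" where
  "mult_op \<Theta> v = abs_L2 (\<lambda>t. boundary_value \<Theta> t (rep_L2 v t))"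

text \<open>\<open>\<Delta>\<^sub>\<Theta>\<close> on \<open>L\<^sup>2(E)\<close> and the closure of its range.\<close>

definition Delta ::
    "'a :: chilbert_space set \<Rightarrow> 'b :: chilbert_space set \<Rightarrow> (complex \<Rightarrow> 'a \<Rightarrow> 'b) \<Rightarrow> 'a L2 \<Rightarrow> 'a L2"
  where "Delta E F \<Theta> = defect_on (L2_on E) (L2_on F) (mult_op \<Theta>)"

definition Delta_space ::
    "'a :: chilbert_space set \<Rightarrow> 'b :: chilbert_space set \<Rightarrow> (complex \<Rightarrow> 'a \<Rightarrow> 'b) \<Rightarrow> 'a L2 set"
  where "Delta_space E F \<Theta> = closure (Delta E F \<Theta> ` L2_on E)"

text \<open>The continuous extension of
  \<open>\<Delta>\<^sub>\<Theta> f \<mapsto> \<Delta>\<^sub>3 \<Theta>\<^sub>2 \<Theta>\<^sub>1 f \<oplus> \<Delta>\<^sub>2 \<Theta>\<^sub>1 f \<oplus> \<Delta>\<^sub>1 f\<close> to \<^term>\<open>Delta_space E1 E4 \<Theta>\<close>, put to \<open>0\<close> off that space.\<close>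

definition Z3 ::
    "'a :: chilbert_space set \<Rightarrow> 'b :: chilbert_space set \<Rightarrow> 'c :: chilbert_space set \<Rightarrow>
     'd :: chilbert_space set \<Rightarrow> (complex \<Rightarrow> 'a \<Rightarrow> 'd) \<Rightarrow> (complex \<Rightarrow> 'c \<Rightarrow> 'd) \<Rightarrow>
     (complex \<Rightarrow> 'b \<Rightarrow> 'c) \<Rightarrow> (complex \<Rightarrow> 'a \<Rightarrow> 'b) \<Rightarrow> 'a L2 \<Rightarrow> 'c L2 \<times> 'b L2 \<times> 'a L2" where
  "Z3 E1 E2 E3 E4 \<Theta> \<Theta>3 \<Theta>2 \<Theta>1 =
     (THE Z. continuous_on (Delta_space E1 E4 \<Theta>) Z \<and>
        (\<forall>f\<in>L2_on E1. Z (Delta E1 E4 \<Theta> f) =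
           (Delta E3 E4 \<Theta>3 (mult_op \<Theta>2 (mult_op \<Theta>1 f)), Delta E2 E3 \<Theta>2 (mult_op \<Theta>1 f),
            Delta E1 E2 \<Theta>1 f)) \<and>
        (\<forall>g. g \<notin> Delta_space E1 E4 \<Theta> \<longrightarrow> Z g = 0))"

definition regular_factorization3 ::
    "'a :: chilbert_space set \<Rightarrow> 'b :: chilbert_space set \<Rightarrow> 'c :: chilbert_space set \<Rightarrow>
     'd :: chilbert_space set \<Rightarrow> (complex \<Rightarrow> 'a \<Rightarrow> 'd) \<Rightarrow> (complex \<Rightarrow> 'c \<Rightarrow> 'd) \<Rightarrow>
     (complex \<Rightarrow> 'b \<Rightarrow> 'c) \<Rightarrow> (complex \<Rightarrow> 'a \<Rightarrow> 'b) \<Rightarrow> bool" where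
  "regular_factorization3 E1 E2 E3 E4 \<Theta> \<Theta>3 \<Theta>2 \<Theta>1 \<longleftrightarrow>
     contractive_analytic E1 E4 \<Theta> \<and> contractive_analytic E1 E2 \<Theta>1 \<and>
     contractive_analytic E2 E3 \<Theta>2 \<and> contractive_analytic E3 E4 \<Theta>3 \<and>
     (\<forall>z\<in>ball 0 1. \<forall>x\<in>E1. \<Theta> z x = \<Theta>3 z (\<Theta>2 z (\<Theta>1 z x))) \<and>
     unitary_on (Delta_space E1 E4 \<Theta>)
       (Delta_space E3 E4 \<Theta>3 \<times> Delta_space E2 E3 \<Theta>2 \<times> Delta_space E1 E2 \<Theta>1)
       (Z3 E1 E2 E3 E4 \<Theta> \<Theta>3 \<Theta>2 \<Theta>1)"

section \<open>Upper triangular contractions\<close>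

definition upper_triangular ::
    "('a \<Rightarrow> 'a :: plus) \<Rightarrow> ('b \<Rightarrow> 'a) \<Rightarrow> ('b \<Rightarrow> 'b) \<Rightarrow> 'a \<times> 'b \<Rightarrow> 'a \<times> 'b" where
  "upper_triangular A X B = (\<lambda>(x, y). (A x + X y, B y))"

text \<open>The factors \<open>\<Theta>'\<^sub>1\<close>, \<open>\<Theta>'\<^sub>2\<close>, \<open>\<Theta>'\<^sub>3\<close>; \<open>L\<close> is an operator from \<open>E\<close> to \<open>F\<close>, and \<open>E\<^sub>0\<close> is the
  domain on which \<open>\<tau>'\<close> (that is, \<open>\<tau>\<^sub>*\<close>) is inverted.\<close>

definition Theta1' ::
    "('a :: chilbert_space \<Rightarrow> 'a) \<Rightarrow> ('c \<Rightarrow> 'a \<times> 'b) \<Rightarrow> complex \<Rightarrow> 'c \<Rightarrow> 'a \<times> 'b" where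
  "Theta1' A \<tau> z x = (case \<tau> x of (u, v) \<Rightarrow> (char_fun A z u, v))"

definition Theta2' ::
    "'b :: chilbert_space set \<Rightarrow> 'a :: chilbert_space set \<Rightarrow> ('b \<Rightarrow> 'a) \<Rightarrow>
     complex \<Rightarrow> 'a \<times> 'b \<Rightarrow> 'b \<times> 'a" where
  "Theta2' E F L z =
     (\<lambda>(u, v). (adj_on E F L u + defect_on E F L v, codefect_on E F L u - L v))"

definition Theta3' ::
    "('b :: chilbert_space \<Rightarrow> 'b) \<Rightarrow> 'c set \<Rightarrow> ('c \<Rightarrow> 'b \<times> 'a) \<Rightarrow> complex \<Rightarrow> 'b \<times> 'a \<Rightarrow> 'c" where
  "Theta3' B E\<^sub>0 \<tau>' z = (\<lambda>(u, v). inv_into E\<^sub>0 \<tau>' (char_fun B z u, v))"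

end

theory Submission
  imports Defs
begin

text \<open>
  The middle factor \<open>\<Theta>'\<^sub>2\<close> is a constant unitary, namely the Julia operator of \<open>L\<close>. So \<open>\<Delta>\<^sub>2 = 0\<close>, and \<open>Z\<^sub>3\<close>, which is
  always isometric by \<open>\<parallel>\<Delta>\<^sub>\<Theta> f\<parallel>\<^sup>2 = \<parallel>f\<parallel>\<^sup>2 - \<parallel>\<Theta> f\<parallel>\<^sup>2\<close> and telescoping, is unitary as soon as its range is dense. Let \<open>(g, 0, h)\<close>
  be orthogonal to the range and put \<open>k = \<Delta>\<^sub>3 g\<close>. Then \<open>\<langle>\<Theta>'\<^sub>2 \<Theta>'\<^sub>1 f, k\<rangle> + \<langle>\<Delta>\<^sub>1 f, h\<rangle> = 0\<close> for all \<open>f\<close>, hence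
  \<open>\<langle>\<Theta>'\<^sub>2 \<Theta>'\<^sub>1 f, k\<rangle> = 0\<close> for all \<open>f\<close> with \<open>\<parallel>\<Theta>'\<^sub>1 f\<parallel> = \<parallel>f\<parallel>\<close>. Everything follows once \<open>k = 0\<close>, because defect operators are
  injective on their defect spaces (\<open>regular_factorization3I\<close>, \<open>regularI\<close>). There are three situations.

  \<^item> If \<open>B\<close> is pure, then \<open>\<Theta>\<^sub>B\<close> is inner, \<open>\<Theta>'\<^sub>3\<close> is isometric and \<open>\<Delta>\<^sub>3 = 0\<close>. If \<open>T\<close> is pure, then so is \<open>B\<close>, because \<open>T*\<close>
    restricts to \<open>B*\<close> on the second summand.

  \<^item> If \<open>A*\<close> is pure, then \<open>\<Theta>\<^bsub>A*\<^esub>\<close> is inner. As \<open>\<Theta>\<^sub>A(z)* = \<Theta>\<^bsub>A*\<^esub>(cnj z)\<close>, the boundary values of \<open>\<Theta>\<^sub>A\<close> are coisometries.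
    So \<open>\<Theta>'\<^sub>1\<close> maps the functions \<open>f\<close> with \<open>\<parallel>\<Theta>'\<^sub>1 f\<parallel> = \<parallel>f\<parallel>\<close> onto the whole space, and \<open>k\<close> is orthogonal to
    everything.

  \<^item> If \<open>L\<close> is proper, then \<open>D\<^sub>L\<close> is injective. As \<open>\<Theta>'\<^sub>3\<close> is isometric on the functions \<open>(0, s)\<close>, \<open>k\<close> has the form \<open>(k\<^sub>1, 0)\<close>;
    the test functions \<open>f = \<tau>\<^sup>-\<^sup>1 (0, f\<^sub>2)\<close> give \<open>D\<^sub>L k\<^sub>1 = 0\<close>.

  The rest is the theory that gives these statements a meaning. Adjoints come from the Riesz representation
  theorem. Square roots come from the binomial series of \<open>(1 - c)\<^bsup>1/2\<^esup>\<close> at \<open>c = T*T\<close>, which makes \<open>T D\<^sub>T = D\<^bsub>T*\<^esub> T\<close> and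
  the isometry of Julia operators immediate. The boundary values exist by a vector-valued version of Fatou's theorem
  (\<open>pseries_radial_limit\<close>): \<open>\<Theta>\<^sub>T(z) x\<close> is a power series with coefficients \<open>-T x\<close> and \<open>D\<^bsub>T*\<^esub> T*\<^sup>n D\<^sub>T x\<close>, whose square sum telescopes to
  at most \<open>\<parallel>x\<parallel>\<^sup>2\<close>, with equality if \<open>T\<close> is pure. The latter together with Parseval's identity is the reason why
  \<open>\<Theta>\<^sub>T\<close> is inner for pure \<open>T\<close>. The maximal inequality behind Fatou's theorem follows from the Vitali covering lemma. Finally
  \<open>L\<^sup>2\<close> is shown to be complete, so that all of this can be applied to multiplication operators.
\<close>

section \<open>Hilbert spaces and their closed subspaces\<close>

text \<open>Hilbert spaces without separability; the space \<open>L\<^sup>2\<close> of vector-valued functions becomes an instance once its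
  completeness is known.\<close>

class complex_hilbert = complex_inner + complete_space

subclass (in complex_hilbert) banach ..

instance chilbert_space \<subseteq> complex_hilbert ..

instance prod :: (complex_hilbert, complex_hilbert) complex_hilbert ..

lemma scaleC_one [simp]: "1 *\<^sub>C x = (x :: 'a :: complex_inner)"
  using scaleR_scaleC[of 1 x] by simp

lemma scaleC_zero_left [simp]: "0 *\<^sub>C x = (0 :: 'a :: complex_inner)"
  using scaleR_scaleC[of 0 x] by simp

lemma scaleC_zero_right [simp]: "c *\<^sub>C 0 = (0 :: 'a :: complex_inner)"
  using scaleC_add_right[of c 0 0] by simp

lemma scaleC_minus_right [simp]: "c *\<^sub>C (- x) = - (c *\<^sub>C x :: 'a :: complex_inner)"
  using scaleC_add_right[of c x "- x"] by (simp add: eq_neg_iff_add_eq_0 add.commute)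

lemma scaleC_diff_right: "c *\<^sub>C (x - y) = c *\<^sub>C x - (c *\<^sub>C y :: 'a :: complex_inner)"
  using scaleC_add_right[of c x "- y"] by simp

lemma scaleC_minus_left [simp]: "(- c) *\<^sub>C x = - (c *\<^sub>C x :: 'a :: complex_inner)"
  using scaleC_add_left[of c "- c" x] by (simp add: eq_neg_iff_add_eq_0 add.commute)

lemma scaleC_diff_left: "(c - d) *\<^sub>C x = c *\<^sub>C x - (d *\<^sub>C x :: 'a :: complex_inner)"
  using scaleC_add_left[of c "- d" x] by simp

lemma cinner_add_right: "cinner x (y + z) = cinner x y + cinner x (z :: 'a :: complex_inner)"
  by (metis cinner_add_left cinner_commute complex_cnj_add)

lemma cinner_zero_left [simp]: "cinner 0 (x :: 'a :: complex_inner) = 0"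
  using cinner_scaleC_left[of 0 0 x] by simp

lemma cinner_zero_right [simp]: "cinner (x :: 'a :: complex_inner) 0 = 0"
  using cinner_scaleC_right[of x 0 0] by simp

lemma cinner_minus_left [simp]: "cinner (- x) y = - cinner x (y :: 'a :: complex_inner)"
  using cinner_scaleC_left[of "-1" x y] by simp

lemma cinner_minus_right [simp]: "cinner x (- y) = - cinner x (y :: 'a :: complex_inner)"
  using cinner_scaleC_right[of x "-1" y] by simp

lemma cinner_diff_left: "cinner (x - y) z = cinner x z - cinner y (z :: 'a :: complex_inner)"
  using cinner_add_left[of x "- y" z] by simp

lemma cinner_diff_right: "cinner x (y - z) = cinner x y - cinner x (z :: 'a :: complex_inner)"
  using cinner_add_right[of x y "- z"] by simp

lemma cinner_self: "cinner x x = complex_of_real ((norm (x :: 'a :: complex_inner))\<^sup>2)"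
proof -
  have "Im (cinner x x) = 0"
    using arg_cong[OF cinner_commute[of x x], of Im] by simp
  then show ?thesis
    by (simp add: complex_eq_iff power2_norm_eq_inner inner_eq_Re_cinner)
qed

lemma cmod_cinner_le: "cmod (cinner x y) \<le> norm x * norm (y :: 'a :: complex_inner)"
proof (cases "cinner x y = 0")
  case False
  define c where "c = cnj (cinner x y) / cmod (cinner x y)"
  have c: "cmod c = 1"
    using False by (simp add: c_def norm_divide)
  have "c * cinner x y = cmod (cinner x y)"
    using False by (simp add: c_def complex_norm_square[symmetric] power2_eq_square field_simps
        flip: of_real_mult)
  then have "cmod (cinner x y) = inner (c *\<^sub>C x) y"
    by (simp add: inner_eq_Re_cinner cinner_scaleC_left)
  also have "\<dots> \<le> norm (c *\<^sub>C x) * norm y"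
    by (rule norm_cauchy_schwarz)
  finally show ?thesis
    by (simp add: norm_scaleC c)
qed auto

lemma cinner_eqI:
  assumes "\<And>c. inner (c *\<^sub>C x) y = Re (c * w)"
  shows "cinner x (y :: 'a :: complex_inner) = w"
  using assms[of 1] assms[of "- \<i>"]
  by (simp add: inner_eq_Re_cinner cinner_scaleC_left complex_eq_iff)

lemma norm_add_sq:
  "(norm (x + y))\<^sup>2 = (norm x)\<^sup>2 + 2 * Re (cinner x y) + (norm (y :: 'a :: complex_inner))\<^sup>2"
  by (simp add: power2_norm_eq_inner inner_add_left inner_add_right inner_eq_Re_cinner[symmetric]
      inner_commute)

lemma norm_diff_sq:
  "(norm (x - y))\<^sup>2 = (norm x)\<^sup>2 - 2 * Re (cinner x y) + (norm (y :: 'a :: complex_inner))\<^sup>2"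
  using norm_add_sq[of x "- y"] by simp

lemma norm_prod_sq: "(norm x)\<^sup>2 = (norm (fst x))\<^sup>2 + (norm (snd x))\<^sup>2"
  by (cases x) (simp add: norm_Pair)

lemma bounded_linear_cinner_left: "bounded_linear (\<lambda>x. cinner x (y :: 'a :: complex_inner))"
  by (rule bounded_linear_intro[where K = "norm y"])
    (auto simp: cinner_add_left scaleR_scaleC cinner_scaleC_left scaleC_complex_def cmod_cinner_le)

lemma bounded_linear_cinner_right: "bounded_linear (\<lambda>y. cinner (x :: 'a :: complex_inner) y)"
  by (rule bounded_linear_intro[where K = "norm x"])
    (auto simp: cinner_add_right scaleR_scaleC cinner_scaleC_right scaleC_complex_def
      cmod_cinner_le mult.commute[of _ "norm x"])

lemma cinner_sum_left: "cinner (sum f I) (y :: 'a :: complex_inner) = (\<Sum>i\<in>I. cinner (f i) y)"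
  using linear_sum[OF bounded_linear.linear[OF bounded_linear_cinner_left]] by fast

lemma cinner_sum_right: "cinner (x :: 'a :: complex_inner) (sum f I) = (\<Sum>i\<in>I. cinner x (f i))"
  using linear_sum[OF bounded_linear.linear[OF bounded_linear_cinner_right]] by fast

lemma cinner_scaleR_left: "cinner (r *\<^sub>R x) (y :: 'a :: complex_inner) = complex_of_real r * cinner x y"
  by (simp add: scaleR_scaleC cinner_scaleC_left)

lemma cinner_scaleR_right: "cinner (x :: 'a :: complex_inner) (r *\<^sub>R y) = complex_of_real r * cinner x y"
  by (simp add: scaleR_scaleC cinner_scaleC_right)

lemma closed_csubspaceD:
  assumes "closed_csubspace E"
  shows "closed E" "0 \<in> E" "\<And>x y. x \<in> E \<Longrightarrow> y \<in> E \<Longrightarrow> x + y \<in> E" "\<And>c x. x \<in> E \<Longrightarrow> c *\<^sub>C x \<in> E"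
  using assms by (auto simp: closed_csubspace_def)

lemma closed_csubspace_more:
  assumes "closed_csubspace E"
  shows "\<And>x. x \<in> E \<Longrightarrow> - x \<in> E" "\<And>x y. x \<in> E \<Longrightarrow> y \<in> E \<Longrightarrow> x - y \<in> E" "\<And>r x. x \<in> E \<Longrightarrow> r *\<^sub>R x \<in> E"
proof -
  show m: "- x \<in> E" if "x \<in> E" for x
    using closed_csubspaceD(4)[OF assms that, of "-1"] by simp
  show "x - y \<in> E" if "x \<in> E" "y \<in> E" for x y
    using closed_csubspaceD(3)[OF assms that(1) m[OF that(2)]] by simp
  show "r *\<^sub>R x \<in> E" if "x \<in> E" for r x
    using closed_csubspaceD(4)[OF assms that] by (simp add: scaleR_scaleC)
qed

lemma closed_csubspace_sum:
  assumes "closed_csubspace E" "\<And>i. i \<in> I \<Longrightarrow> f i \<in> E"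
  shows "sum f I \<in> E"
  using assms(2)
  by (induction I rule: infinite_finite_induct)
    (auto simp: closed_csubspaceD(2)[OF assms(1)] closed_csubspaceD(3)[OF assms(1)])

lemma closed_csubspace_UNIV [simp]: "closed_csubspace UNIV"
  by (simp add: closed_csubspace_def)

lemma closed_csubspace_Times:
  assumes "closed_csubspace E" "closed_csubspace F"
  shows "closed_csubspace (E \<times> F)"
  using closed_csubspaceD[OF assms(1)] closed_csubspaceD[OF assms(2)]
  by (auto simp: closed_csubspace_def scaleC_prod_def zero_prod_def intro: closed_Times)

lemma clinear_onD:
  assumes "clinear_on E F f"
  shows "\<And>x. x \<in> E \<Longrightarrow> f x \<in> F" "\<And>x y. x \<in> E \<Longrightarrow> y \<in> E \<Longrightarrow> f (x + y) = f x + f y"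
    "\<And>c x. x \<in> E \<Longrightarrow> f (c *\<^sub>C x) = c *\<^sub>C f x"
  using assms by (auto simp: clinear_on_def)

lemma clinear_on_more:
  assumes "closed_csubspace E" "clinear_on E F f"
  shows "f 0 = 0" "\<And>x. x \<in> E \<Longrightarrow> f (- x) = - f x"
    "\<And>x y. x \<in> E \<Longrightarrow> y \<in> E \<Longrightarrow> f (x - y) = f x - f y"
    "\<And>r x. x \<in> E \<Longrightarrow> f (r *\<^sub>R x) = r *\<^sub>R f x"
proof -
  note E = closed_csubspaceD[OF assms(1)] closed_csubspace_more[OF assms(1)]
  note f = clinear_onD[OF assms(2)]
  show "f 0 = 0"
    using f(3)[OF E(2), of 0] by simp
  show m: "f (- x) = - f x" if "x \<in> E" for x
    using f(3)[OF that, of "-1"] by simp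
  show "f (x - y) = f x - f y" if "x \<in> E" "y \<in> E" for x y
    using f(2)[OF that(1) E(5)[OF that(2)]] m[OF that(2)] by simp
  show "f (r *\<^sub>R x) = r *\<^sub>R f x" if "x \<in> E" for r x
    using f(3)[OF that] by (simp add: scaleR_scaleC)
qed

lemma clinear_on_sum:
  assumes "closed_csubspace E" "clinear_on E F f" "\<And>i. i \<in> I \<Longrightarrow> g i \<in> E"
  shows "f (sum g I) = (\<Sum>i\<in>I. f (g i))"
  using assms(3)
  by (induction I rule: infinite_finite_induct)
    (auto simp: clinear_on_more(1)[OF assms(1,2)] clinear_onD(2)[OF assms(2)]
      closed_csubspace_sum[OF assms(1)])

lemma closed_csubspace_closure_image:
  assumes "closed_csubspace E" "clinear_on E F f" "closed_csubspace F"
  shows "closed_csubspace (closure (f ` E))" "closure (f ` E) \<subseteq> F"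
proof -
  note E = closed_csubspaceD[OF assms(1)] and f = clinear_onD[OF assms(2)]
  have "x + y \<in> closure (f ` E)" if x: "x \<in> closure (f ` E)" and y: "y \<in> closure (f ` E)" for x y
  proof -
    obtain a where a: "\<And>n. a n \<in> f ` E" "a \<longlonglongrightarrow> x"
      using x unfolding closure_sequential by blast
    obtain b where b: "\<And>n. b n \<in> f ` E" "b \<longlonglongrightarrow> y"
      using y unfolding closure_sequential by blast
    have "a n + b n \<in> f ` E" for n
      using a(1)[of n] b(1)[of n] E(3) f(2) by (force simp: image_iff)
    moreover have "(\<lambda>n. a n + b n) \<longlonglongrightarrow> x + y"
      by (intro tendsto_add a b)
    ultimately show ?thesis
      unfolding closure_sequential by (intro exI[of _ "\<lambda>n. a n + b n"]) auto
  qed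
  moreover have "c *\<^sub>C x \<in> closure (f ` E)" if x: "x \<in> closure (f ` E)" for c x
  proof -
    obtain a where a: "\<And>n. a n \<in> f ` E" "a \<longlonglongrightarrow> x"
      using x unfolding closure_sequential by blast
    have "c *\<^sub>C a n \<in> f ` E" for n
      using a(1)[of n] E(4)[of _ c] f(3)[of _ c, symmetric] by auto
    moreover have "(\<lambda>n. c *\<^sub>C a n) \<longlonglongrightarrow> c *\<^sub>C x"
      by (intro bounded_linear.tendsto[OF bounded_linear_scaleC] a)
    ultimately show ?thesis
      unfolding closure_sequential by (intro exI[of _ "\<lambda>n. c *\<^sub>C a n"]) auto
  qed
  moreover have "0 \<in> closure (f ` E)"
    using closure_subset[of "f ` E"] E(2) clinear_on_more(1)[OF assms(1,2)] by (metis image_eqI subsetD)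
  ultimately show "closed_csubspace (closure (f ` E))"
    by (auto simp: closed_csubspace_def)
  show "closure (f ` E) \<subseteq> F"
    using f(1) closed_csubspaceD(1)[OF assms(3)] by (intro closure_minimal) auto
qed

section \<open>The Riesz representation theorem and adjoints\<close>

text \<open>The first variation at a minimum: a quadratic function of \<open>t\<close> that vanishes at \<open>0\<close> and is nonnegative
  has no linear term.\<close>

lemma quadratic_nonneg_imp_zero:
  assumes "\<And>t :: real. 0 \<le> t\<^sup>2 * a + 2 * t * b"
  shows "b = 0"
proof (rule ccontr)
  assume "b \<noteq> 0"
  define a' where "a' = \<bar>a\<bar> + 1"
  have a': "a' > 0" "a \<le> a'"
    by (auto simp: a'_def)
  have "0 \<le> (- b / a')\<^sup>2 * a + 2 * (- b / a') * b"
    by (rule assms)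
  also have "\<dots> \<le> (- b / a')\<^sup>2 * a' + 2 * (- b / a') * b"
    using a' by (intro add_right_mono mult_left_mono) auto
  also have "\<dots> = - b\<^sup>2 / a'"
    using a' by (simp add: field_simps power2_eq_square)
  also have "\<dots> < 0"
    using a' \<open>b \<noteq> 0\<close> by simp
  finally show False
    by simp
qed

text \<open>The representing vector minimises the functional \<open>\<parallel>x\<parallel>\<^sup>2 - 2 Re (f x)\<close> on \<open>E\<close>. It is bounded
  below, the parallelogram law makes minimising sequences Cauchy, and the first variation at the
  minimum vanishes.\<close>

lemma riesz_representation:
  fixes E :: "'a :: complex_hilbert set" and f :: "'a \<Rightarrow> complex"
  assumes E: "closed_csubspace E" and f: "bounded_clinear_on E UNIV f"
  obtains x where "x \<in> E" "\<And>u. u \<in> E \<Longrightarrow> f u = cinner u x"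
proof -
  note ED = closed_csubspaceD[OF E] closed_csubspace_more[OF E]
  have fl: "clinear_on E UNIV f"
    using f by (auto simp: bounded_clinear_on_def)
  note fD = clinear_onD[OF fl] clinear_on_more[OF E fl]
  obtain K where K: "\<And>x. x \<in> E \<Longrightarrow> cmod (f x) \<le> K * norm x"
    using f by (auto simp: bounded_clinear_on_def)
  define J where "J x = (norm x)\<^sup>2 - 2 * Re (f x)" for x
  have lower: "J x \<ge> - K\<^sup>2" if "x \<in> E" for x
  proof -
    have "Re (f x) \<le> K * norm x"
      using K[OF that] complex_Re_le_cmod[of "f x"] by linarith
    moreover have "0 \<le> (norm x - K)\<^sup>2"
      by simp
    ultimately show ?thesis
      by (simp add: J_def power2_diff algebra_simps)
  qed
  define d where "d = Inf (J ` E)"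
  have bdd: "bdd_below (J ` E)"
    using lower by (rule bdd_belowI2)
  have d_le: "d \<le> J x" if "x \<in> E" for x
    unfolding d_def using bdd that by (intro cInf_lower) auto
  have "\<exists>x\<in>E. J x < d + 1 / Suc n" for n
  proof -
    have "Inf (J ` E) < d + 1 / Suc n"
      by (simp add: d_def)
    then show ?thesis
      using ED(2) by (subst (asm) cInf_less_iff[OF _ bdd]) auto
  qed
  then obtain x where x: "\<And>n. x n \<in> E" "\<And>n. J (x n) < d + 1 / Suc n"
    by metis
  \<comment> \<open>parallelogram law: the midpoint of two almost minimisers cannot lie below the minimum\<close>
  have par: "(norm (u - v))\<^sup>2 \<le> 2 * (J u - d) + 2 * (J v - d)" if "u \<in> E" "v \<in> E" for u v
  proof -
    have m: "(1/2) *\<^sub>R (u + v) \<in> E"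
      using that ED by auto
    have "J ((1/2) *\<^sub>R (u + v)) = (norm (u + v))\<^sup>2 / 4 - Re (f u) - Re (f v)"
      using that ED fD by (simp add: J_def power_divide add_divide_distrib)
    then have "d \<le> (norm (u + v))\<^sup>2 / 4 - Re (f u) - Re (f v)"
      using d_le[OF m] by simp
    then have "4 * d \<le> (norm (u + v))\<^sup>2 - 4 * Re (f u) - 4 * Re (f v)"
      by simp
    then show ?thesis
      using norm_add_sq[of u v] norm_diff_sq[of u v] by (simp add: J_def algebra_simps)
  qed
  have "Cauchy x"
  proof (rule metric_CauchyI)
    fix e :: real
    assume e: "e > 0"
    then obtain N where N: "1 / Suc N < e\<^sup>2 / 4"
      using reals_Archimedean[of "e\<^sup>2 / 4"] by (auto simp: inverse_eq_divide)
    have "dist (x m) (x n) < e" if "m \<ge> N" "n \<ge> N" for m n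
    proof -
      have J: "J (x k) - d < e\<^sup>2 / 4" if "k \<ge> N" for k
      proof -
        have "1 / real (Suc k) \<le> 1 / Suc N"
          using that by (simp add: frac_le)
        then show ?thesis
          using x(2)[of k] N by linarith
      qed
      have "(norm (x m - x n))\<^sup>2 < e\<^sup>2"
        using par[OF x(1)[of m] x(1)[of n]] J[OF that(1)] J[OF that(2)]
        by (simp add: field_simps)
      then show ?thesis
        using e by (simp add: dist_norm power2_less_imp_less)
    qed
    then show "\<exists>M. \<forall>m\<ge>M. \<forall>n\<ge>M. dist (x m) (x n) < e"
      by blast
  qed
  then obtain l where l: "x \<longlonglongrightarrow> l"
    using Cauchy_convergent_iff convergent_def by blast
  have lE: "l \<in> E"
    using ED(1) x(1) l closed_sequentially by blast
  have "(\<lambda>n. f (x n)) \<longlonglongrightarrow> f l"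
  proof (rule LIM_zero_cancel, rule Lim_transform_bound)
    show "\<forall>\<^sub>F n in sequentially. norm (f (x n) - f l) \<le> norm (K * norm (x n - l))"
      using K[OF ED(6)[OF x(1) lE]] fD(6)[OF x(1) lE] abs_ge_self order_trans
      by (intro always_eventually allI) fastforce
    show "(\<lambda>n. K * norm (x n - l)) \<longlonglongrightarrow> 0"
      using tendsto_mult[OF tendsto_const tendsto_norm_zero[OF LIM_zero[OF l]], of K] by simp
  qed
  then have "(\<lambda>n. J (x n)) \<longlonglongrightarrow> J l"
    unfolding J_def by (intro tendsto_intros l)
  moreover have "(\<lambda>n. d + 1 / Suc n) \<longlonglongrightarrow> d + 0"
    using LIMSEQ_inverse_real_of_nat by (intro tendsto_intros) (simp add: inverse_eq_divide)
  ultimately have "J l \<le> d + 0"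
    using x(2) by (intro LIMSEQ_le[of _ "J l"]) (auto intro: less_imp_le)
  then have Jl: "J l \<le> J v" if "v \<in> E" for v
    using d_le[OF that] by simp
  have re: "Re (f u) = inner u l" if "u \<in> E" for u
  proof -
    have "0 \<le> t\<^sup>2 * (norm u)\<^sup>2 + 2 * t * (inner u l - Re (f u))" for t :: real
    proof -
      have "J l \<le> J (l + t *\<^sub>R u)"
        using that lE ED by (intro Jl) auto
      then show ?thesis
        using that lE ED fD
        by (simp add: J_def norm_add_sq power_mult_distrib algebra_simps
            inner_eq_Re_cinner[symmetric] inner_commute)
    qed
    from quadratic_nonneg_imp_zero[OF this] show ?thesis
      by simp
  qed
  have "f u = cinner u l" if "u \<in> E" for u
    using re[OF ED(4)[OF that]] fD(3)[OF that]
    by (intro cinner_eqI[symmetric]) (metis scaleC_complex_def)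
  with lE that show thesis
    by blast
qed

lemma adj_on:
  fixes E :: "'a :: complex_hilbert set"
  assumes E: "closed_csubspace E" and T: "bounded_clinear_on E F T"
  shows adj_on_in: "adj_on E F T y \<in> E"
    and adj_on_cinner: "\<And>u. u \<in> E \<Longrightarrow> cinner (T u) y = cinner u (adj_on E F T y)"
proof -
  have lin: "clinear_on E F T"
    using T by (auto simp: bounded_clinear_on_def)
  obtain K where K: "\<And>x. x \<in> E \<Longrightarrow> norm (T x) \<le> K * norm x"
    using T by (auto simp: bounded_clinear_on_def)
  have "bounded_clinear_on E UNIV (\<lambda>u. cinner (T u) y)"
    unfolding bounded_clinear_on_def
  proof
    show "clinear_on E UNIV (\<lambda>u. cinner (T u) y)"
      using clinear_onD[OF lin]
      by (auto simp: clinear_on_def cinner_add_left cinner_scaleC_left scaleC_complex_def)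
    have "cmod (cinner (T u) y) \<le> (K * norm y) * norm u" if "u \<in> E" for u
    proof -
      have "cmod (cinner (T u) y) \<le> norm (T u) * norm y"
        by (rule cmod_cinner_le)
      also have "\<dots> \<le> (K * norm u) * norm y"
        using K[OF that] by (intro mult_right_mono) auto
      finally show ?thesis
        by (simp add: mult_ac)
    qed
    then show "\<exists>K. \<forall>x\<in>E. norm (cinner (T x) y) \<le> K * norm x"
      by blast
  qed
  then obtain x where x: "x \<in> E" "\<And>u. u \<in> E \<Longrightarrow> cinner (T u) y = cinner u x"
    using riesz_representation[OF E] by metis
  have "\<exists>!x. x \<in> E \<and> (\<forall>u\<in>E. cinner (T u) y = cinner u x)"
  proof (rule ex1I[of _ x])
    fix x'
    assume x': "x' \<in> E \<and> (\<forall>u\<in>E. cinner (T u) y = cinner u x')"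
    have "cinner (x' - x) (x' - x) = 0"
      using x x' closed_csubspace_more(2)[OF E, of x' x]
      by (subst cinner_diff_right) (metis right_minus_eq)
    then show "x' = x"
      by (simp add: cinner_self)
  qed (use x in auto)
  from theI'[OF this]
  show "adj_on E F T y \<in> E" "\<And>u. u \<in> E \<Longrightarrow> cinner (T u) y = cinner u (adj_on E F T y)"
    by (auto simp: adj_on_def)
qed

lemma adj_on_unique:
  fixes E :: "'a :: complex_hilbert set"
  assumes "closed_csubspace E" "bounded_clinear_on E F T"
    and "x \<in> E" "\<And>u. u \<in> E \<Longrightarrow> cinner (T u) y = cinner u x"
  shows "adj_on E F T y = x"
proof -
  let ?d = "adj_on E F T y - x"
  have d: "?d \<in> E"
    using closed_csubspace_more(2)[OF assms(1) adj_on_in[OF assms(1,2)] assms(3)] .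
  have "cinner ?d ?d = 0"
    using adj_on_cinner[OF assms(1,2) d, of y] assms(4)[OF d] by (subst cinner_diff_right) simp
  then show ?thesis
    by (simp add: cinner_self)
qed

text \<open>A vector of a closed subspace \<open>V\<close> lies in the closure of the range of an operator as soon as
  only \<open>0\<close> is orthogonal to that range: project it to the closure of the range.\<close>

lemma dense_range_if_orthogonal_trivial:
  fixes V :: "'b :: complex_hilbert set"
  assumes E: "closed_csubspace E" and V: "closed_csubspace V" and G: "clinear_on E V G"
    and orth: "\<And>w. w \<in> V \<Longrightarrow> (\<And>f. f \<in> E \<Longrightarrow> cinner (G f) w = 0) \<Longrightarrow> w = 0"
  shows "closure (G ` E) = V"
proof
  let ?R = "closure (G ` E)"
  note R = closed_csubspace_closure_image[OF E G V]
  show "?R \<subseteq> V"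
    by (rule R)
  show "V \<subseteq> ?R"
  proof
    fix v
    assume v: "v \<in> V"
    have "bounded_clinear_on ?R UNIV (\<lambda>u. cinner u v)"
      by (auto simp: bounded_clinear_on_def clinear_on_def cinner_add_left cinner_scaleC_left
          scaleC_complex_def intro!: exI[of _ "norm v"])
        (metis cmod_cinner_le mult.commute)
    then obtain p where p: "p \<in> ?R" "\<And>u. u \<in> ?R \<Longrightarrow> cinner u v = cinner u p"
      using riesz_representation[OF R(1)] by metis
    have "v - p = 0"
    proof (rule orth)
      show "v - p \<in> V"
        using closed_csubspace_more(2)[OF V v] p(1) R(2) by blast
      show "cinner (G f) (v - p) = 0" if "f \<in> E" for f
        using p(2)[of "G f"] closure_subset[of "G ` E"] that by (auto simp: cinner_diff_right)
    qed
    then show "v \<in> ?R"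
      using p(1) by simp
  qed
qed

section \<open>Square roots of positive operators\<close>

text \<open>The coefficients of the binomial series of \<open>(1 - c)\<^bsup>1/2\<^esup>\<close>. All but the first are nonpositive, and
  the partial sums are nonnegative, so the series converges absolutely on the closed unit ball of
  operators.\<close>

definition sqrt_coeff :: "nat \<Rightarrow> real" where
  "sqrt_coeff k = (- 1) ^ k * ((1/2) gchoose k)"

lemma sqrt_coeff_0 [simp]: "sqrt_coeff 0 = 1"
  by (simp add: sqrt_coeff_def)

lemma sqrt_coeff_1 [simp]: "sqrt_coeff (Suc 0) = - 1 / 2"
  by (simp add: sqrt_coeff_def)

lemma gbinomial_Suc_ratio: "a gchoose Suc k = (a - real k) / (real k + 1) * (a gchoose k)"
  using gbinomial_absorb_comp[of a k] gbinomial_absorption[of k a]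
  by (simp add: field_simps)

lemma sqrt_coeff_Suc: "sqrt_coeff (Suc k) = (real k - 1/2) / (real k + 1) * sqrt_coeff k"
  by (simp add: sqrt_coeff_def gbinomial_Suc_ratio field_simps)

lemma sqrt_coeff_nonpos: "sqrt_coeff (Suc k) \<le> 0"
proof (induction k)
  case (Suc k)
  then show ?case
    by (subst sqrt_coeff_Suc) (rule mult_nonneg_nonpos, auto)
qed simp

lemma sqrt_coeff_partial_sum: "0 \<le> (\<Sum>k\<le>m. sqrt_coeff k)"
proof -
  have "0 \<le> (- 1) ^ m * ((- 1/2 :: real) gchoose m)"
  proof (induction m)
    case (Suc m)
    have "(- 1) ^ Suc m * ((- 1/2 :: real) gchoose Suc m)
        = (real m + 1/2) / (real m + 1) * ((- 1) ^ m * ((- 1/2) gchoose m))"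
      by (simp add: gbinomial_Suc_ratio field_simps)
    also have "\<dots> \<ge> 0"
      by (rule mult_nonneg_nonneg[OF _ Suc]) simp
    finally show ?case .
  qed simp
  then show ?thesis
    using gbinomial_sum_lower_neg[of "1/2 :: real" m] by (simp add: sqrt_coeff_def mult.commute)
qed

lemma sum_abs_sqrt_coeff_le: "(\<Sum>k\<le>m. \<bar>sqrt_coeff k\<bar>) \<le> 2"
proof -
  have "(\<Sum>k\<le>m. \<bar>sqrt_coeff k\<bar>) = 2 - (\<Sum>k\<le>m. sqrt_coeff k)"
    using sqrt_coeff_nonpos by (induction m) (auto simp: abs_of_nonpos)
  then show ?thesis
    using sqrt_coeff_partial_sum[of m] by simp
qed

lemma summable_abs_sqrt_coeff: "summable (\<lambda>k. \<bar>sqrt_coeff k\<bar>)"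
proof (rule bounded_imp_summable)
  show "(\<Sum>k\<le>n. \<bar>sqrt_coeff k\<bar>) \<le> 2" for n
    by (rule sum_abs_sqrt_coeff_le)
qed auto

lemma suminf_abs_sqrt_coeff_le: "(\<Sum>k. \<bar>sqrt_coeff k\<bar>) \<le> 2"
proof (rule suminf_le_const[OF summable_abs_sqrt_coeff])
  show "(\<Sum>k<n. \<bar>sqrt_coeff k\<bar>) \<le> 2" for n
    using sum_abs_sqrt_coeff_le[of "n - 1"] by (cases n) (auto simp: lessThan_Suc_atMost)
qed

text \<open>The Cauchy square of the binomial series of \<open>(1 - c)\<^bsup>1/2\<^esup>\<close> is \<open>1 - c\<close>, by Vandermonde's identity.\<close>

lemma sqrt_coeff_convolution:
  "(\<Sum>i\<le>n. sqrt_coeff i * sqrt_coeff (n - i)) = (if n = 0 then 1 else if n = 1 then - 1 else 0)"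
proof -
  have "(\<Sum>i\<le>n. sqrt_coeff i * sqrt_coeff (n - i))
      = (\<Sum>i\<le>n. (- 1) ^ n * (((1/2) gchoose i) * ((1/2) gchoose (n - i))))"
    by (intro sum.cong refl) (simp add: sqrt_coeff_def power_add[symmetric] mult_ac)
  also have "\<dots> = (- 1) ^ n * ((1 :: real) gchoose n)"
    using gbinomial_Vandermonde[of "1/2 :: real" "1/2" n]
    by (simp add: sum_distrib_left[symmetric] atMost_atLeast0)
  also have "(1 :: real) gchoose n = real (1 choose n)"
    using binomial_gbinomial[of 1 n, where 'a = real] by simp
  finally show ?thesis
    by (cases n; cases "n - 1") auto
qed

lemma scaleC_scaleR: "c *\<^sub>C (r *\<^sub>R x) = r *\<^sub>R (c *\<^sub>C (x :: 'a :: complex_inner))"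
  unfolding scaleR_scaleC scaleC_scaleC by (simp only: mult.commute)

text \<open>The square root of \<open>I - C\<close> for a contraction \<open>C\<close>. A series in the powers of \<open>C\<close> is used because it
  makes all commutation properties evident.\<close>

definition sqrt_op :: "('a :: complex_hilbert \<Rightarrow> 'a) \<Rightarrow> 'a \<Rightarrow> 'a" where
  "sqrt_op C x = (\<Sum>k. sqrt_coeff k *\<^sub>R (C ^^ k) x)"

lemma bounded_clinear_on_tendsto:
  assumes E: "closed_csubspace E" and G: "bounded_clinear_on E F G"
    and f: "\<And>n. f n \<in> E" "(f \<longlongrightarrow> l) Fl" "l \<in> E"
  shows "((\<lambda>n. G (f n)) \<longlongrightarrow> G l) Fl"
proof -
  have lin: "clinear_on E F G"
    using G by (auto simp: bounded_clinear_on_def)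
  obtain K where K: "\<And>x. x \<in> E \<Longrightarrow> norm (G x) \<le> K * norm x"
    using G by (auto simp: bounded_clinear_on_def)
  show ?thesis
  proof (rule LIM_zero_cancel, rule Lim_transform_bound)
    have "norm (G (f n) - G l) \<le> norm (K * norm (f n - l))" for n
      using K[OF closed_csubspace_more(2)[OF E f(1) f(3), of n]]
        clinear_on_more(3)[OF E lin f(1) f(3), of n] abs_ge_self[of "K * norm (f n - l)"]
      by simp
    then show "\<forall>\<^sub>F n in Fl. norm (G (f n) - G l) \<le> norm (K * norm (f n - l))"
      by simp
    show "((\<lambda>n. K * norm (f n - l)) \<longlongrightarrow> 0) Fl"
      using tendsto_mult[OF tendsto_const tendsto_norm_zero[OF LIM_zero[OF f(2)]], of K] by simp
  qed
qed

lemma contraction_on_bounded: "contraction_on E F f \<Longrightarrow> bounded_clinear_on E F f"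
  unfolding contraction_on_def bounded_clinear_on_def by (auto intro!: exI[of _ 1])

lemma contraction_on_comp:
  "contraction_on E F f \<Longrightarrow> contraction_on F G g \<Longrightarrow> contraction_on E G (\<lambda>x. g (f x))"
  unfolding contraction_on_def clinear_on_def image_subset_iff by auto (meson order_trans)

locale hilbert_endo_contraction =
  fixes E :: "'a :: complex_hilbert set" and C
  assumes E: "closed_csubspace E" and C: "contraction_on E E C"
begin

lemma iterate: "contraction_on E E (C ^^ k)"
proof (induction k)
  case 0
  then show ?case
    by (auto simp: contraction_on_def clinear_on_def)
next
  case (Suc k)
  then show ?case
    using contraction_on_comp[OF Suc C] by (simp add: o_def)
qed

lemma iterate_in: "x \<in> E \<Longrightarrow> (C ^^ k) x \<in> E"
  and iterate_norm: "x \<in> E \<Longrightarrow> norm ((C ^^ k) x) \<le> norm x"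
  and iterate_clinear: "clinear_on E E (C ^^ k)"
  using iterate[of k] by (auto simp: contraction_on_def clinear_on_def)

lemma norm_term_le: "x \<in> E \<Longrightarrow> norm (sqrt_coeff k *\<^sub>R (C ^^ k) x) \<le> \<bar>sqrt_coeff k\<bar> * norm x"
  using iterate_norm[of x k] by (simp add: mult_left_mono)

lemma summable_norm_terms: "x \<in> E \<Longrightarrow> summable (\<lambda>k. norm (sqrt_coeff k *\<^sub>R (C ^^ k) x))"
  by (rule summable_comparison_test'[OF summable_mult2[OF summable_abs_sqrt_coeff, of "norm x"]])
    (use norm_term_le in auto)

lemma summable_terms: "x \<in> E \<Longrightarrow> summable (\<lambda>k. sqrt_coeff k *\<^sub>R (C ^^ k) x)"
  by (rule summable_norm_cancel[OF summable_norm_terms])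

lemma sqrt_op_LIMSEQ: "x \<in> E \<Longrightarrow> (\<lambda>n. \<Sum>k<n. sqrt_coeff k *\<^sub>R (C ^^ k) x) \<longlonglongrightarrow> sqrt_op C x"
  unfolding sqrt_op_def using summable_terms by (auto simp: summable_LIMSEQ)

lemma partial_sum_in: "x \<in> E \<Longrightarrow> (\<Sum>k<n. sqrt_coeff k *\<^sub>R (C ^^ k) x) \<in> E"
  by (intro closed_csubspace_sum[OF E] closed_csubspace_more(3)[OF E] iterate_in)

lemma sqrt_op_in: "x \<in> E \<Longrightarrow> sqrt_op C x \<in> E"
  using closed_sequentially[OF closed_csubspaceD(1)[OF E] _ sqrt_op_LIMSEQ] partial_sum_in by blast

lemma sqrt_op_bounded: "bounded_clinear_on E E (sqrt_op C)"
proof -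
  note it = clinear_onD[OF iterate_clinear]
  have "sqrt_op C (x + y) = sqrt_op C x + sqrt_op C y" if "x \<in> E" "y \<in> E" for x y
    using that unfolding sqrt_op_def
    by (simp add: it(2) scaleR_add_right suminf_add[OF summable_terms summable_terms])
  moreover have "sqrt_op C (c *\<^sub>C x) = c *\<^sub>C sqrt_op C x" if "x \<in> E" for c x
  proof -
    have "sqrt_coeff k *\<^sub>R (C ^^ k) (c *\<^sub>C x) = c *\<^sub>C (sqrt_coeff k *\<^sub>R (C ^^ k) x)" for k
      by (simp add: it(3)[OF that] scaleC_scaleR)
    then show ?thesis
      using bounded_linear.suminf[OF bounded_linear_scaleC summable_terms[OF that], of c]
      by (simp add: sqrt_op_def)
  qed
  moreover have "norm (sqrt_op C x) \<le> 2 * norm x" if "x \<in> E" for x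
  proof -
    have "norm (sqrt_op C x) \<le> (\<Sum>k. norm (sqrt_coeff k *\<^sub>R (C ^^ k) x))"
      unfolding sqrt_op_def by (rule summable_norm[OF summable_norm_terms[OF that]])
    also have "\<dots> \<le> (\<Sum>k. \<bar>sqrt_coeff k\<bar> * norm x)"
      by (rule suminf_le[OF norm_term_le[OF that] summable_norm_terms[OF that]
            summable_mult2[OF summable_abs_sqrt_coeff]])
    also have "\<dots> = (\<Sum>k. \<bar>sqrt_coeff k\<bar>) * norm x"
      by (rule suminf_mult2[OF summable_abs_sqrt_coeff, symmetric])
    also have "\<dots> \<le> 2 * norm x"
      by (intro mult_right_mono suminf_abs_sqrt_coeff_le) auto
    finally show ?thesis .
  qed
  ultimately show ?thesis
    unfolding bounded_clinear_on_def clinear_on_def using sqrt_op_in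
    by (auto intro!: exI[of _ 2])
qed

text \<open>An operator that intertwines two contractions intertwines their square roots, since it does so
  for every polynomial in them.\<close>

lemma sqrt_op_intertwine:
  fixes F :: "'b :: complex_hilbert set"
  assumes C': "hilbert_endo_contraction F C'" and G: "bounded_clinear_on E F G"
    and GC: "\<And>x. x \<in> E \<Longrightarrow> G (C x) = C' (G x)" and x: "x \<in> E"
  shows "G (sqrt_op C x) = sqrt_op C' (G x)"
proof -
  interpret C': hilbert_endo_contraction F C'
    by (rule C')
  have lin: "clinear_on E F G"
    using G by (auto simp: bounded_clinear_on_def)
  have pow: "G ((C ^^ k) x) = (C' ^^ k) (G x)" for k
    by (induction k) (auto simp: GC iterate_in x)
  have "(\<lambda>n. G (\<Sum>k<n. sqrt_coeff k *\<^sub>R (C ^^ k) x)) \<longlonglongrightarrow> G (sqrt_op C x)"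
    by (rule bounded_clinear_on_tendsto[OF E G partial_sum_in[OF x] sqrt_op_LIMSEQ[OF x]
          sqrt_op_in[OF x]])
  moreover have "G (\<Sum>k<n. sqrt_coeff k *\<^sub>R (C ^^ k) x)
      = (\<Sum>k<n. sqrt_coeff k *\<^sub>R (C' ^^ k) (G x))" for n
    by (simp add: clinear_on_sum[OF E lin] closed_csubspace_more(3)[OF E] iterate_in x
        clinear_on_more(4)[OF E lin] pow)
  ultimately show ?thesis
    using C'.sqrt_op_LIMSEQ[OF clinear_onD(1)[OF lin x]] by (simp add: LIMSEQ_unique)
qed

text \<open>The double series of \<open>(\<Sum> \<beta>\<^sub>i C\<^sup>i)\<^sup>2 x\<close>, with \<open>\<beta>\<^sub>i\<close> the coefficients of the binomial series, converges absolutely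
  and may be summed along the diagonals.\<close>

lemma sqrt_op_square:
  assumes x: "x \<in> E"
  shows "sqrt_op C (sqrt_op C x) = x - C x"
proof -
  define f where "f i j = (sqrt_coeff i * sqrt_coeff j) *\<^sub>R (C ^^ (i + j)) x" for i j
  have infsum_eq: "infsum g UNIV = suminf g" if "summable (\<lambda>n. norm (g n))" for g :: "nat \<Rightarrow> 'a"
    using norm_summable_imp_has_sum[OF that] that
    by (metis infsumI summable_norm_cancel summable_sums)
  have abs: "(\<lambda>k. \<bar>sqrt_coeff k\<bar> * r) summable_on UNIV" for r
    by (rule norm_summable_imp_summable_on)
      (use summable_mult2[OF summable_abs_sqrt_coeff, of "\<bar>r\<bar>"] in \<open>simp add: abs_mult\<close>)
  define g where "g = (\<lambda>(i, j). \<bar>sqrt_coeff i\<bar> * \<bar>sqrt_coeff j\<bar> * norm x)"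
  have "(\<lambda>p. norm (g p)) summable_on Sigma UNIV (\<lambda>_. UNIV)"
  proof (rule iffD2[OF Infinite_Sum.abs_summable_on_Sigma_iff], intro conjI ballI)
    show "(\<lambda>j. norm (g (i, j))) summable_on UNIV" for i
      using abs[of "\<bar>sqrt_coeff i\<bar> * norm x"] by (simp add: g_def abs_mult mult_ac)
    have "infsum (\<lambda>j. norm (g (i, j))) UNIV
        = \<bar>sqrt_coeff i\<bar> * (infsum (\<lambda>j. \<bar>sqrt_coeff j\<bar>) UNIV * norm x)" for i
      by (simp add: g_def abs_mult infsum_cmult_right' infsum_cmult_left' mult_ac)
    then show "(\<lambda>i. norm (infsum (\<lambda>j. norm (g (i, j))) UNIV)) summable_on UNIV"
      using abs[of "\<bar>infsum (\<lambda>j. \<bar>sqrt_coeff j\<bar>) UNIV * norm x\<bar>"] by (simp add: abs_mult)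
  qed
  then have "(\<lambda>p. norm (case p of (i, j) \<Rightarrow> f i j)) summable_on UNIV \<times> UNIV"
    by (rule Infinite_Sum.abs_summable_on_comparison_test)
      (auto simp: f_def g_def abs_mult intro!: mult_left_mono iterate_norm x)
  then have summ: "(\<lambda>(i, j). f i j) summable_on UNIV \<times> UNIV"
    by (rule abs_summable_summable)
  have inner: "infsum (f i) UNIV = sqrt_coeff i *\<^sub>R (C ^^ i) (sqrt_op C x)" for i
  proof -
    have eq: "f i j = sqrt_coeff i *\<^sub>R (sqrt_coeff j *\<^sub>R (C ^^ j) ((C ^^ i) x))" for j
      by (simp add: f_def funpow_add add.commute[of i j])
    have "infsum (f i) UNIV = suminf (f i)"
      using summable_mult[OF summable_norm_terms[OF iterate_in[OF x], of i], of "\<bar>sqrt_coeff i\<bar>"]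
      by (intro infsum_eq) (simp add: eq[abs_def] abs_mult mult_ac)
    also have "\<dots> = sqrt_coeff i *\<^sub>R sqrt_op C ((C ^^ i) x)"
      unfolding eq[abs_def] sqrt_op_def
      by (rule suminf_scaleR_right[symmetric]) (rule summable_terms[OF iterate_in[OF x]])
    also have "sqrt_op C ((C ^^ i) x) = (C ^^ i) (sqrt_op C x)"
    proof (rule sqrt_op_intertwine[OF _ _ _ x, symmetric])
      show "hilbert_endo_contraction E C"
        by unfold_locales
      show "bounded_clinear_on E E (C ^^ i)"
        by (rule contraction_on_bounded[OF iterate])
      show "(C ^^ i) (C y) = C ((C ^^ i) y)" for y
        by (rule funpow_swap1[symmetric])
    qed
    finally show ?thesis .
  qed
  have "sqrt_op C (sqrt_op C x) = infsum (\<lambda>i. infsum (f i) UNIV) UNIV"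
    unfolding inner using summable_norm_terms[OF sqrt_op_in[OF x]]
    by (subst infsum_eq) (simp_all add: sqrt_op_def[of C "sqrt_op C x"])
  also have "\<dots> = infsum (\<lambda>(i, j). f i j) (UNIV \<times> UNIV)"
    using infsum_Sigma'_banach[OF summ] by simp
  also have "\<dots> = infsum (\<lambda>(n, i). f i (n - i)) (Sigma UNIV (\<lambda>n. {..n}))"
    by (rule infsum_reindex_bij_witness[of _ "\<lambda>(n, i). (i, n - i)" "\<lambda>(i, j). (i + j, i)"]) auto
  also have "\<dots> = infsum (\<lambda>n. infsum (\<lambda>i. f i (n - i)) {..n}) UNIV"
  proof (rule infsum_Sigma'_banach[symmetric])
    show "(\<lambda>(n, i). f i (n - i)) summable_on Sigma UNIV (\<lambda>n. {..n})"
      using summ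
      by (subst summable_on_reindex_bij_witness[of "UNIV \<times> UNIV" "\<lambda>(n, i). (i, n - i)"
            "\<lambda>(i, j). (i + j, i)" _ "\<lambda>(n, i). f i (n - i)" "\<lambda>(i, j). f i j", symmetric]) auto
  qed
  also have "\<dots> = infsum (\<lambda>n. (if n = 0 then 1 else if n = 1 then - 1 else 0) *\<^sub>R (C ^^ n) x) UNIV"
  proof (rule infsum_cong)
    fix n
    have "infsum (\<lambda>i. f i (n - i)) {..n}
        = (\<Sum>i\<le>n. sqrt_coeff i * sqrt_coeff (n - i)) *\<^sub>R (C ^^ n) x"
      by (simp add: f_def scaleR_sum_left)
    then show "infsum (\<lambda>i. f i (n - i)) {..n}
        = (if n = 0 then 1 else if n = 1 then - 1 else 0) *\<^sub>R (C ^^ n) x"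
      by (simp only: sqrt_coeff_convolution)
  qed
  also have "\<dots> = infsum (\<lambda>n. (if n = 0 then 1 else if n = 1 then - 1 else 0) *\<^sub>R (C ^^ n) x) {0, 1}"
    by (rule infsum_cong_neutral) auto
  also have "\<dots> = x - C x"
    by simp
  finally show ?thesis .
qed

end


locale selfadjoint_contraction = hilbert_endo_contraction +
  assumes selfadj: "\<And>x y. x \<in> E \<Longrightarrow> y \<in> E \<Longrightarrow> cinner (C x) y = cinner x (C y)"
begin

lemma iterate_selfadj: "x \<in> E \<Longrightarrow> y \<in> E \<Longrightarrow> cinner ((C ^^ k) x) y = cinner x ((C ^^ k) y)"
proof (induction k arbitrary: y)
  case (Suc k)
  have Cy: "C y \<in> E"
    using iterate_in[OF Suc.prems(2), of 1] by simp
  show ?case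
    using selfadj[OF iterate_in[OF Suc.prems(1), of k] Suc.prems(2)] Suc.IH[OF Suc.prems(1) Cy]
    by (simp add: funpow_swap1)
qed simp

lemma sqrt_op_selfadj:
  assumes x: "x \<in> E" and y: "y \<in> E"
  shows "cinner (sqrt_op C x) y = cinner x (sqrt_op C y)"
proof -
  have "(\<lambda>n. cinner (\<Sum>k<n. sqrt_coeff k *\<^sub>R (C ^^ k) x) y) \<longlonglongrightarrow> cinner (sqrt_op C x) y"
    by (rule bounded_linear.tendsto[OF bounded_linear_cinner_left sqrt_op_LIMSEQ[OF x]])
  moreover have "(\<lambda>n. cinner x (\<Sum>k<n. sqrt_coeff k *\<^sub>R (C ^^ k) y)) \<longlonglongrightarrow> cinner x (sqrt_op C y)"
    by (rule bounded_linear.tendsto[OF bounded_linear_cinner_right sqrt_op_LIMSEQ[OF y]])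
  moreover have "cinner (\<Sum>k<n. sqrt_coeff k *\<^sub>R (C ^^ k) x) y
      = cinner x (\<Sum>k<n. sqrt_coeff k *\<^sub>R (C ^^ k) y)" for n
    by (simp add: cinner_sum_left cinner_sum_right cinner_scaleR_left cinner_scaleR_right
        iterate_selfadj[OF x y])
  ultimately show ?thesis
    by (simp add: LIMSEQ_unique)
qed

text \<open>Since \<open>\<beta>\<^sub>k \<le> 0\<close> for \<open>k \<ge> 1\<close> and \<open>Re \<langle>C\<^sup>k x, x\<rangle> \<le> \<parallel>x\<parallel>\<^sup>2\<close>, the partial sums of the form are at least
  \<open>\<parallel>x\<parallel>\<^sup>2 \<Sum> \<beta>\<^sub>k \<ge> 0\<close>.\<close>

lemma sqrt_op_nonneg:
  assumes x: "x \<in> E"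
  shows "cinner (sqrt_op C x) x \<in> \<real>\<^sub>\<ge>\<^sub>0"
proof -
  have "0 \<le> Re (cinner (\<Sum>k<n. sqrt_coeff k *\<^sub>R (C ^^ k) x) x)" for n
  proof -
    have "0 \<le> (\<Sum>k<n. sqrt_coeff k * (norm x)\<^sup>2)"
      using sqrt_coeff_partial_sum[of "n - 1"]
      by (cases n) (auto simp: lessThan_Suc_atMost sum_distrib_right[symmetric])
    also have "\<dots> \<le> (\<Sum>k<n. sqrt_coeff k * Re (cinner ((C ^^ k) x) x))"
    proof (rule sum_mono)
      fix k
      show "sqrt_coeff k * (norm x)\<^sup>2 \<le> sqrt_coeff k * Re (cinner ((C ^^ k) x) x)"
      proof (cases k)
        case 0
        then show ?thesis
          by (simp add: cinner_self)
      next
        case (Suc j)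
        have "Re (cinner ((C ^^ k) x) x) \<le> norm ((C ^^ k) x) * norm x"
          using cmod_cinner_le complex_Re_le_cmod order_trans by blast
        also have "\<dots> \<le> (norm x)\<^sup>2"
          using iterate_norm[OF x, of k] by (simp add: power2_eq_square mult_right_mono)
        finally show ?thesis
          using sqrt_coeff_nonpos[of j] Suc by (simp add: mult_left_mono_neg)
      qed
    qed
    also have "\<dots> = Re (cinner (\<Sum>k<n. sqrt_coeff k *\<^sub>R (C ^^ k) x) x)"
      by (simp add: cinner_sum_left cinner_scaleR_left)
    finally show ?thesis .
  qed
  moreover have "(\<lambda>n. Re (cinner (\<Sum>k<n. sqrt_coeff k *\<^sub>R (C ^^ k) x) x))
      \<longlonglongrightarrow> Re (cinner (sqrt_op C x) x)"
    by (intro tendsto_Re bounded_linear.tendsto[OF bounded_linear_cinner_left sqrt_op_LIMSEQ[OF x]])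
  ultimately have "0 \<le> Re (cinner (sqrt_op C x) x)"
    by (intro LIMSEQ_le_const) auto
  moreover have "Im (cinner (sqrt_op C x) x) = 0"
    using sqrt_op_selfadj[OF x x] cinner_commute[of "sqrt_op C x" x] by (simp add: complex_eq_iff)
  ultimately show ?thesis
    by (simp add: complex_nonneg_Reals_iff)
qed

end

text \<open>Polarization: the form is real at \<open>x + c y\<close>, which for \<open>c = 1\<close> and \<open>c = \<i>\<close> determines the imaginary and
  the real part of \<open>\<langle>R x, y\<rangle> - \<langle>x, R y\<rangle>\<close>.\<close>

lemma positive_imp_selfadjoint:
  assumes E: "closed_csubspace E" and R: "clinear_on E E R"
    and pos: "\<And>x. x \<in> E \<Longrightarrow> cinner (R x) x \<in> \<real>\<^sub>\<ge>\<^sub>0" and x: "x \<in> E" and y: "y \<in> E"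
  shows "cinner (R x) y = cinner x (R y)"
proof -
  have im: "Im (cnj c * cinner (R x) y + c * cinner (R y) x) = 0" for c
  proof -
    have cy: "c *\<^sub>C y \<in> E"
      by (rule closed_csubspaceD(4)[OF E y])
    have "Im (cinner (R (x + c *\<^sub>C y)) (x + c *\<^sub>C y)) = 0"
      using pos[OF closed_csubspaceD(3)[OF E x cy]] by (simp add: complex_nonneg_Reals_iff)
    moreover have "Im (cinner (R x) x) = 0" "Im (cinner (R y) y) = 0"
      using pos[OF x] pos[OF y] by (simp_all add: complex_nonneg_Reals_iff)
    moreover have "cinner (R (x + c *\<^sub>C y)) (x + c *\<^sub>C y) = cinner (R x) x + cnj c * cinner (R x) y
        + c * cinner (R y) x + (c * cnj c) * cinner (R y) y"
      using clinear_onD(2)[OF R x cy] clinear_onD(3)[OF R y, of c]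
      by (simp add: cinner_add_left cinner_add_right cinner_scaleC_left cinner_scaleC_right
          algebra_simps)
    moreover have "Im ((c * cnj c) * cinner (R y) y) = 0"
      using \<open>Im (cinner (R y) y) = 0\<close> by simp
    ultimately show ?thesis
      by simp
  qed
  have "cinner (R x) y = cnj (cinner (R y) x)"
    using im[of 1] im[of \<i>] by (simp add: complex_eq_iff)
  then show ?thesis
    using cinner_commute[of x "R y"] by simp
qed

text \<open>Test the form at \<open>z + t R z\<close>: its linear coefficient in \<open>t\<close> is \<open>2 \<parallel>R z\<parallel>\<^sup>2\<close>.\<close>

lemma positive_form_zero_imp_zero:
  assumes E: "closed_csubspace E" and R: "clinear_on E E R"
    and pos: "\<And>x. x \<in> E \<Longrightarrow> cinner (R x) x \<in> \<real>\<^sub>\<ge>\<^sub>0" and z: "z \<in> E" and Rz: "cinner (R z) z = 0"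
  shows "R z = 0"
proof -
  have w: "R z \<in> E"
    by (rule clinear_onD(1)[OF R z])
  have "0 \<le> t\<^sup>2 * Re (cinner (R (R z)) (R z)) + 2 * t * (norm (R z))\<^sup>2" for t :: real
  proof -
    have tw: "t *\<^sub>R R z \<in> E"
      by (rule closed_csubspace_more(3)[OF E w])
    have "0 \<le> Re (cinner (R (z + t *\<^sub>R R z)) (z + t *\<^sub>R R z))"
      using pos[OF closed_csubspaceD(3)[OF E z tw]] by (simp add: complex_nonneg_Reals_iff)
    also have "R (z + t *\<^sub>R R z) = R z + complex_of_real t *\<^sub>C R (R z)"
      using clinear_onD(2)[OF R z tw] clinear_on_more(4)[OF E R w, of t] by (simp add: scaleR_scaleC)
    also have "z + t *\<^sub>R R z = z + complex_of_real t *\<^sub>C R z"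
      by (simp add: scaleR_scaleC)
    finally show ?thesis
      using positive_imp_selfadjoint[OF E R pos w z] Rz
      by (simp add: cinner_add_left cinner_add_right cinner_scaleC_left cinner_scaleC_right
          cinner_self power2_eq_square algebra_simps)
  qed
  from quadratic_nonneg_imp_zero[OF this] show ?thesis
    by simp
qed

text \<open>Uniqueness of the square root: any positive square root \<open>R\<close> commutes with \<open>P = R\<^sup>2\<close>, hence with
  the series \<open>S\<close>; for \<open>y = (R - S) x\<close> this gives \<open>\<langle>R y, y\<rangle> + \<langle>S y, y\<rangle> = \<langle>(R\<^sup>2 - S\<^sup>2) x, y\<rangle> = 0\<close>, so \<open>R y = S y = 0\<close>
  and \<open>y = 0\<close>.\<close>

lemma (in selfadjoint_contraction) psqrt_on_eq:
  assumes P: "\<And>x. x \<in> E \<Longrightarrow> P x = x - C x"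
  shows "psqrt_on E P = (\<lambda>x. if x \<in> E then sqrt_op C x else 0)"
  unfolding psqrt_on_def
proof (rule the_equality)
  let ?S = "\<lambda>x. if x \<in> E then sqrt_op C x else 0"
  have "bounded_clinear_on E E ?S"
    using sqrt_op_bounded closed_csubspaceD[OF E]
    unfolding bounded_clinear_on_def clinear_on_def by auto
  then show "bounded_clinear_on E E ?S \<and> (\<forall>x\<in>E. cinner (?S x) x \<in> \<real>\<^sub>\<ge>\<^sub>0) \<and>
      (\<forall>x\<in>E. ?S (?S x) = P x) \<and> (\<forall>x. x \<notin> E \<longrightarrow> ?S x = 0)"
    by (simp add: sqrt_op_nonneg sqrt_op_square sqrt_op_in P)
  fix R
  assume R: "bounded_clinear_on E E R \<and> (\<forall>x\<in>E. cinner (R x) x \<in> \<real>\<^sub>\<ge>\<^sub>0) \<and>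
      (\<forall>x\<in>E. R (R x) = P x) \<and> (\<forall>x. x \<notin> E \<longrightarrow> R x = 0)"
  then have Rb: "bounded_clinear_on E E R" and Rpos: "\<And>x. x \<in> E \<Longrightarrow> cinner (R x) x \<in> \<real>\<^sub>\<ge>\<^sub>0"
    and Rsq: "\<And>x. x \<in> E \<Longrightarrow> R (R x) = x - C x" and R0: "\<And>x. x \<notin> E \<Longrightarrow> R x = 0"
    using P by auto
  have Rl: "clinear_on E E R" and Sl: "clinear_on E E (sqrt_op C)"
    using Rb sqrt_op_bounded by (auto simp: bounded_clinear_on_def)
  have "R x = sqrt_op C x" if x: "x \<in> E" for x
  proof -
    have Rx: "R x \<in> E" and Sx: "sqrt_op C x \<in> E"
      using clinear_onD(1)[OF Rl x] sqrt_op_in[OF x] by auto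
    have Cin: "C x \<in> E" if "x \<in> E" for x
      using iterate_in[OF that, of 1] by simp
    have comm: "R (sqrt_op C x) = sqrt_op C (R x)"
    proof (rule sqrt_op_intertwine[OF _ Rb _ x])
      show "hilbert_endo_contraction E C"
        by unfold_locales
      show "R (C u) = C (R u)" if "u \<in> E" for u
      proof -
        have "R (R (R u)) = R u - R (C u)"
          using Rsq[OF that] clinear_on_more(3)[OF E Rl that Cin[OF that]] by simp
        then show ?thesis
          using Rsq[OF clinear_onD(1)[OF Rl that]] by simp
      qed
    qed
    define y where "y = R x - sqrt_op C x"
    have y: "y \<in> E"
      unfolding y_def by (rule closed_csubspace_more(2)[OF E Rx Sx])
    have Ry: "R y = R (R x) - R (sqrt_op C x)" and Sy: "sqrt_op C y = sqrt_op C (R x) - sqrt_op C (sqrt_op C x)"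
      unfolding y_def using clinear_on_more(3)[OF E Rl Rx Sx] clinear_on_more(3)[OF E Sl Rx Sx] by auto
    have "R y + sqrt_op C y = 0"
      by (simp add: Ry Sy comm Rsq[OF x] sqrt_op_square[OF x])
    then have sum0: "cinner (R y) y + cinner (sqrt_op C y) y = 0"
      by (metis cinner_add_left cinner_zero_left)
    have "cinner (R y) y = 0 \<and> cinner (sqrt_op C y) y = 0"
      using sum0 Rpos[OF y] sqrt_op_nonneg[OF y]
      by (auto simp: complex_nonneg_Reals_iff complex_eq_iff)
    then have "R y = 0" "sqrt_op C y = 0"
      using positive_form_zero_imp_zero[OF E Rl Rpos y] positive_form_zero_imp_zero[OF E Sl sqrt_op_nonneg y]
      by auto
    then have "cinner y y = 0"
      using positive_imp_selfadjoint[OF E Rl Rpos x y] sqrt_op_selfadj[OF x y]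
      by (subst (1) y_def) (simp add: cinner_diff_left)
    then show ?thesis
      by (simp add: cinner_self y_def)
  qed
  then show "R = ?S"
    using R0 by auto
qed

lemma psqrt_on_cong:
  assumes "\<And>x. x \<in> E \<Longrightarrow> P x = P' x"
  shows "psqrt_on E P = psqrt_on E P'"
  unfolding psqrt_on_def by (simp add: assms)

section \<open>Defect operators\<close>

locale subspace_contraction =
  fixes E :: "'a :: complex_hilbert set" and F :: "'b :: complex_hilbert set" and T
  assumes E: "closed_csubspace E" and F: "closed_csubspace F" and T: "contraction_on E F T"
begin

abbreviation "Ts \<equiv> adj_on E F T"
abbreviation "D \<equiv> defect_on E F T"
abbreviation "Ds \<equiv> codefect_on E F T"

lemma T_clinear: "clinear_on E F T"
  and T_norm: "x \<in> E \<Longrightarrow> norm (T x) \<le> norm x"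
  and T_in: "x \<in> E \<Longrightarrow> T x \<in> F"
  using T by (auto simp: contraction_on_def clinear_on_def)

lemma Ts_in: "Ts y \<in> E"
  by (rule adj_on_in[OF E contraction_on_bounded[OF T]])

lemma Ts_cinner: "u \<in> E \<Longrightarrow> cinner u (Ts y) = cinner (T u) y"
  by (rule adj_on_cinner[OF E contraction_on_bounded[OF T], symmetric])

lemma Ts_cinner': "u \<in> E \<Longrightarrow> cinner (Ts y) u = cinner y (T u)"
  by (metis Ts_cinner cinner_commute)

lemma Ts_norm: "norm (Ts y) \<le> norm y"
proof -
  have "(norm (Ts y))\<^sup>2 = cmod (cinner (Ts y) (Ts y))"
    by (simp add: cinner_self norm_power)
  also have "\<dots> = cmod (cinner (T (Ts y)) y)"
    by (simp add: Ts_cinner Ts_in)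
  also have "\<dots> \<le> norm (T (Ts y)) * norm y"
    by (rule cmod_cinner_le)
  also have "\<dots> \<le> norm (Ts y) * norm y"
    by (intro mult_right_mono T_norm Ts_in norm_ge_zero)
  finally show ?thesis
    by (cases "Ts y = 0") (auto simp: power2_eq_square)
qed

lemma adjoint_contraction: "subspace_contraction F E Ts"
proof
  have "Ts (x + y) = Ts x + Ts y" for x y
    by (rule adj_on_unique[OF E contraction_on_bounded[OF T]])
      (auto simp: cinner_add_right Ts_cinner Ts_in closed_csubspaceD(3)[OF E])
  moreover have "Ts (c *\<^sub>C x) = c *\<^sub>C Ts x" for c x
    by (rule adj_on_unique[OF E contraction_on_bounded[OF T]])
      (auto simp: cinner_scaleC_right Ts_cinner Ts_in closed_csubspaceD(4)[OF E])
  ultimately show "contraction_on F E Ts"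
    by (auto simp: contraction_on_def clinear_on_def Ts_in Ts_norm)
qed (fact F E)+

lemma Ts_clinear: "clinear_on F E Ts"
  using adjoint_contraction by (rule subspace_contraction.T_clinear)

lemma adj_adj: "x \<in> E \<Longrightarrow> adj_on F E Ts x = T x"
  by (rule adj_on_unique[OF F contraction_on_bounded[OF subspace_contraction.T[OF adjoint_contraction]]])
    (auto simp: T_in Ts_cinner')

lemma TsT: "selfadjoint_contraction E (\<lambda>x. Ts (T x))"
proof
  show "contraction_on E E (\<lambda>x. Ts (T x))"
    by (rule contraction_on_comp[OF T subspace_contraction.T[OF adjoint_contraction]])
qed (auto simp: Ts_cinner Ts_cinner' Ts_in T_in E)

lemma defect_eq: "D = (\<lambda>x. if x \<in> E then sqrt_op (\<lambda>x. Ts (T x)) x else 0)"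
  unfolding defect_on_def by (rule selfadjoint_contraction.psqrt_on_eq[OF TsT]) simp

lemma D_bounded: "bounded_clinear_on E E D"
proof -
  interpret TsT: selfadjoint_contraction E "\<lambda>x. Ts (T x)"
    by (rule TsT)
  show ?thesis
    using TsT.sqrt_op_bounded closed_csubspaceD[OF E]
    unfolding bounded_clinear_on_def clinear_on_def defect_eq by auto
qed

lemma D_clinear: "clinear_on E E D"
  using D_bounded by (simp add: bounded_clinear_on_def)

lemma D_in: "x \<in> E \<Longrightarrow> D x \<in> E"
  by (rule clinear_onD(1)[OF D_clinear])

lemma D_selfadj: "x \<in> E \<Longrightarrow> y \<in> E \<Longrightarrow> cinner (D x) y = cinner x (D y)"
  using selfadjoint_contraction.sqrt_op_selfadj[OF TsT] by (simp add: defect_eq)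

lemma D_square: "x \<in> E \<Longrightarrow> D (D x) = x - Ts (T x)"
  using selfadjoint_contraction.axioms(1)[OF TsT]
  by (simp add: defect_eq hilbert_endo_contraction.sqrt_op_square hilbert_endo_contraction.sqrt_op_in)

lemma D_norm_sq: "x \<in> E \<Longrightarrow> (norm (D x))\<^sup>2 = (norm x)\<^sup>2 - (norm (T x))\<^sup>2"
proof -
  assume x: "x \<in> E"
  have "cinner (D x) (D x) = cinner x x - cinner (T x) (T x)"
    using x by (simp add: D_selfadj[OF x D_in[OF x]] D_square cinner_diff_right Ts_cinner)
  then have "complex_of_real ((norm (D x))\<^sup>2) = complex_of_real ((norm x)\<^sup>2 - (norm (T x))\<^sup>2)"
    by (simp only: cinner_self of_real_diff)
  then show ?thesis
    by (simp only: of_real_eq_iff)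
qed

lemma D_norm: "x \<in> E \<Longrightarrow> norm (D x) \<le> norm x"
  using D_norm_sq[of x] by (intro power2_le_imp_le[OF _ norm_ge_zero]) simp

text \<open>As \<open>T** = T\<close>, facts about \<open>D\<^bsub>T*\<^esub>\<close> are instances of facts about \<open>D\<^sub>T\<close>.\<close>

lemma codefect_eq: "Ds = defect_on F E Ts"
  unfolding codefect_on_def defect_on_def by (rule psqrt_on_cong) (simp add: adj_adj Ts_in)

text \<open>The relation \<open>T (T*T) = (T T*) T\<close> passes to the square roots.\<close>

lemma T_D: "x \<in> E \<Longrightarrow> T (D x) = Ds (T x)"
proof -
  assume x: "x \<in> E"
  interpret adjoint: subspace_contraction F E Ts
    by (rule adjoint_contraction)
  have "T (sqrt_op (\<lambda>x. Ts (T x)) x) = sqrt_op (\<lambda>y. adjoint.Ts (Ts y)) (T x)"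
    using selfadjoint_contraction.axioms(1)[OF TsT] selfadjoint_contraction.axioms(1)[OF adjoint.TsT]
    by (rule hilbert_endo_contraction.sqrt_op_intertwine[OF _ _ contraction_on_bounded[OF T] _ x])
      (simp add: adj_adj Ts_in)
  then show ?thesis
    using x by (simp add: defect_eq codefect_eq adjoint.defect_eq T_in)
qed

lemma defect_space: "closed_csubspace (defect_space_on E F T)" "defect_space_on E F T \<subseteq> E"
  unfolding defect_space_on_def by (rule closed_csubspace_closure_image[OF E D_clinear E])+

lemma D_in_defect_space: "x \<in> E \<Longrightarrow> D x \<in> defect_space_on E F T"
  unfolding defect_space_on_def using closure_subset[of "D ` E"] by blast

lemma codefect_space_eq: "codefect_space_on E F T = defect_space_on F E Ts"
  by (simp add: codefect_space_on_def defect_space_on_def codefect_eq)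

text \<open>\<open>D\<close> is self-adjoint, so its kernel is orthogonal to its range.\<close>

lemma D_injective_on_defect_space:
  assumes w: "w \<in> defect_space_on E F T" and Dw: "D w = 0"
  shows "w = 0"
proof -
  have wE: "w \<in> E"
    using w defect_space(2) by blast
  obtain f where f: "\<And>n. f n \<in> D ` E" "f \<longlonglongrightarrow> w"
    using w unfolding defect_space_on_def closure_sequential by blast
  have "cinner w (f n) = 0" for n
    using f(1)[of n] D_selfadj[OF wE, symmetric] Dw by auto
  moreover have "(\<lambda>n. cinner w (f n)) \<longlonglongrightarrow> cinner w w"
    by (rule bounded_linear.tendsto[OF bounded_linear_cinner_right f(2)])
  ultimately show ?thesis
    by (simp add: LIMSEQ_const_iff cinner_self)
qed

lemma T_defect_space:
  assumes x: "x \<in> defect_space_on E F T"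
  shows "T x \<in> codefect_space_on E F T"
proof -
  obtain f where f: "\<And>n. f n \<in> D ` E" "f \<longlonglongrightarrow> x"
    using x unfolding defect_space_on_def closure_sequential by blast
  have fE: "f n \<in> E" for n
    using f(1)[of n] D_in by auto
  have "x \<in> E"
    using x defect_space(2) by blast
  then have "(\<lambda>n. T (f n)) \<longlonglongrightarrow> T x"
    by (intro bounded_clinear_on_tendsto[OF E contraction_on_bounded[OF T] fE f(2)])
  moreover have "T (f n) \<in> Ds ` F" for n
    using f(1)[of n] T_D T_in by auto
  ultimately show ?thesis
    unfolding codefect_space_on_def closure_sequential by (intro exI[of _ "\<lambda>n. T (f n)"]) auto
qed

end

context subspace_contraction
begin

lemma Ds_square: "y \<in> F \<Longrightarrow> Ds (Ds y) = y - T (Ts y)"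
  and Ds_norm_sq: "y \<in> F \<Longrightarrow> (norm (Ds y))\<^sup>2 = (norm y)\<^sup>2 - (norm (Ts y))\<^sup>2"
  and Ds_norm: "y \<in> F \<Longrightarrow> norm (Ds y) \<le> norm y"
  and Ds_selfadj: "x \<in> F \<Longrightarrow> y \<in> F \<Longrightarrow> cinner (Ds x) y = cinner x (Ds y)"
  and Ds_clinear: "clinear_on F F Ds"
  and Ds_in: "y \<in> F \<Longrightarrow> Ds y \<in> F"
  and Ts_Ds: "y \<in> F \<Longrightarrow> Ts (Ds y) = D (Ts y)"
  and Ds_in_codefect_space: "y \<in> F \<Longrightarrow> Ds y \<in> codefect_space_on E F T"
  and codefect_space: "closed_csubspace (codefect_space_on E F T)" "codefect_space_on E F T \<subseteq> F"
  and Ts_codefect_space: "y \<in> codefect_space_on E F T \<Longrightarrow> Ts y \<in> defect_space_on E F T"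
proof -
  interpret adjoint: subspace_contraction F E Ts
    by (rule adjoint_contraction)
  have D: "adjoint.Ds = D"
    unfolding codefect_on_def defect_on_def by (rule psqrt_on_cong) (simp add: adj_adj)
  have S: "codefect_space_on F E Ts = defect_space_on E F T"
    by (simp add: codefect_space_on_def defect_space_on_def D)
  show "y \<in> F \<Longrightarrow> Ds (Ds y) = y - T (Ts y)"
    "y \<in> F \<Longrightarrow> (norm (Ds y))\<^sup>2 = (norm y)\<^sup>2 - (norm (Ts y))\<^sup>2"
    "y \<in> F \<Longrightarrow> norm (Ds y) \<le> norm y"
    "x \<in> F \<Longrightarrow> y \<in> F \<Longrightarrow> cinner (Ds x) y = cinner x (Ds y)"
    "clinear_on F F Ds" "y \<in> F \<Longrightarrow> Ds y \<in> F"
    using adjoint.D_square[of y] adjoint.D_norm_sq[of y] adjoint.D_norm[of y]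
      adjoint.D_selfadj[of x y] adjoint.D_clinear adjoint.D_in[of y]
    by (auto simp: codefect_eq adj_adj Ts_in)
  show "y \<in> F \<Longrightarrow> Ts (Ds y) = D (Ts y)"
    using adjoint.T_D by (simp add: codefect_eq D)
  show "y \<in> F \<Longrightarrow> Ds y \<in> codefect_space_on E F T"
    "closed_csubspace (codefect_space_on E F T)" "codefect_space_on E F T \<subseteq> F"
    using adjoint.D_in_defect_space[of y] adjoint.defect_space
    by (auto simp: codefect_space_eq codefect_eq)
  show "y \<in> codefect_space_on E F T \<Longrightarrow> Ts y \<in> defect_space_on E F T"
    using adjoint.T_defect_space[of y] by (simp add: codefect_space_eq S)
qed

text \<open>In the norm of the Julia operator \<open>[T*, D\<^sub>T; D\<^bsub>T*\<^esub>, -T]\<close> the cross terms cancel because of \<open>D\<^sub>T T* = T* D\<^bsub>T*\<^esub>\<close>.\<close>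

lemma julia_norm:
  assumes p: "p \<in> F" and x: "x \<in> E"
  shows "(norm (Ts p + D x))\<^sup>2 + (norm (Ds p - T x))\<^sup>2 = (norm p)\<^sup>2 + (norm x)\<^sup>2"
proof -
  have "cinner (Ts p) (D x) = cinner (Ts (Ds p)) x"
    using D_selfadj[OF Ts_in x, of p] by (simp add: Ts_Ds[OF p])
  also have "\<dots> = cinner (Ds p) (T x)"
    by (rule Ts_cinner'[OF x])
  finally show ?thesis
    by (simp add: norm_add_sq norm_diff_sq D_norm_sq[OF x] Ds_norm_sq[OF p])
qed

end

section \<open>Isometric extension\<close>

text \<open>Equality of norms makes \<open>D f \<mapsto> G f\<close> well defined and isometric, hence uniformly continuous. The extension to
  the closure stays isometric, so its range is complete; as it contains the range of \<open>G\<close>, it is all of \<open>V\<close>.\<close>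

lemma unitary_on_isometric_extension:
  fixes D :: "'a :: complex_hilbert \<Rightarrow> 'b :: complex_hilbert" and G :: "'a \<Rightarrow> 'c :: complex_hilbert"
  assumes E: "closed_csubspace E" and W: "closed_csubspace W" and V: "closed_csubspace V"
    and D: "clinear_on E W D" and G: "clinear_on E V G"
    and iso: "\<And>f. f \<in> E \<Longrightarrow> norm (D f) = norm (G f)" and dense: "closure (G ` E) = V"
  shows "unitary_on (closure (D ` E)) V
    (THE Z. continuous_on (closure (D ` E)) Z \<and> (\<forall>f\<in>E. Z (D f) = G f) \<and>
      (\<forall>g. g \<notin> closure (D ` E) \<longrightarrow> Z g = 0))"
proof -
  let ?R = "closure (D ` E)"
  let ?P = "\<lambda>Z. continuous_on ?R Z \<and> (\<forall>f\<in>E. Z (D f) = G f) \<and> (\<forall>g. g \<notin> ?R \<longrightarrow> Z g = 0)"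
  note R = closed_csubspace_closure_image[OF E D W]
  have dist_eq: "dist (G f) (G f') = dist (D f) (D f')" if "f \<in> E" "f' \<in> E" for f f'
    using iso[OF closed_csubspace_more(2)[OF E that]]
      clinear_on_more(3)[OF E D that] clinear_on_more(3)[OF E G that] by (simp add: dist_norm)
  define Z0 where "Z0 d = G (SOME f. f \<in> E \<and> D f = d)" for d
  have Z0: "Z0 (D f) = G f" if "f \<in> E" for f
  proof -
    have "(SOME f'. f' \<in> E \<and> D f' = D f) \<in> E \<and> D (SOME f'. f' \<in> E \<and> D f' = D f) = D f"
      by (rule someI[of "\<lambda>f'. f' \<in> E \<and> D f' = D f" f]) (simp add: that)
    then show ?thesis
      using dist_eq[OF _ that] unfolding Z0_def by (metis dist_eq_0_iff)
  qed
  have "uniformly_continuous_on (D ` E) Z0"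
    unfolding uniformly_continuous_on_def
  proof (intro allI impI)
    fix e :: real
    assume "e > 0"
    then show "\<exists>d>0. \<forall>x\<in>D ` E. \<forall>x'\<in>D ` E. dist x' x < d \<longrightarrow> dist (Z0 x') (Z0 x) < e"
      by (intro exI[of _ e]) (auto simp: Z0 dist_eq)
  qed
  then obtain Z1 where Z1: "uniformly_continuous_on ?R Z1" "\<And>x. x \<in> D ` E \<Longrightarrow> Z0 x = Z1 x"
    by (rule uniformly_continuous_on_extension_on_closure) blast
  define Z where "Z g = (if g \<in> ?R then Z1 g else 0)" for g
  have DR: "D f \<in> ?R" if "f \<in> E" for f
    using closure_subset[of "D ` E"] that by blast
  have PZ: "?P Z"
  proof (intro conjI ballI allI impI)
    show "continuous_on ?R Z"
      using uniformly_continuous_imp_continuous[OF Z1(1)]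
      by (subst continuous_on_cong[OF refl, of _ _ Z1]) (auto simp: Z_def)
    show "Z (D f) = G f" if "f \<in> E" for f
      using Z1(2)[of "D f"] Z0[OF that] DR[OF that] that by (simp add: Z_def)
  qed (simp add: Z_def)
  have uniq: "Z' = Z" if "?P Z'" for Z'
  proof
    fix g
    show "Z' g = Z g"
    proof (cases "g \<in> ?R")
      case True
      then obtain f where f: "\<And>n. f n \<in> D ` E" "f \<longlonglongrightarrow> g"
        unfolding closure_sequential by blast
      have fR: "f n \<in> ?R" for n
        using f(1)[of n] closure_subset[of "D ` E"] by blast
      have "(\<lambda>n. Z' (f n)) \<longlonglongrightarrow> Z' g" "(\<lambda>n. Z (f n)) \<longlonglongrightarrow> Z g"
        using PZ that fR by (auto intro!: continuous_on_tendsto_compose[OF _ f(2) True])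
      moreover have "Z' (f n) = Z (f n)" for n
        using f(1)[of n] PZ that by auto
      ultimately show ?thesis
        by (simp add: LIMSEQ_unique)
    qed (use PZ that in auto)
  qed
  have eq: "(THE Z. ?P Z) = Z"
    using PZ uniq by (rule the_equality)
  have lim: "(\<lambda>n. G (f n)) \<longlonglongrightarrow> Z g"
    if f: "\<And>n. f n \<in> E" "(\<lambda>n. D (f n)) \<longlonglongrightarrow> g" and g: "g \<in> ?R" for f g
  proof -
    have "(\<lambda>n. Z (D (f n))) \<longlonglongrightarrow> Z g"
      using PZ DR f by (intro continuous_on_tendsto_compose[OF _ f(2) g]) auto
    then show ?thesis
      using PZ f(1) by simp
  qed
  have approx: "\<exists>f. (\<forall>n. f n \<in> E) \<and> (\<lambda>n. D (f n)) \<longlonglongrightarrow> g \<and> (\<lambda>n. G (f n)) \<longlonglongrightarrow> Z g" if g: "g \<in> ?R" for g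
  proof -
    obtain d where d: "\<And>n. d n \<in> D ` E" "d \<longlonglongrightarrow> g"
      using g unfolding closure_sequential by blast
    then obtain f where f: "\<And>n. f n \<in> E" "\<And>n. d n = D (f n)"
      unfolding image_iff by metis
    then have "d = (\<lambda>n. D (f n))"
      by auto
    with d(2) have "(\<lambda>n. D (f n)) \<longlonglongrightarrow> g"
      by simp
    with lim[OF f(1) this g] f(1) show ?thesis
      by blast
  qed
  have ZV: "Z g \<in> V" if g: "g \<in> ?R" for g
  proof -
    obtain f where f: "\<forall>n. f n \<in> E" "(\<lambda>n. G (f n)) \<longlonglongrightarrow> Z g"
      using approx[OF g] by blast
    then show ?thesis
      using closed_sequentially[OF closed_csubspaceD(1)[OF V] _ f(2)] clinear_onD(1)[OF G] by blast
  qed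
  have add: "Z (g + h) = Z g + Z h" if g: "g \<in> ?R" and h: "h \<in> ?R" for g h
  proof -
    obtain f where f: "\<forall>n. f n \<in> E" "(\<lambda>n. D (f n)) \<longlonglongrightarrow> g" "(\<lambda>n. G (f n)) \<longlonglongrightarrow> Z g"
      using approx[OF g] by blast
    obtain k where k: "\<forall>n. k n \<in> E" "(\<lambda>n. D (k n)) \<longlonglongrightarrow> h" "(\<lambda>n. G (k n)) \<longlonglongrightarrow> Z h"
      using approx[OF h] by blast
    have E': "f n + k n \<in> E" for n
      using closed_csubspaceD(3)[OF E] f k by blast
    have "(\<lambda>n. D (f n + k n)) \<longlonglongrightarrow> g + h"
      using tendsto_add[OF f(2) k(2)] clinear_onD(2)[OF D] f k by simp
    then have "(\<lambda>n. G (f n) + G (k n)) \<longlonglongrightarrow> Z (g + h)"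
      using lim[OF E' _ closed_csubspaceD(3)[OF R(1) g h]] clinear_onD(2)[OF G] f k by simp
    then show ?thesis
      using LIMSEQ_unique tendsto_add[OF f(3) k(3)] by blast
  qed
  have scale: "Z (c *\<^sub>C g) = c *\<^sub>C Z g" if g: "g \<in> ?R" for c g
  proof -
    obtain f where f: "\<forall>n. f n \<in> E" "(\<lambda>n. D (f n)) \<longlonglongrightarrow> g" "(\<lambda>n. G (f n)) \<longlonglongrightarrow> Z g"
      using approx[OF g] by blast
    have E': "c *\<^sub>C f n \<in> E" for n
      using closed_csubspaceD(4)[OF E] f by blast
    have "(\<lambda>n. D (c *\<^sub>C f n)) \<longlonglongrightarrow> c *\<^sub>C g"
      using bounded_linear.tendsto[OF bounded_linear_scaleC f(2)] clinear_onD(3)[OF D] f by simp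
    then have "(\<lambda>n. c *\<^sub>C G (f n)) \<longlonglongrightarrow> Z (c *\<^sub>C g)"
      using lim[OF E' _ closed_csubspaceD(4)[OF R(1) g]] clinear_onD(3)[OF G] f by simp
    then show ?thesis
      using LIMSEQ_unique bounded_linear.tendsto[OF bounded_linear_scaleC f(3)] by blast
  qed
  have norm: "norm (Z g) = norm g" if g: "g \<in> ?R" for g
  proof -
    obtain f where f: "\<forall>n. f n \<in> E" "(\<lambda>n. D (f n)) \<longlonglongrightarrow> g" "(\<lambda>n. G (f n)) \<longlonglongrightarrow> Z g"
      using approx[OF g] by blast
    then show ?thesis
      using tendsto_norm[OF f(2)] tendsto_norm[OF f(3)] iso by (simp add: LIMSEQ_unique)
  qed
  have surj: "V \<subseteq> Z ` ?R"
  proof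
    fix v
    assume "v \<in> V"
    then obtain w where w: "\<And>n. w n \<in> G ` E" "w \<longlonglongrightarrow> v"
      unfolding dense[symmetric] closure_sequential by blast
    then obtain f where f: "\<And>n. f n \<in> E" "\<And>n. w n = G (f n)"
      unfolding image_iff by metis
    have "Cauchy (\<lambda>n. D (f n))"
      using LIMSEQ_imp_Cauchy[OF w(2)] f dist_eq by (simp add: Cauchy_def)
    then obtain g where g: "(\<lambda>n. D (f n)) \<longlonglongrightarrow> g"
      using Cauchy_convergent_iff convergent_def by blast
    have gR: "g \<in> ?R"
      using closed_sequentially[OF closed_csubspaceD(1)[OF R(1)] _ g] DR f by blast
    have "w = (\<lambda>n. G (f n))"
      using f(2) by auto
    then have "v = Z g"
      using LIMSEQ_unique[OF w(2)] lim[OF f(1) g gR] by blast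
    then show "v \<in> Z ` ?R"
      using gR by blast
  qed
  show ?thesis
    unfolding eq unitary_on_def clinear_on_def using ZV add scale norm surj by blast
qed

section \<open>Power series with vector coefficients on circles\<close>

lemma sums_has_integral_uniform:
  fixes f :: "nat \<Rightarrow> real \<Rightarrow> 'a :: banach"
  assumes cont: "\<And>n. continuous_on {a..b} (f n)" and M: "summable M"
    and bound: "\<And>n x. x \<in> {a..b} \<Longrightarrow> norm (f n x) \<le> M n"
    and int: "\<And>n. (f n has_integral I n) {a..b}"
  obtains J where "I sums J" "((\<lambda>x. \<Sum>n. f n x) has_integral J) {a..b}"
proof -
  have u: "uniform_limit {a..b} (\<lambda>n x. \<Sum>i<n. f i x) (\<lambda>x. \<Sum>n. f n x) sequentially"
    by (rule Weierstrass_m_test[OF bound M])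
  obtain I' J where J: "\<And>n. ((\<lambda>x. \<Sum>i<n. f i x) has_integral I' n) {a..b}"
    "((\<lambda>x. \<Sum>n. f n x) has_integral J) {a..b}" "I' \<longlonglongrightarrow> J"
    by (rule uniform_limit_integral[OF u]) (use cont in \<open>auto intro: continuous_on_sum\<close>)
  have "I' = (\<lambda>n. \<Sum>i<n. I i)"
    using has_integral_sum[of "{..<_}" f I "{a..b}"] int J(1) by (blast intro: has_integral_unique)
  with J that show thesis
    by (simp add: sums_def)
qed

lemma cis_has_integral_period:
  "((\<lambda>t. cis (of_int m * t)) has_integral (if m = 0 then 2 * pi else 0)) {a..a + 2 * pi}"
proof (cases "m = 0")
  case True
  then show ?thesis
    using has_integral_const_real[of "1 :: complex" a "a + 2 * pi"] by (simp add: scaleR_conv_of_real)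
next
  case False
  let ?F = "\<lambda>t. cis (of_int m * t) / (\<i> * of_int m)"
  have "((\<lambda>t. cis (of_int m * t)) has_integral ?F (a + 2 * pi) - ?F a) {a..a + 2 * pi}"
  proof (rule fundamental_theorem_of_calculus)
    fix t :: real
    show "(?F has_vector_derivative cis (of_int m * t)) (at t within {a..a + 2 * pi})"
      using False unfolding cis_conv_exp
      by (auto intro!: derivative_eq_intros has_vector_derivative_real_field simp: field_simps)
  qed simp
  moreover have "cis (of_int m * (a + 2 * pi)) = cis (of_int m * a)"
    using cis_multiple_2pi[of "of_int m"] by (simp add: distrib_left cis_mult[symmetric] mult_ac)
  ultimately show ?thesis
    using False by simp
qed

definition pseries :: "(nat \<Rightarrow> 'a :: complex_hilbert) \<Rightarrow> complex \<Rightarrow> 'a" where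
  "pseries a z = (\<Sum>n. z ^ n *\<^sub>C a n)"

lemma pseries_terms_summable:
  fixes a :: "nat \<Rightarrow> 'a :: complex_hilbert"
  assumes "summable (\<lambda>n. norm (a n))" "cmod z \<le> 1"
  shows "summable (\<lambda>n. norm (z ^ n *\<^sub>C a n))" "summable (\<lambda>n. z ^ n *\<^sub>C a n)"
proof -
  show "summable (\<lambda>n. norm (z ^ n *\<^sub>C a n))"
    using assms(2) by (intro summable_comparison_test'[OF assms(1)])
      (auto simp: norm_scaleC norm_power mult_left_le_one_le power_le_one)
  then show "summable (\<lambda>n. z ^ n *\<^sub>C a n)"
    by (rule summable_norm_cancel)
qed

lemma continuous_on_scaleC_left: "continuous_on S g \<Longrightarrow> continuous_on S (\<lambda>x. g x *\<^sub>C (v :: 'a :: complex_inner))"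
  by (rule bounded_linear.continuous_on[of "\<lambda>c. c *\<^sub>C v"])
    (auto intro!: bounded_linear_intro[where K = "norm v"] simp: scaleC_add_left scaleR_scaleC
      scaleC_scaleC norm_scaleC scaleC_complex_def)

lemma continuous_on_pseries:
  fixes a :: "nat \<Rightarrow> 'a :: complex_hilbert"
  assumes "summable (\<lambda>n. norm (a n))"
  shows "continuous_on (cball 0 1) (pseries a)"
proof (rule uniform_limit_theorem)
  show "uniform_limit (cball 0 1) (\<lambda>n z. \<Sum>i<n. z ^ i *\<^sub>C a i) (pseries a) sequentially"
    unfolding pseries_def
    by (rule Weierstrass_m_test[OF _ assms])
      (auto simp: norm_scaleC norm_power mult_left_le_one_le power_le_one)
  show "\<forall>\<^sub>F n in sequentially. continuous_on (cball 0 1) (\<lambda>z. \<Sum>i<n. z ^ i *\<^sub>C a i)"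
    by (intro always_eventually allI continuous_on_sum continuous_on_scaleC_left continuous_intros)
qed simp

lemma continuous_on_pseries_cis:
  fixes a :: "nat \<Rightarrow> 'a :: complex_hilbert"
  assumes "summable (\<lambda>n. norm (a n))"
  shows "continuous_on S (\<lambda>t. pseries a (cis t))"
  by (rule continuous_on_compose2[OF continuous_on_pseries[OF assms]]) (auto intro!: continuous_intros)

lemma norm_pseries_le:
  fixes a :: "nat \<Rightarrow> 'a :: complex_hilbert"
  assumes "summable (\<lambda>n. norm (a n))" "cmod z \<le> 1"
  shows "norm (pseries a z) \<le> (\<Sum>n. norm (a n))"
proof -
  have "norm (pseries a z) \<le> (\<Sum>n. norm (z ^ n *\<^sub>C a n))"
    unfolding pseries_def by (rule summable_norm[OF pseries_terms_summable(1)[OF assms]])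
  also have "\<dots> \<le> (\<Sum>n. norm (a n))"
    using assms(2) by (intro suminf_le pseries_terms_summable assms)
      (auto simp: norm_scaleC norm_power mult_left_le_one_le power_le_one)
  finally show ?thesis .
qed

lemma cinner_pseries_left:
  fixes a :: "nat \<Rightarrow> 'a :: complex_hilbert"
  assumes "summable (\<lambda>n. norm (a n))" "cmod z \<le> 1"
  shows "cinner (pseries a z) y = (\<Sum>n. z ^ n * cinner (a n) y)"
  unfolding pseries_def
  using bounded_linear.suminf[OF bounded_linear_cinner_left pseries_terms_summable(2)[OF assms]]
  by (simp add: cinner_scaleC_left)

text \<open>The Fourier coefficients of the boundary function, paired with a fixed vector.\<close>

lemma cinner_cis_pseries_has_integral:
  fixes a :: "nat \<Rightarrow> 'a :: complex_hilbert"
  assumes a: "summable (\<lambda>n. norm (a n))"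
  shows "((\<lambda>t. cis (of_int m * t) * cinner y (pseries a (cis t))) has_integral
    (if m \<ge> 0 then 2 * pi * cinner y (a (nat m)) else 0)) {c..c + 2 * pi}"
proof -
  let ?f = "\<lambda>n t. cis (of_int m * t) * (cnj (cis t ^ n) * cinner y (a n))"
  let ?I = "\<lambda>n. (if m = int n then 2 * pi else 0) * cinner y (a n)"
  have f_eq: "?f n t = cis (of_int (m - int n) * t) * cinner y (a n)" for n t
    by (simp add: Complex.DeMoivre cis_cnj cis_mult algebra_simps flip: mult.assoc)
  have int: "(?f n has_integral ?I n) {c..c + 2 * pi}" for n
    unfolding f_eq using has_integral_mult_left[OF cis_has_integral_period[of "m - int n" c]] by simp
  obtain J where J: "?I sums J" "((\<lambda>t. \<Sum>n. ?f n t) has_integral J) {c..c + 2 * pi}"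
  proof (rule sums_has_integral_uniform[OF _ _ _ int])
    show "continuous_on {c..c + 2 * pi} (?f n)" for n
      by (intro continuous_intros)
    show "summable (\<lambda>n. norm y * norm (a n))"
      by (rule summable_mult[OF a])
    show "norm (?f n t) \<le> norm y * norm (a n)" for n t
      by (simp add: norm_mult norm_power cmod_cinner_le)
  qed
  have "(\<Sum>n. ?f n t) = cis (of_int m * t) * cinner y (pseries a (cis t))" for t
  proof -
    have s: "summable (\<lambda>n. cnj (cis t ^ n) * cinner y (a n))"
      using bounded_linear.summable[OF bounded_linear_cinner_right pseries_terms_summable(2)[OF a, of "cis t"]]
      by (simp add: cinner_scaleC_right)
    have "cinner y (pseries a (cis t)) = (\<Sum>n. cnj (cis t ^ n) * cinner y (a n))"
      unfolding pseries_def
      using bounded_linear.suminf[OF bounded_linear_cinner_right pseries_terms_summable(2)[OF a, of "cis t"]]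
      by (simp add: cinner_scaleC_right)
    then show ?thesis
      by (simp only: suminf_mult[OF s])
  qed
  moreover have "J = (if m \<ge> 0 then 2 * pi * cinner y (a (nat m)) else 0)"
  proof -
    have "?I = (\<lambda>n. if n = nat m then (if m \<ge> 0 then 2 * pi * cinner y (a (nat m)) else 0) else 0)"
      by (rule ext) auto
    then show ?thesis
      using J(1) sums_single[of "nat m" "\<lambda>_. if m \<ge> 0 then 2 * pi * cinner y (a (nat m)) else 0"]
      by (simp add: sums_unique2)
  qed
  ultimately show ?thesis
    using J(2) by simp
qed

text \<open>Parseval's identity: expand one of the two factors of \<open>\<langle>F, F\<rangle>\<close> into its series.\<close>

lemma parseval_pseries:
  fixes a :: "nat \<Rightarrow> 'a :: complex_hilbert"
  assumes a: "summable (\<lambda>n. norm (a n))"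
  obtains S where "(\<lambda>n. (norm (a n))\<^sup>2) sums S"
    "((\<lambda>t. (norm (pseries a (cis t)))\<^sup>2) has_integral 2 * pi * S) {c..c + 2 * pi}"
proof -
  let ?F = "\<lambda>t. pseries a (cis t)"
  let ?f = "\<lambda>n t. cis (of_int (int n) * t) * cinner (a n) (?F t)"
  let ?I = "\<lambda>n. complex_of_real (2 * pi * (norm (a n))\<^sup>2)"
  have int: "(?f n has_integral ?I n) {c..c + 2 * pi}" for n
    using cinner_cis_pseries_has_integral[OF a, of "int n" "a n" c] by (simp add: cinner_self)
  obtain J where J: "?I sums J" "((\<lambda>t. \<Sum>n. ?f n t) has_integral J) {c..c + 2 * pi}"
  proof (rule sums_has_integral_uniform[OF _ _ _ int])
    show "continuous_on {c..c + 2 * pi} (?f n)" for n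
      by (intro continuous_intros bounded_linear.continuous_on[OF bounded_linear_cinner_right]
          continuous_on_pseries_cis a)
    show "summable (\<lambda>n. norm (a n) * (\<Sum>n. norm (a n)))"
      by (rule summable_mult2[OF a])
    show "norm (?f n t) \<le> norm (a n) * (\<Sum>n. norm (a n))" for n t
      using cmod_cinner_le[of "a n" "?F t"] norm_pseries_le[OF a, of "cis t"]
      by (simp add: norm_mult) (meson mult_left_mono norm_ge_zero order_trans)
  qed
  have F_eq: "(\<Sum>n. ?f n t) = complex_of_real ((norm (?F t))\<^sup>2)" for t
    using cinner_pseries_left[OF a, of "cis t" "?F t"]
    by (simp add: cinner_self Complex.DeMoivre)
  have "Re J = 2 * pi * (Re J / (2 * pi))"
    by simp
  moreover have "((\<lambda>t. (norm (?F t))\<^sup>2) has_integral Re J) {c..c + 2 * pi}"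
    using has_integral_Re[OF J(2)] by (simp only: F_eq Re_complex_of_real)
  moreover have "(\<lambda>n. (norm (a n))\<^sup>2) sums (Re J / (2 * pi))"
  proof -
    have "(\<lambda>n. 2 * pi * (norm (a n))\<^sup>2) sums Re J"
      using sums_Re[OF J(1)] by simp
    from sums_divide[OF this, of "2 * pi"] show ?thesis
      by simp
  qed
  ultimately show thesis
    using that by metis
qed

section \<open>Radial limits of vector-valued power series\<close>

definition poisson :: "real \<Rightarrow> real \<Rightarrow> real" where
  "poisson \<rho> u = (1 - \<rho>\<^sup>2) / (1 - 2 * \<rho> * cos u + \<rho>\<^sup>2)"

lemma poisson_denominator_pos:
  assumes "0 \<le> \<rho>" "\<rho> < (1 :: real)"
  shows "0 < 1 - 2 * \<rho> * cos u + \<rho>\<^sup>2"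
proof -
  have "0 < (1 - \<rho>)\<^sup>2"
    using assms by (intro zero_less_power) simp
  also have "\<dots> \<le> 1 - 2 * \<rho> * cos u + \<rho>\<^sup>2"
    using mult_left_le[of "cos u" \<rho>] assms by (simp add: power2_diff)
  finally show ?thesis .
qed

lemma poisson_nonneg: "0 \<le> \<rho> \<Longrightarrow> \<rho> < 1 \<Longrightarrow> 0 \<le> poisson \<rho> u"
  using poisson_denominator_pos[of \<rho> u] by (simp add: poisson_def power_le_one)

lemma poisson_minus [simp]: "poisson \<rho> (- u) = poisson \<rho> u"
  by (simp add: poisson_def)

lemma continuous_on_poisson: "0 \<le> \<rho> \<Longrightarrow> \<rho> < 1 \<Longrightarrow> continuous_on S (poisson \<rho>)"
  unfolding poisson_def using poisson_denominator_pos[of \<rho>]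
  by (intro continuous_intros) (metis less_irrefl)

text \<open>With \<open>q = \<rho> e\<^bsup>iu\<^esup>\<close> the kernel is \<open>1 / (1 - cnj q) + q / (1 - q)\<close>, a sum of two geometric series.\<close>

lemma poisson_sums:
  assumes \<rho>: "0 \<le> \<rho>" "\<rho> < 1"
  shows "(\<lambda>k. complex_of_real (\<rho> ^ k) * cis (of_int (- int k) * u)
    + complex_of_real (\<rho> ^ Suc k) * cis (of_int (int (Suc k)) * u)) sums complex_of_real (poisson \<rho> u)"
proof -
  define q where "q = complex_of_real \<rho> * cis u"
  have q: "cmod q < 1" "cmod (cnj q) < 1"
    using \<rho> by (simp_all add: q_def norm_mult)
  have qk: "q ^ k = complex_of_real (\<rho> ^ k) * cis (of_int (int k) * u)" for k
    by (simp add: q_def power_mult_distrib Complex.DeMoivre)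
  have cqk: "cnj q ^ k = complex_of_real (\<rho> ^ k) * cis (of_int (- int k) * u)" for k
    by (simp add: q_def power_mult_distrib Complex.DeMoivre cis_cnj)
  have ne: "1 - q \<noteq> 0" "1 - cnj q \<noteq> 0"
    using q by auto
  have "(\<lambda>k. cnj q ^ k + q * q ^ k) sums (1 / (1 - cnj q) + q * (1 / (1 - q)))"
    by (intro sums_add sums_mult geometric_sums q)
  moreover have "1 / (1 - cnj q) + q * (1 / (1 - q)) = complex_of_real (poisson \<rho> u)"
  proof -
    have qq: "q * cnj q = complex_of_real (\<rho>\<^sup>2)"
      by (simp add: q_def cis_cnj cis_mult power2_eq_square)
    have "q + cnj q = complex_of_real (2 * \<rho> * cos u)"
      by (simp add: complex_eq_iff q_def)
    then have "(1 - cnj q) * (1 - q) = complex_of_real (1 - 2 * \<rho> * cos u + \<rho>\<^sup>2)"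
      using qq by (simp add: algebra_simps)
    moreover have "1 / (1 - cnj q) + q * (1 / (1 - q)) = (1 - q * cnj q) / ((1 - cnj q) * (1 - q))"
      using ne by (simp add: field_simps)
    ultimately show ?thesis
      using qq by (simp add: poisson_def)
  qed
  moreover have "complex_of_real (\<rho> ^ Suc k) * cis (of_int (int (Suc k)) * u) = q * q ^ k" for k
    using qk[of "Suc k"] by simp
  ultimately show ?thesis
    by (simp only: cqk[symmetric])
qed

lemma poisson_cis_has_integral:
  assumes \<rho>: "0 \<le> \<rho>" "\<rho> < 1"
  shows "((\<lambda>u. complex_of_real (poisson \<rho> u) * cis (of_int (int n) * u)) has_integral
    2 * pi * complex_of_real (\<rho> ^ n)) {- pi..pi}"
proof -
  let ?f = "\<lambda>k u. (complex_of_real (\<rho> ^ k) * cis (of_int (- int k) * u)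
    + complex_of_real (\<rho> ^ Suc k) * cis (of_int (int (Suc k)) * u)) * cis (of_int (int n) * u)"
  let ?I = "\<lambda>k. if k = n then 2 * pi * complex_of_real (\<rho> ^ n) else 0"
  have f_eq: "?f k u = complex_of_real (\<rho> ^ k) * cis (of_int (int n - int k) * u)
    + complex_of_real (\<rho> ^ Suc k) * cis (of_int (int n + int (Suc k)) * u)" for k u
    by (simp add: distrib_right cis_mult mult.assoc algebra_simps)
  have int: "(?f k has_integral ?I k) {- pi..pi}" for k
  proof -
    have "(?f k has_integral complex_of_real (\<rho> ^ k) * (if int n - int k = 0 then 2 * pi else 0)
        + complex_of_real (\<rho> ^ Suc k) * (if int n + int (Suc k) = 0 then 2 * pi else 0)) {- pi..- pi + 2 * pi}"
      unfolding f_eq by (intro has_integral_add has_integral_mult_right cis_has_integral_period)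
    moreover have "complex_of_real (\<rho> ^ k) * (if int n - int k = 0 then 2 * pi else 0)
        + complex_of_real (\<rho> ^ Suc k) * (if int n + int (Suc k) = 0 then 2 * pi else 0) = ?I k"
      by auto
    ultimately show ?thesis
      by simp
  qed
  obtain J where J: "?I sums J" "((\<lambda>u. \<Sum>k. ?f k u) has_integral J) {- pi..pi}"
  proof (rule sums_has_integral_uniform[OF _ _ _ int])
    show "continuous_on {- pi..pi} (?f k)" for k
      by (intro continuous_intros)
    show "summable (\<lambda>k. \<rho> ^ k + \<rho> ^ k)"
      using \<rho> by (intro summable_add) auto
    show "norm (?f k u) \<le> \<rho> ^ k + \<rho> ^ k" for k u
    proof -
      have "norm (?f k u) \<le> \<rho> ^ k + \<rho> ^ Suc k"
        using \<rho> by (simp only: norm_mult norm_cis mult_1_right)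
          (rule norm_triangle_le, simp add: norm_mult norm_power)
      also have "\<dots> \<le> \<rho> ^ k + \<rho> ^ k"
        using \<rho> by (simp add: mult_left_le_one_le)
      finally show ?thesis .
    qed
  qed
  have "(\<Sum>k. ?f k u) = complex_of_real (poisson \<rho> u) * cis (of_int (int n) * u)" for u
    by (rule sums_unique[symmetric]) (intro sums_mult2 poisson_sums \<rho>)
  moreover have "J = 2 * pi * complex_of_real (\<rho> ^ n)"
    using J(1) sums_single[of n "\<lambda>_. 2 * pi * complex_of_real (\<rho> ^ n)"]
    by (simp add: sums_unique2 eq_commute)
  ultimately show ?thesis
    using J(2) by simp
qed

lemma poisson_has_integral:
  assumes \<rho>: "0 \<le> \<rho>" "\<rho> < 1"
  shows "(poisson \<rho> has_integral 2 * pi) {- pi..pi}"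
  using has_integral_Re[OF poisson_cis_has_integral[OF assms, of 0]] by simp

lemma poisson_has_integral_half:
  assumes \<rho>: "0 \<le> \<rho>" "\<rho> < 1"
  shows "(poisson \<rho> has_integral pi) {0..pi}"
proof -
  obtain i where i: "(poisson \<rho> has_integral i) {0..pi}"
    using integrable_continuous_real[OF continuous_on_poisson[OF assms]] by blast
  have "(poisson \<rho> has_integral i) {- pi..- 0}"
    using i by (subst has_integral_reflect_real[symmetric]) simp
  then have "(poisson \<rho> has_integral i + i) {- pi..pi}"
    using i by (intro has_integral_combine[of "- pi" 0 pi]) auto
  from has_integral_unique[OF this poisson_has_integral[OF assms]] have "i = pi"
    by simp
  with i show ?thesis
    by simp
qed

text \<open>Pair \<open>f\<close> with the fixed vector \<open>f(\<rho> e\<^bsup>it\<^esup>)\<close> and integrate the resulting scalar power series against the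
  Poisson kernel term by term.\<close>

lemma norm_pseries_le_poisson_integral:
  fixes b :: "nat \<Rightarrow> 'a :: complex_hilbert"
  assumes b: "summable (\<lambda>n. norm (b n))" and \<rho>: "0 \<le> \<rho>" "\<rho> < 1"
  shows "2 * pi * norm (pseries b (\<rho> * cis t))
    \<le> integral {- pi..pi} (\<lambda>u. poisson \<rho> u * norm (pseries b (cis (t + u))))"
proof -
  define y where "y = pseries b (\<rho> * cis t)"
  let ?P = "\<lambda>u. complex_of_real (poisson \<rho> u)"
  let ?f = "\<lambda>n u. (cis t ^ n * cinner (b n) y) * (?P u * cis (of_int (int n) * u))"
  let ?I = "\<lambda>n. (cis t ^ n * cinner (b n) y) * (2 * pi * complex_of_real (\<rho> ^ n))"
  obtain M where M: "\<And>u. u \<in> {- pi..pi} \<Longrightarrow> norm (poisson \<rho> u) \<le> M"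
    using compact_imp_bounded[OF compact_continuous_image[OF continuous_on_poisson[OF \<rho>] compact_Icc]]
    unfolding bounded_iff by blast
  have int: "(?f n has_integral ?I n) {- pi..pi}" for n
    by (intro has_integral_mult_right poisson_cis_has_integral \<rho>)
  obtain J where J: "?I sums J" "((\<lambda>u. \<Sum>n. ?f n u) has_integral J) {- pi..pi}"
  proof (rule sums_has_integral_uniform[OF _ _ _ int])
    show "continuous_on {- pi..pi} (?f n)" for n
      by (intro continuous_intros continuous_on_poisson \<rho>)
    show "summable (\<lambda>n. norm (b n) * norm y * M)"
      by (intro summable_mult2 b)
    show "norm (?f n u) \<le> norm (b n) * norm y * M" if "u \<in> {- pi..pi}" for n u
      using M[OF that] by (simp add: norm_mult norm_power) (intro mult_mono cmod_cinner_le, auto)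
  qed
  have f_eq: "(\<Sum>n. ?f n u) = ?P u * cinner (pseries b (cis (t + u))) y" for u
  proof -
    have s: "summable (\<lambda>n. cis (t + u) ^ n * cinner (b n) y)"
      using bounded_linear.summable[OF bounded_linear_cinner_left
          pseries_terms_summable(2)[OF b, of "cis (t + u)"]]
      by (simp add: cinner_scaleC_left)
    have "cis t ^ n * cis (of_int (int n) * u) = cis (t + u) ^ n" for n
      by (simp add: Complex.DeMoivre cis_mult algebra_simps)
    then have "?f n u = ?P u * (cis (t + u) ^ n * cinner (b n) y)" for n
      by (metis (no_types, opaque_lifting) mult.assoc mult.commute)
    then show ?thesis
      using suminf_mult[OF s, of "?P u"] cinner_pseries_left[OF b, of "cis (t + u)" y]
      by (simp only: norm_cis order_refl simp_thms)
  qed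
  have "J = 2 * pi * cinner y y"
  proof -
    have s: "(\<lambda>n. (\<rho> * cis t) ^ n * cinner (b n) y) sums cinner y y"
      using bounded_linear.sums[OF bounded_linear_cinner_left
          summable_sums[OF pseries_terms_summable(2)[OF b, of "\<rho> * cis t"]], of y] \<rho>
      by (simp add: cinner_scaleC_left y_def pseries_def norm_mult)
    have "?I n = 2 * pi * ((\<rho> * cis t) ^ n * cinner (b n) y)" for n
      by (simp add: power_mult_distrib)
    then have "(\<lambda>n. 2 * pi * ((\<rho> * cis t) ^ n * cinner (b n) y)) sums J"
      using J(1) by (simp only:)
    then show ?thesis
      using sums_unique2[OF _ sums_mult[OF s, of "2 * pi"]] by simp
  qed
  then have "((\<lambda>u. poisson \<rho> u * Re (cinner (pseries b (cis (t + u))) y)) has_integral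
      2 * pi * (norm y)\<^sup>2) {- pi..pi}"
    using has_integral_Re[OF J(2)] unfolding f_eq by (simp add: cinner_self flip: of_real_power)
  moreover have cont: "(\<lambda>u. poisson \<rho> u * norm (pseries b (cis (t + u)))) integrable_on {- pi..pi}"
  proof (intro integrable_continuous_real continuous_intros continuous_on_poisson \<rho>)
    show "continuous_on {- pi..pi} (\<lambda>u. pseries b (cis (t + u)))"
      by (rule continuous_on_compose2[OF continuous_on_pseries_cis[OF b, of UNIV], of _ "\<lambda>u. t + u"])
        (auto intro!: continuous_intros)
  qed
  then have "((\<lambda>u. norm y * (poisson \<rho> u * norm (pseries b (cis (t + u))))) has_integral
      norm y * integral {- pi..pi} (\<lambda>u. poisson \<rho> u * norm (pseries b (cis (t + u))))) {- pi..pi}"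
    by (intro has_integral_mult_right integrable_integral)
  ultimately have le: "2 * pi * (norm y)\<^sup>2
      \<le> norm y * integral {- pi..pi} (\<lambda>u. poisson \<rho> u * norm (pseries b (cis (t + u))))"
  proof (rule has_integral_le)
    fix u
    have "Re (cinner (pseries b (cis (t + u))) y) \<le> norm (pseries b (cis (t + u))) * norm y"
      using cmod_cinner_le complex_Re_le_cmod order_trans by blast
    from mult_left_mono[OF this poisson_nonneg[OF \<rho>, of u]]
    show "poisson \<rho> u * Re (cinner (pseries b (cis (t + u))) y)
        \<le> norm y * (poisson \<rho> u * norm (pseries b (cis (t + u))))"
      by (simp add: mult_ac)
  qed
  show ?thesis
  proof (cases "norm y = 0")
    case True
    have "0 \<le> integral {- pi..pi} (\<lambda>u. poisson \<rho> u * norm (pseries b (cis (t + u))))"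
      by (intro integral_nonneg cont mult_nonneg_nonneg poisson_nonneg \<rho>) auto
    then show ?thesis
      using True by (simp flip: y_def)
  next
    case False
    have "norm y * (2 * pi * norm y)
        \<le> norm y * integral {- pi..pi} (\<lambda>u. poisson \<rho> u * norm (pseries b (cis (t + u))))"
      using le by (simp add: power2_eq_square mult_ac)
    then have "2 * pi * norm y \<le> integral {- pi..pi} (\<lambda>u. poisson \<rho> u * norm (pseries b (cis (t + u))))"
      using False by (subst (asm) mult_le_cancel_left_pos) auto
    then show ?thesis
      by (simp add: y_def)
  qed
qed

text \<open>The Poisson kernel is even and decreasing on \<open>[0, \<pi>]\<close>, so Poisson averages are dominated by the
  averages over centred intervals: integrate by parts against the primitive of \<open>g\<close>.\<close>

lemma poisson_integral_le_centred_averages: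
  fixes g :: "real \<Rightarrow> real"
  assumes g: "continuous_on UNIV g" and \<rho>: "0 \<le> \<rho>" "\<rho> < 1"
    and avg: "\<And>v. 0 < v \<Longrightarrow> v \<le> pi \<Longrightarrow> integral {t - v..t + v} g \<le> 2 * v * lam"
  shows "integral {- pi..pi} (\<lambda>u. poisson \<rho> u * g (t + u)) \<le> 2 * pi * lam"
proof -
  \<comment> \<open>a primitive of \<open>g\<close> whose base point lies to the left of all intervals in use\<close>
  define \<Phi> where "\<Phi> x = integral {t - 2 * pi..x} g" for x
  have cont: "continuous_on S g" for S
    using g continuous_on_subset by blast
  have \<Phi>': "(\<Phi> has_real_derivative g x) (at x)" if "x \<in> {t - pi..t + pi}" for x
  proof -
    have "(\<Phi> has_real_derivative g x) (at x within {t - 2 * pi..t + 2 * pi})"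
      unfolding \<Phi>_def using that pi_gt_zero by (intro integral_has_real_derivative cont) auto
    moreover have "t - 2 * pi < x" "x < t + 2 * pi"
      using that pi_gt_zero unfolding atLeastAtMost_iff by linarith+
    ultimately show ?thesis
      by (simp add: at_within_Icc_at)
  qed
  have \<Phi>_diff: "\<Phi> (t + v) - \<Phi> (t - v) = integral {t - v..t + v} g" if "0 \<le> v" "v \<le> pi" for v
    unfolding \<Phi>_def
    using Henstock_Kurzweil_Integration.integral_combine[of "t - 2 * pi" "t - v" "t + v" g] that pi_gt_zero
    by (simp add: integrable_continuous_real cont)
  define H where "H v = poisson \<rho> v * (\<Phi> (t + v) - \<Phi> (t - v) - 2 * v * lam)" for v
  define P' where "P' v = - ((1 - \<rho>\<^sup>2) * (2 * \<rho> * sin v) / (1 - 2 * \<rho> * cos v + \<rho>\<^sup>2)\<^sup>2)" for v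
  have P': "(poisson \<rho> has_real_derivative P' v) (at v)" for v
    unfolding poisson_def P'_def using poisson_denominator_pos[OF \<rho>, of v]
    by (auto intro!: derivative_eq_intros simp: power2_eq_square)
  have H': "(H has_real_derivative P' v * (\<Phi> (t + v) - \<Phi> (t - v) - 2 * v * lam)
      + poisson \<rho> v * (g (t + v) + g (t - v) - 2 * lam)) (at v)" if "v \<in> {0..pi}" for v
  proof -
    have 1: "((\<lambda>v. \<Phi> (t + v)) has_real_derivative g (t + v) * 1) (at v)"
      using that by (intro DERIV_chain2[OF \<Phi>']) (auto intro!: derivative_eq_intros)
    have 2: "((\<lambda>v. \<Phi> (t - v)) has_real_derivative g (t - v) * (- 1)) (at v)"
      using that by (intro DERIV_chain2[OF \<Phi>']) (auto intro!: derivative_eq_intros)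
    show ?thesis
      unfolding H_def by (rule derivative_eq_intros P' 1 2 refl | simp add: algebra_simps)+
  qed
  have int: "((\<lambda>v. P' v * (\<Phi> (t + v) - \<Phi> (t - v) - 2 * v * lam)
      + poisson \<rho> v * (g (t + v) + g (t - v) - 2 * lam)) has_integral H pi - H 0) {0..pi}"
    by (rule fundamental_theorem_of_calculus)
      (use H' in \<open>auto simp flip: has_real_derivative_iff_has_vector_derivative
        intro: has_field_derivative_at_within\<close>)
  let ?h = "\<lambda>v. poisson \<rho> v * (g (t + v) + g (t - v))"
  have cont_plus: "continuous_on {0..pi} (\<lambda>v. g (t + v))" "continuous_on {0..pi} (\<lambda>v. g (t - v))"
    by (rule continuous_on_compose2[OF g]; auto intro!: continuous_intros)+
  have h_int: "?h integrable_on {0..pi}"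
    by (intro integrable_continuous_real continuous_intros continuous_on_poisson \<rho> cont_plus)
  have "((\<lambda>v. ?h v - 2 * lam * poisson \<rho> v) has_integral integral {0..pi} ?h - 2 * lam * pi) {0..pi}"
    by (intro has_integral_diff integrable_integral h_int has_integral_mult_right poisson_has_integral_half \<rho>)
  then have "integral {0..pi} ?h - 2 * lam * pi \<le> H pi - H 0"
  proof (rule has_integral_le[OF _ int])
    fix v
    assume v: "v \<in> {0..pi}"
    have "\<Phi> (t + v) - \<Phi> (t - v) - 2 * v * lam \<le> 0"
      using v avg[of v] \<Phi>_diff[of v] by (cases "v = 0") auto
    moreover have "P' v \<le> 0"
      using v \<rho> sin_ge_zero[of v] by (simp add: P'_def power_le_one)
    ultimately have "0 \<le> P' v * (\<Phi> (t + v) - \<Phi> (t - v) - 2 * v * lam)"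
      by (rule mult_nonpos_nonpos[rotated])
    then show "?h v - 2 * lam * poisson \<rho> v \<le> P' v * (\<Phi> (t + v) - \<Phi> (t - v) - 2 * v * lam)
      + poisson \<rho> v * (g (t + v) + g (t - v) - 2 * lam)"
      by (simp add: algebra_simps)
  qed
  also have "\<dots> \<le> 0"
    using avg[of pi] \<Phi>_diff[of pi] pi_gt_zero poisson_nonneg[OF \<rho>, of pi]
    by (simp add: H_def mult_nonneg_nonpos)
  finally have h_le: "integral {0..pi} ?h \<le> 2 * pi * lam"
    by (simp add: mult_ac)
  let ?k = "\<lambda>u. poisson \<rho> u * g (t + u)"
  have k1: "(?k has_integral integral {0..pi} ?k) {0..pi}"
    by (intro integrable_integral integrable_continuous_real continuous_intros continuous_on_poisson \<rho> cont_plus)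
  let ?k' = "\<lambda>u. poisson \<rho> u * g (t - u)"
  have k2': "(?k' has_integral integral {0..pi} ?k') {0..pi}"
    by (intro integrable_integral integrable_continuous_real continuous_intros continuous_on_poisson \<rho> cont_plus)
  then have k2: "(?k has_integral integral {0..pi} ?k') {- pi..- 0}"
    by (subst has_integral_reflect_real[symmetric]) simp
  have "(?k has_integral integral {0..pi} ?k' + integral {0..pi} ?k) {- pi..pi}"
    by (rule has_integral_combine[of "- pi" 0 pi]) (use k1 k2 in auto)
  moreover have "(?h has_integral integral {0..pi} ?k + integral {0..pi} ?k') {0..pi}"
    using has_integral_add[OF k1 k2'] by (simp add: distrib_left)
  ultimately show ?thesis
    using h_le by (simp add: integral_unique)
qed

text \<open>Among the intervals on which \<open>g\<close> has a large average, the Vitali covering lemma selects disjoint ones whose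
  fivefold enlargements cover \<open>S\<close>. By disjointness their total length is at most \<open>\<integral> g / lam\<close>.\<close>

lemma centred_maximal_weak_type:
  fixes g :: "real \<Rightarrow> real"
  assumes g: "continuous_on UNIV g" "\<And>x. 0 \<le> g x" and lam: "0 < lam" and ab: "a + pi \<le> b - pi"
    and S: "S \<subseteq> {a + pi..b - pi}"
    and big: "\<And>t. t \<in> S \<Longrightarrow> \<exists>v. 0 < v \<and> v \<le> pi \<and> 2 * v * lam < integral {t - v..t + v} g"
  obtains U where "S \<subseteq> U" "U \<in> lmeasurable" "measure lebesgue U \<le> 5 / lam * integral {a..b} g"
proof -
  obtain v where v: "\<And>t. t \<in> S \<Longrightarrow> 0 < v t \<and> v t \<le> pi \<and> 2 * v t * lam < integral {t - v t..t + v t} g"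
    using big by metis
  have int: "g integrable_on {x..y}" for x y
    using g(1) by (intro integrable_continuous_real) (auto intro: continuous_on_subset)
  obtain C where C: "countable C" "C \<subseteq> S"
    "pairwise (\<lambda>i j. disjnt (cball i (v i)) (cball j (v j))) C"
    "S \<subseteq> (\<Union>i\<in>C. cball i (5 * v i))"
  proof (rule Vitali_covering_lemma_cballs[where S = S and K = S and a = "\<lambda>i. i" and r = v and B = pi])
    show "S \<subseteq> (\<Union>i\<in>S. cball i (v i))"
      using v by (auto intro!: bexI simp: less_imp_le)
  qed (use v in auto)
  have bound: "measure lebesgue (\<Union>i\<in>I. cball i (5 * v i)) \<le> 5 / lam * integral {a..b} g"
    if I: "I \<subseteq> C" "finite I" for I
  proof -
    have IS: "I \<subseteq> S"
      using I C(2) by blast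
    have cb: "cball i (v i) = {i - v i..i + v i}" for i
      by (rule cball_eq_atLeastAtMost)
    have "measure lebesgue (\<Union>i\<in>I. cball i (5 * v i)) \<le> (\<Sum>i\<in>I. measure lebesgue (cball i (5 * v i)))"
      by (rule measure_UNION_le[OF I(2)]) auto
    also have "\<dots> \<le> (\<Sum>i\<in>I. 5 / lam * integral (cball i (v i)) g)"
    proof (rule sum_mono)
      fix i
      assume "i \<in> I"
      then have vi: "0 < v i" "2 * v i * lam < integral {i - v i..i + v i} g"
        using IS v by auto
      have "measure lebesgue (cball i (5 * v i)) = 5 * (2 * v i)"
        using vi(1) by (simp add: cball_eq_atLeastAtMost)
      also have "\<dots> \<le> 5 * (integral (cball i (v i)) g / lam)"
        using vi(2) lam by (simp add: cb field_simps)
      finally show "measure lebesgue (cball i (5 * v i)) \<le> 5 / lam * integral (cball i (v i)) g"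
        by simp
    qed
    also have "\<dots> = 5 / lam * (\<Sum>i\<in>I. integral (cball i (v i)) g)"
      by (simp add: sum_distrib_left)
    also have "(\<Sum>i\<in>I. integral (cball i (v i)) g) \<le> integral {a..b} g"
    proof (rule has_integral_subset_le)
      show "(g has_integral (\<Sum>i\<in>I. integral (cball i (v i)) g)) (\<Union>i\<in>I. cball i (v i))"
      proof (rule has_integral_UN[OF I(2)])
        show "(g has_integral integral (cball i (v i)) g) (cball i (v i))" for i
          unfolding cb by (rule integrable_integral[OF int])
        show "pairwise (\<lambda>i j. negligible (cball i (v i) \<inter> cball j (v j))) I"
          using C(3) I(1) unfolding pairwise_def disjnt_def by (metis negligible_empty subsetD)
      qed
      show "(g has_integral integral {a..b} g) {a..b}"
        by (rule integrable_integral[OF int])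
      show "(\<Union>i\<in>I. cball i (v i)) \<subseteq> {a..b}"
        using IS v S unfolding cb by fastforce
    qed (use g in auto)
    finally show ?thesis
      using lam by (simp add: divide_right_mono)
  qed
  show thesis
  proof
    show "S \<subseteq> (\<Union>i\<in>C. cball i (5 * v i))"
      by (rule C)
    show "(\<Union>i\<in>C. cball i (5 * v i)) \<in> lmeasurable"
      by (rule fmeasurable_UN_bound[OF C(1) _ bound]) auto
    show "measure lebesgue (\<Union>i\<in>C. cball i (5 * v i)) \<le> 5 / lam * integral {a..b} g"
      by (rule measure_UN_bound[OF C(1) _ bound]) auto
  qed
qed

text \<open>Square summable coefficients are bounded, so the series converges absolutely inside the disc.\<close>

lemma pseries_terms_summable_disc:
  fixes a :: "nat \<Rightarrow> 'a :: complex_hilbert"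
  assumes a: "summable (\<lambda>n. (norm (a n))\<^sup>2)" and z: "cmod z < 1"
  shows "summable (\<lambda>n. norm (z ^ n *\<^sub>C a n))" "summable (\<lambda>n. z ^ n *\<^sub>C a n)"
proof -
  have "Bseq (\<lambda>n. (norm (a n))\<^sup>2)"
    by (rule convergent_imp_Bseq[OF convergentI[OF summable_LIMSEQ_zero[OF a]]])
  then obtain M where M: "\<And>n. (norm (a n))\<^sup>2 \<le> M"
    by (auto simp: Bseq_def)
  have bound: "norm (a n) \<le> M + 1" for n
    using M[of n] zero_le_power2[of "norm (a n) - 1/2"] by (simp add: power2_diff power_divide)
  show *: "summable (\<lambda>n. norm (z ^ n *\<^sub>C a n))"
  proof (rule summable_comparison_test')
    show "summable (\<lambda>n. cmod z ^ n * (M + 1))"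
      using z by (intro summable_mult2 summable_geometric) simp
    show "norm (norm (z ^ n *\<^sub>C a n)) \<le> cmod z ^ n * (M + 1)" for n
      using bound[of n] by (simp add: norm_scaleC norm_power mult_left_mono)
  qed
  then show "summable (\<lambda>n. z ^ n *\<^sub>C a n)"
    by (rule summable_norm_cancel)
qed

text \<open>For radii below a fixed \<open>s < 1\<close> the series may be rescaled to one with continuous boundary values, to which
  the Poisson bound and the weak type estimate apply.\<close>

lemma radial_maximal_estimate_below:
  fixes a :: "nat \<Rightarrow> 'a :: complex_hilbert"
  assumes a: "summable (\<lambda>n. (norm (a n))\<^sup>2)" and le: "(\<Sum>n. (norm (a n))\<^sup>2) \<le> \<epsilon>\<^sup>2"
    and pos: "0 < \<epsilon>" "0 < lam" and s: "0 < s" "s < 1"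
  defines "S \<equiv> {t \<in> {0..2 * pi}. \<exists>r. 0 \<le> r \<and> r < s \<and> lam < norm (pseries a (complex_of_real r * cis t))}"
  shows "S \<in> lmeasurable" "measure lebesgue S \<le> 20 * pi * \<epsilon> / lam"
proof -
  define b where "b n = complex_of_real s ^ n *\<^sub>C a n" for n
  have b: "summable (\<lambda>n. norm (b n))"
    unfolding b_def using pseries_terms_summable_disc(1)[OF a, of "complex_of_real s"] s by simp
  have ab: "pseries a (complex_of_real r * cis t) = pseries b (complex_of_real (r / s) * cis t)" for r t
  proof -
    have "(complex_of_real (r / s) * cis t) ^ n * complex_of_real s ^ n = (complex_of_real r * cis t) ^ n" for n
      unfolding power_mult_distrib[symmetric] using s by simp
    then show ?thesis
      by (simp only: pseries_def b_def scaleC_scaleC)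
  qed
  have b_le: "norm (b n) \<le> norm (a n)" for n
    using s by (simp add: b_def norm_scaleC norm_power mult_left_le_one_le power_le_one)
  have b2: "summable (\<lambda>n. (norm (b n))\<^sup>2)"
    by (rule summable_comparison_test'[OF a]) (use b_le in \<open>auto intro: power_mono\<close>)
  have b2_le: "(\<Sum>n. (norm (b n))\<^sup>2) \<le> \<epsilon>\<^sup>2"
    using suminf_le[OF _ b2 a] b_le le by (meson norm_ge_zero order_trans power_mono)
  define g where "g x = norm (pseries b (cis x))" for x
  have g: "continuous_on A g" for A
    unfolding g_def by (intro continuous_intros continuous_on_pseries_cis b)
  have g_int: "integral {- pi..3 * pi} g \<le> 4 * pi * \<epsilon>"
  proof -
    have sq: "((\<lambda>x. (g x)\<^sup>2) has_integral 2 * pi * (\<Sum>n. (norm (b n))\<^sup>2)) {c..c + 2 * pi}" for c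
      using parseval_pseries[OF b, of c] unfolding g_def by (metis sums_unique)
    have "((\<lambda>x. (g x)\<^sup>2) has_integral 2 * pi * (\<Sum>n. (norm (b n))\<^sup>2) + 2 * pi * (\<Sum>n. (norm (b n))\<^sup>2))
        {- pi..3 * pi}"
      using sq[of "- pi"] sq[of pi] by (intro has_integral_combine[of "- pi" pi "3 * pi"]) auto
    then have large: "((\<lambda>x. (g x)\<^sup>2 / \<epsilon> + \<epsilon>) has_integral
        4 * pi * (\<Sum>n. (norm (b n))\<^sup>2) / \<epsilon> + 4 * pi * \<epsilon>) {- pi..3 * pi}"
      using has_integral_const_real[of \<epsilon> "- pi" "3 * pi"]
      by (intro has_integral_add has_integral_divide) (auto simp: algebra_simps)
    have small: "((\<lambda>x. 2 * g x) has_integral 2 * integral {- pi..3 * pi} g) {- pi..3 * pi}"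
      by (intro has_integral_mult_right integrable_integral integrable_continuous_real g)
    have "2 * integral {- pi..3 * pi} g \<le> 4 * pi * (\<Sum>n. (norm (b n))\<^sup>2) / \<epsilon> + 4 * pi * \<epsilon>"
    proof (rule has_integral_le[OF small large])
      fix x
      \<comment> \<open>instead of the Cauchy-Schwarz inequality for integrals: \<open>2 g \<le> g\<^sup>2 / \<epsilon> + \<epsilon>\<close>\<close>
      have "0 \<le> (g x - \<epsilon>)\<^sup>2 / \<epsilon>"
        using pos by simp
      also have "\<dots> = (g x)\<^sup>2 / \<epsilon> + \<epsilon> - 2 * g x"
        using pos by (simp add: power2_diff field_simps power2_eq_square)
      finally show "2 * g x \<le> (g x)\<^sup>2 / \<epsilon> + \<epsilon>"
        by simp
    qed
    also have "4 * pi * (\<Sum>n. (norm (b n))\<^sup>2) / \<epsilon> \<le> 4 * pi * \<epsilon>\<^sup>2 / \<epsilon>"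
      using b2_le pos by (intro divide_right_mono mult_left_mono) auto
    finally show ?thesis
      using pos by (simp add: power2_eq_square)
  qed
  have big: "\<exists>v. 0 < v \<and> v \<le> pi \<and> 2 * v * lam < integral {t - v..t + v} g" if t: "t \<in> S" for t
  proof (rule ccontr)
    assume *: "\<not> ?thesis"
    obtain r where r: "0 \<le> r" "r < s" "lam < norm (pseries a (complex_of_real r * cis t))"
      using t by (auto simp: S_def)
    have rs: "0 \<le> r / s" "r / s < 1"
      using r s by auto
    have "2 * pi * norm (pseries b (complex_of_real (r / s) * cis t))
        \<le> integral {- pi..pi} (\<lambda>u. poisson (r / s) u * g (t + u))"
      unfolding g_def by (rule norm_pseries_le_poisson_integral[OF b rs])
    also have "\<dots> \<le> 2 * pi * lam"
      by (rule poisson_integral_le_centred_averages[OF g rs]) (use * in force)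
    finally show False
      using r(3) by (simp add: ab)
  qed
  obtain U where U: "S \<subseteq> U" "U \<in> lmeasurable" "measure lebesgue U \<le> 5 / lam * integral {- pi..3 * pi} g"
  proof (rule centred_maximal_weak_type[OF g _ pos(2) _ _ big])
    show "0 \<le> g x" for x
      by (simp add: g_def)
    show "S \<subseteq> {- pi + pi..3 * pi - pi}"
      by (auto simp: S_def)
  qed auto
  have "S = {0..2 * pi} \<inter> (\<Union>r\<in>{0..<s}. {t. lam < norm (pseries b (complex_of_real (r / s) * cis t))})"
    by (auto simp: S_def ab)
  moreover have "open {t. lam < norm (pseries b (complex_of_real (r / s) * cis t))}" if "r \<in> {0..<s}" for r
    using that by (intro open_Collect_less continuous_intros
        continuous_on_compose2[OF continuous_on_pseries[OF b]]) (auto simp: norm_mult norm_divide)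
  then have "open (\<Union>r\<in>{0..<s}. {t. lam < norm (pseries b (complex_of_real (r / s) * cis t))})"
    by (intro open_UN) blast
  then have "(\<Union>r\<in>{0..<s}. {t. lam < norm (pseries b (complex_of_real (r / s) * cis t))}) \<in> sets lebesgue"
    using borel_open by (intro sets_completionI_sets) simp
  ultimately have "S \<in> sets lebesgue"
    by (simp only:) (intro sets.Int, auto)
  then show Sm: "S \<in> lmeasurable"
    using U fmeasurableI2 by blast
  have "measure lebesgue S \<le> measure lebesgue U"
    by (rule measure_mono_fmeasurable[OF U(1) \<open>S \<in> sets lebesgue\<close> U(2)])
  also have "\<dots> \<le> 5 / lam * (4 * pi * \<epsilon>)"
    using U(3) g_int pos by (meson divide_nonneg_pos mult_left_mono order_trans zero_le_numeral)
  finally show "measure lebesgue S \<le> 20 * pi * \<epsilon> / lam"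
    by simp
qed

text \<open>As \<open>s\<close> increases to \<open>1\<close>, the exceptional sets increase and the bound stays the same.\<close>

lemma radial_maximal_estimate:
  fixes a :: "nat \<Rightarrow> 'a :: complex_hilbert"
  assumes a: "summable (\<lambda>n. (norm (a n))\<^sup>2)" and le: "(\<Sum>n. (norm (a n))\<^sup>2) \<le> \<epsilon>\<^sup>2"
    and pos: "0 < \<epsilon>" "0 < lam"
  defines "S \<equiv> {t \<in> {0..2 * pi}. \<exists>r. 0 \<le> r \<and> r < 1 \<and> lam < norm (pseries a (complex_of_real r * cis t))}"
  shows "S \<in> lmeasurable" "measure lebesgue S \<le> 20 * pi * \<epsilon> / lam"
proof -
  define s where "s k = 1 - 1 / (real k + 2)" for k
  have s: "0 < s k" "s k < 1" for k
    by (auto simp: s_def)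
  define Sk where "Sk k = {t \<in> {0..2 * pi}. \<exists>r. 0 \<le> r \<and> r < s k \<and>
      lam < norm (pseries a (complex_of_real r * cis t))}" for k
  have Sk: "Sk k \<in> lmeasurable" "measure lebesgue (Sk k) \<le> 20 * pi * \<epsilon> / lam" for k
    unfolding Sk_def by (rule radial_maximal_estimate_below[OF a le pos s])+
  have mono: "Sk i \<subseteq> Sk j" if "i \<le> j" for i j
  proof -
    have "s i \<le> s j"
      using that by (auto simp: s_def frac_le)
    then show ?thesis
      by (force simp: Sk_def)
  qed
  have bound: "measure lebesgue (\<Union>k\<in>I. Sk k) \<le> 20 * pi * \<epsilon> / lam" if I: "finite I" for I
  proof (cases "I = {}")
    case False
    have "(\<Union>k\<in>I. Sk k) \<subseteq> Sk (Max I)"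
      using mono Max_ge[OF I] by blast
    then have "measure lebesgue (\<Union>k\<in>I. Sk k) \<le> measure lebesgue (Sk (Max I))"
      using Sk(1) I by (intro measure_mono_fmeasurable) (auto intro!: sets.finite_UN)
    then show ?thesis
      using Sk(2)[of "Max I"] by simp
  qed (use pos in simp)
  have "S = (\<Union>k. Sk k)"
  proof
    show "S \<subseteq> (\<Union>k. Sk k)"
    proof
      fix t
      assume "t \<in> S"
      then obtain r where r: "t \<in> {0..2 * pi}" "0 \<le> r" "r < 1"
        "lam < norm (pseries a (complex_of_real r * cis t))"
        by (auto simp: S_def)
      obtain k where "1 / (real k + 1) < 1 - r"
        using reals_Archimedean[of "1 - r"] r by (auto simp: inverse_eq_divide add.commute)
      moreover have "1 / (real k + 2) \<le> 1 / (real k + 1)"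
        by (simp add: frac_le)
      ultimately have "r < s k"
        by (simp add: s_def)
      with r show "t \<in> (\<Union>k. Sk k)"
        unfolding Sk_def by blast
    qed
    have "r < 1" if "r < s k" for r k
      using that s(2)[of k] by simp
    then show "(\<Union>k. Sk k) \<subseteq> S"
      unfolding Sk_def S_def by blast
  qed
  then show "S \<in> lmeasurable" "measure lebesgue S \<le> 20 * pi * \<epsilon> / lam"
    using fmeasurable_UN_bound[of UNIV Sk lebesgue "20 * pi * \<epsilon> / lam"]
      measure_UN_bound[of UNIV Sk lebesgue "20 * pi * \<epsilon> / lam"] Sk(1) bound by auto
qed

lemma AE_circI:
  assumes "negligible {t \<in> {0..2 * pi}. \<not> P t}"
  shows "AE t in circ. P t"
proof -
  have "AE t in lebesgue. t \<notin> {t \<in> {0..2 * pi}. \<not> P t}"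
    using assms by (intro AE_not_in) (simp add: negligible_iff_null_sets)
  then show ?thesis
    by (subst AE_restrict_space_iff) (auto elim: eventually_mono)
qed

lemma convergent_at_left_if_Cauchy:
  fixes f :: "real \<Rightarrow> 'a :: complete_space"
  assumes f: "\<And>m :: nat. \<exists>d<1. \<forall>r s. d < r \<and> r < 1 \<and> d < s \<and> s < 1 \<longrightarrow> dist (f r) (f s) \<le> 1 / Suc m"
  shows "\<exists>l. (f \<longlongrightarrow> l) (at_left 1)"
proof -
  have f': "\<exists>d<1. \<forall>r s. d < r \<and> r < 1 \<and> d < s \<and> s < 1 \<longrightarrow> dist (f r) (f s) < e" if e: "e > 0" for e
  proof -
    obtain m where "1 / real (Suc m) < e"
      using reals_Archimedean[OF e] by (auto simp: inverse_eq_divide)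
    then show ?thesis
      using f[of m] by (meson le_less_trans)
  qed
  define x where "x n = 1 - 1 / real (Suc n)" for n
  have x1: "x n < 1" for n
    by (simp add: x_def)
  have "x \<longlonglongrightarrow> 1 - 0"
    unfolding x_def using LIMSEQ_inverse_real_of_nat by (intro tendsto_intros) (simp add: inverse_eq_divide)
  then have ev: "\<forall>\<^sub>F n in sequentially. d < x n" if "d < 1" for d
    using that by (simp add: order_tendstoD(1))
  have "Cauchy (\<lambda>n. f (x n))"
  proof (rule metric_CauchyI)
    fix e :: real
    assume "e > 0"
    then obtain d where d: "d < 1" "\<forall>r s. d < r \<and> r < 1 \<and> d < s \<and> s < 1 \<longrightarrow> dist (f r) (f s) < e"
      using f' by blast
    obtain N where "\<forall>n\<ge>N. d < x n"
      using ev[OF d(1)] by (auto simp: eventually_sequentially)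
    then show "\<exists>M. \<forall>m\<ge>M. \<forall>n\<ge>M. dist (f (x m)) (f (x n)) < e"
      using d(2) x1 by blast
  qed
  then obtain l where l: "(\<lambda>n. f (x n)) \<longlonglongrightarrow> l"
    using Cauchy_convergent_iff convergent_def by blast
  have "(f \<longlongrightarrow> l) (at_left 1)"
  proof (rule tendstoI)
    fix e :: real
    assume e: "e > 0"
    then obtain d where d: "d < 1" "\<forall>r s. d < r \<and> r < 1 \<and> d < s \<and> s < 1 \<longrightarrow> dist (f r) (f s) < e / 2"
      using f'[of "e / 2"] by auto
    have "dist (f r) l < e" if r: "r \<in> {d<..<1}" for r
    proof -
      have "\<forall>\<^sub>F n in sequentially. dist (f r) (f (x n)) \<le> e / 2"
        using ev[OF d(1)] by eventually_elim (use d(2) x1 r in \<open>auto intro: less_imp_le\<close>)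
      then have "dist (f r) l \<le> e / 2"
        by (intro tendsto_upperbound[OF tendsto_dist[OF tendsto_const l]]) auto
      then show ?thesis
        using e by simp
    qed
    then show "\<forall>\<^sub>F r in at_left 1. dist (f r) l < e"
      using eventually_at_left_real[OF d(1)] by (auto elim: eventually_mono)
  qed
  then show ?thesis
    by blast
qed

text \<open>A vector-valued form of Fatou's theorem. Polynomials converge everywhere, and by the maximal inequality a tail of
  small norm exceeds a given bound only on a set of small measure.\<close>

theorem pseries_radial_limit:
  fixes a :: "nat \<Rightarrow> 'a :: complex_hilbert"
  assumes a: "summable (\<lambda>n. (norm (a n))\<^sup>2)"
  shows "AE t in circ. \<exists>l. ((\<lambda>r. pseries a (complex_of_real r * cis t)) \<longlongrightarrow> l) (at_left 1)"
proof -
  let ?f = "\<lambda>t r. pseries a (complex_of_real r * cis t)"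
  have "AE t in circ. \<exists>d<1. \<forall>r s. d < r \<and> r < 1 \<and> d < s \<and> s < 1 \<longrightarrow> dist (?f t r) (?f t s) \<le> 1 / Suc m"
    (is "AE t in circ. ?Q t") for m
  proof (rule AE_circI, unfold negligible_outer_le, intro allI impI)
    fix e :: real
    assume e: "e > 0"
    define lam where "lam = 1 / (3 * real (Suc m))"
    have lam: "0 < lam"
      by (simp add: lam_def)
    define \<epsilon> where "\<epsilon> = e * lam / (20 * pi)"
    have \<epsilon>: "0 < \<epsilon>"
      using e lam by (simp add: \<epsilon>_def)
    obtain N where N: "norm (\<Sum>i. (norm (a (i + N)))\<^sup>2) < \<epsilon>\<^sup>2"
      using suminf_exist_split[OF _ a, of "\<epsilon>\<^sup>2"] \<epsilon> by auto
    define b where "b n = (if n < N then 0 else a n)" for n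
    have b: "summable (\<lambda>n. (norm (b n))\<^sup>2)"
      by (rule summable_comparison_test'[OF a]) (auto simp: b_def)
    have "(\<Sum>n. (norm (b n))\<^sup>2) = (\<Sum>i. (norm (b (i + N)))\<^sup>2) + (\<Sum>i<N. (norm (b i))\<^sup>2)"
      by (rule suminf_split_initial_segment[OF b])
    also have "\<dots> = (\<Sum>i. (norm (a (i + N)))\<^sup>2)"
      by (simp add: b_def)
    finally have b_le: "(\<Sum>n. (norm (b n))\<^sup>2) \<le> \<epsilon>\<^sup>2"
      using N by simp
    define p where "p z = (\<Sum>n<N. z ^ n *\<^sub>C a n)" for z
    have split: "pseries a z = p z + pseries b z" if z: "cmod z < 1" for z
    proof -
      have "pseries a z = (\<Sum>i. z ^ (i + N) *\<^sub>C a (i + N)) + p z"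
        unfolding pseries_def p_def
        by (rule suminf_split_initial_segment[OF pseries_terms_summable_disc(2)[OF a z]])
      moreover have "pseries b z = (\<Sum>i. z ^ (i + N) *\<^sub>C b (i + N)) + (\<Sum>i<N. z ^ i *\<^sub>C b i)"
        unfolding pseries_def
        by (rule suminf_split_initial_segment[OF pseries_terms_summable_disc(2)[OF b z]])
      ultimately show ?thesis
        by (simp add: b_def)
    qed
    define S where "S = {t \<in> {0..2 * pi}. \<exists>r. 0 \<le> r \<and> r < 1 \<and> lam < norm (pseries b (complex_of_real r * cis t))}"
    have "S \<in> lmeasurable" "measure lebesgue S \<le> 20 * pi * \<epsilon> / lam"
      unfolding S_def by (rule radial_maximal_estimate[OF b b_le \<epsilon> lam])+
    moreover have "20 * pi * \<epsilon> / lam = e"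
      using lam by (simp add: \<epsilon>_def)
    moreover have "{t \<in> {0..2 * pi}. \<not> ?Q t} \<subseteq> S"
    proof
      fix t
      assume t: "t \<in> {t \<in> {0..2 * pi}. \<not> ?Q t}"
      show "t \<in> S"
      proof (rule ccontr)
        assume "t \<notin> S"
        then have tail: "norm (pseries b (complex_of_real r * cis t)) \<le> lam" if "0 \<le> r" "r < 1" for r
          using t that by (auto simp: S_def not_less)
        have "continuous_on UNIV (\<lambda>r. p (complex_of_real r * cis t))"
          unfolding p_def by (intro continuous_on_sum continuous_on_scaleC_left continuous_intros)
        then have "((\<lambda>r. p (complex_of_real r * cis t)) \<longlongrightarrow> p (complex_of_real 1 * cis t)) (at_left 1)"
          by (meson UNIV_I continuous_on_def filterlim_at_split iso_tuple_UNIV_I open_UNIV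
              continuous_on_eq_continuous_at isCont_def)
        then have "\<forall>\<^sub>F r in at_left 1. dist (p (complex_of_real r * cis t)) (p (complex_of_real 1 * cis t)) < lam / 2"
          using lam by (intro tendstoD) auto
        then obtain d0 where d0: "d0 < 1"
          "\<And>r. d0 < r \<Longrightarrow> r < 1 \<Longrightarrow> dist (p (complex_of_real r * cis t)) (p (complex_of_real 1 * cis t)) < lam / 2"
          unfolding eventually_at_left_field by auto
        have "dist (?f t r) (?f t s) \<le> 1 / Suc m"
          if r: "max d0 0 < r" "r < 1" and s: "max d0 0 < s" "s < 1" for r s
        proof -
          let ?zr = "complex_of_real r * cis t" and ?zs = "complex_of_real s * cis t"
          have "dist (?f t r) (?f t s) = norm ((p ?zr - p ?zs) + (pseries b ?zr - pseries b ?zs))"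
            using r s by (simp add: split norm_mult dist_norm algebra_simps)
          also have "\<dots> \<le> dist (p ?zr) (p ?zs) + (norm (pseries b ?zr) + norm (pseries b ?zs))"
            by (intro order_trans[OF norm_triangle_ineq] add_mono norm_triangle_ineq4)
              (simp add: dist_norm)
          also have "\<dots> \<le> lam + (lam + lam)"
            using r s d0(2)[of r] d0(2)[of s] tail[of r] tail[of s]
              dist_triangle2[of "p ?zr" "p ?zs" "p (complex_of_real 1 * cis t)"]
            by (intro add_mono) auto
          also have "\<dots> = 1 / Suc m"
            by (simp add: lam_def field_simps)
          finally show ?thesis .
        qed
        then have "?Q t"
          using d0(1) by (intro exI[of _ "max d0 0"]) auto
        with t show False
          by blast
      qed
    qed
    ultimately show "\<exists>T. {t \<in> {0..2 * pi}. \<not> ?Q t} \<subseteq> T \<and> T \<in> lmeasurable \<and> measure lebesgue T \<le> e"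
      by blast
  qed
  then have "AE t in circ. \<forall>m. \<exists>d<1. \<forall>r s. d < r \<and> r < 1 \<and> d < s \<and> s < 1 \<longrightarrow>
      dist (?f t r) (?f t s) \<le> 1 / Suc m"
    unfolding AE_all_countable by blast
  then show ?thesis
    by (rule eventually_mono) (rule convergent_at_left_if_Cauchy, blast)
qed

section \<open>The space of square-integrable functions\<close>

lemma sets_circ: "A \<in> sets circ \<longleftrightarrow> A \<in> sets lebesgue \<and> A \<subseteq> {0..2 * pi}"
  by (subst sets_restrict_space_iff) auto

text \<open>Measurability survives a change on a null set because Lebesgue measure is complete.\<close>

lemma borel_measurable_circ_AE:
  assumes f: "f \<in> borel_measurable circ" and eq: "AE t in circ. f t = g t"
  shows "g \<in> borel_measurable circ"
proof (rule measurableI)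
  obtain N where N: "\<And>t. t \<in> space circ - N \<Longrightarrow> f t = g t" "N \<in> null_sets circ"
    using AE_E3[OF eq] by blast
  have N0: "N \<in> null_sets lebesgue"
    using N(2) by (subst (asm) null_sets_restrict_space) auto
  fix B :: "'a set"
  assume B: "B \<in> sets borel"
  have sub: "g -` B \<inter> {0..2 * pi} \<inter> N \<in> sets lebesgue"
    by (rule completion.complete[OF _ N0]) auto
  have "f -` B \<inter> {0..2 * pi} \<in> sets lebesgue"
    using measurable_sets[OF f B] by (simp add: sets_circ)
  with sub N0 have "(f -` B \<inter> {0..2 * pi} - N) \<union> (g -` B \<inter> {0..2 * pi} \<inter> N) \<in> sets lebesgue"
    by auto
  moreover have "g -` B \<inter> {0..2 * pi} = (f -` B \<inter> {0..2 * pi} - N) \<union> (g -` B \<inter> {0..2 * pi} \<inter> N)"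
    using N(1) by auto
  ultimately show "g -` B \<inter> space circ \<in> sets circ"
    by (simp add: sets_circ)
qed auto

lemma rep_L2_sq_integrable: "sq_integrable (rep_L2 f)"
  using Quotient_rep_reflp[OF Quotient_L2, of f] by (simp add: L2_eq_def)

lemma rep_L2_measurable [measurable]: "rep_L2 f \<in> borel_measurable circ"
  using rep_L2_sq_integrable[of f] by (simp add: sq_integrable_def)

lemma abs_rep_L2 [simp]: "abs_L2 (rep_L2 f) = f"
  by (rule Quotient_abs_rep[OF Quotient_L2])

lemma rep_abs_L2: "sq_integrable u \<Longrightarrow> AE t in circ. rep_L2 (abs_L2 u) t = u t"
  using Quotient_rep_abs[OF Quotient_L2, of u] by (auto simp: L2_eq_def)

lemma L2_eqI: "AE t in circ. rep_L2 f t = rep_L2 g t \<Longrightarrow> f = g"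
  using Quotient_rel_rep[OF Quotient_L2, of f g] rep_L2_sq_integrable[of f] rep_L2_sq_integrable[of g]
  by (simp add: L2_eq_def)

lemma rep_L2_add: "AE t in circ. rep_L2 (f + g) t = rep_L2 f t + rep_L2 g t"
  using rep_abs_L2[OF sq_integrable_add[OF rep_L2_sq_integrable[of f] rep_L2_sq_integrable[of g]]]
    plus_L2.abs_eq[of "rep_L2 f" "rep_L2 g"] rep_L2_sq_integrable[of f] rep_L2_sq_integrable[of g]
  by (simp add: L2_eq_def)

lemma rep_L2_diff: "AE t in circ. rep_L2 (f - g) t = rep_L2 f t - rep_L2 g t"
  using rep_abs_L2[OF sq_integrable_diff[OF rep_L2_sq_integrable[of f] rep_L2_sq_integrable[of g]]]
    minus_L2.abs_eq[of "rep_L2 f" "rep_L2 g"] rep_L2_sq_integrable[of f] rep_L2_sq_integrable[of g]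
  by (simp add: L2_eq_def)

lemma rep_L2_scaleC: "AE t in circ. rep_L2 (c *\<^sub>C f) t = c *\<^sub>C rep_L2 f t"
  using rep_abs_L2[OF sq_integrable_scaleC[OF rep_L2_sq_integrable[of f]]]
    scaleC_L2.abs_eq[of "rep_L2 f" c] rep_L2_sq_integrable[of f]
  by (simp add: L2_eq_def)

lemma rep_L2_zero: "AE t in circ. rep_L2 0 t = 0"
  using rep_abs_L2[OF sq_integrable_zero] by (simp add: zero_L2_def)

lemma cinner_L2_eq: "cinner f g = (LINT t|circ. cinner (rep_L2 f t) (rep_L2 g t))"
  using cinner_L2.abs_eq[of "rep_L2 f" "rep_L2 g"] rep_L2_sq_integrable[of f] rep_L2_sq_integrable[of g]
  by (simp add: L2_eq_def)

lemma norm_L2_sq: "(norm f)\<^sup>2 = (LINT t|circ. (norm (rep_L2 f t))\<^sup>2)"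
proof -
  have "complex_of_real ((norm f)\<^sup>2) = (LINT t|circ. complex_of_real ((norm (rep_L2 f t))\<^sup>2))"
    unfolding cinner_self[symmetric] cinner_L2_eq ..
  also have "\<dots> = complex_of_real (LINT t|circ. (norm (rep_L2 f t))\<^sup>2)"
    by (rule integral_complex_of_real)
  finally show ?thesis
    by (simp only: of_real_eq_iff)
qed

lemma integrable_norm_rep_L2_sq: "integrable circ (\<lambda>t. (norm (rep_L2 f t))\<^sup>2)"
  using rep_L2_sq_integrable[of f] by (simp add: sq_integrable_def)

lemma nn_integral_norm_rep_L2_sq: "(\<integral>\<^sup>+t. ennreal ((norm (rep_L2 f t))\<^sup>2) \<partial>circ) = ennreal ((norm f)\<^sup>2)"
  unfolding norm_L2_sq by (rule nn_integral_eq_integral[OF integrable_norm_rep_L2_sq]) simp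

lemma sq_integrable_abs_L2_norm:
  assumes u: "u \<in> borel_measurable circ" and le: "(\<integral>\<^sup>+t. ennreal ((norm (u t))\<^sup>2) \<partial>circ) \<le> ennreal (c\<^sup>2)" and c: "0 \<le> c"
  shows "sq_integrable u" "norm (abs_L2 u) \<le> c"
proof -
  note u [measurable]
  have "integrable circ (\<lambda>t. (norm (u t))\<^sup>2)"
    using le by (intro integrableI_nonneg) (auto simp: ennreal_less_top order_le_less_trans)
  then show s: "sq_integrable u"
    using u by (simp add: sq_integrable_def)
  have "(\<integral>\<^sup>+t. ennreal ((norm (rep_L2 (abs_L2 u) t))\<^sup>2) \<partial>circ) = (\<integral>\<^sup>+t. ennreal ((norm (u t))\<^sup>2) \<partial>circ)"
    by (rule nn_integral_cong_AE) (use rep_abs_L2[OF s] in \<open>auto elim: eventually_mono\<close>)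
  then have "ennreal ((norm (abs_L2 u))\<^sup>2) \<le> ennreal (c\<^sup>2)"
    using le by (simp add: nn_integral_norm_rep_L2_sq)
  then have "(norm (abs_L2 u))\<^sup>2 \<le> c\<^sup>2"
    by (subst (asm) ennreal_le_iff) auto
  then show "norm (abs_L2 u) \<le> c"
    by (rule power2_le_imp_le[OF _ c])
qed

text \<open>The sum \<open>\<Sum> 2\<^sup>n \<parallel>F\<^sub>n\<^sub>+\<^sub>1 - F\<^sub>n\<parallel>\<^sup>2\<close> is integrable, hence finite almost everywhere, and \<open>h \<le> 2\<^sup>n h\<^sup>2 + 2\<^sup>-\<^sup>n\<close> makes the
  increments \<open>h\<close> themselves summable there. By Fatou's lemma the pointwise limit is also the limit in the mean.\<close>

lemma L2_fast_Cauchy: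
  fixes F :: "nat \<Rightarrow> 'a :: chilbert_space L2"
  assumes F: "\<And>n. norm (F (Suc n) - F n) \<le> (1/2) ^ n"
  obtains G where "F \<longlonglongrightarrow> G" "AE t in circ. (\<lambda>n. rep_L2 (F n) t) \<longlonglongrightarrow> rep_L2 G t"
proof -
  have F_dist: "norm (F (n + k) - F n) \<le> 2 * (1/2) ^ n" for n k
  proof -
    have "norm (F (n + k) - F n) \<le> 2 * (1/2) ^ n - 2 * (1/2) ^ (n + k)"
    proof (induction k)
      case (Suc k)
      have "norm (F (n + Suc k) - F n) \<le> norm (F (Suc (n + k)) - F (n + k)) + norm (F (n + k) - F n)"
        using norm_triangle_ineq[of "F (Suc (n + k)) - F (n + k)" "F (n + k) - F n"] by simp
      also have "\<dots> \<le> (1/2) ^ (n + k) + (2 * (1/2) ^ n - 2 * (1/2) ^ (n + k))"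
        by (intro add_mono F Suc)
      finally show ?case
        by simp
    qed simp
    then show ?thesis
      by (smt (verit) zero_le_power divide_nonneg_nonneg)
  qed
  let ?h = "\<lambda>n t. norm (rep_L2 (F (Suc n) - F n) t)"
  have "(\<integral>\<^sup>+t. (\<Sum>n. ennreal (2 ^ n * (?h n t)\<^sup>2)) \<partial>circ) = (\<Sum>n. \<integral>\<^sup>+t. ennreal (2 ^ n * (?h n t)\<^sup>2) \<partial>circ)"
    by (rule nn_integral_suminf) measurable
  also have "\<dots> \<le> (\<Sum>n. ennreal ((1/2) ^ n))"
  proof (rule suminf_le)
    fix n
    have "(\<integral>\<^sup>+t. ennreal (2 ^ n * (?h n t)\<^sup>2) \<partial>circ) = ennreal (2 ^ n) * (\<integral>\<^sup>+t. ennreal ((?h n t)\<^sup>2) \<partial>circ)"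
      by (subst nn_integral_cmult[symmetric]) (auto simp: ennreal_mult)
    also have "\<dots> = ennreal (2 ^ n * (norm (F (Suc n) - F n))\<^sup>2)"
      by (simp add: nn_integral_norm_rep_L2_sq ennreal_mult)
    also have "\<dots> \<le> ennreal (2 ^ n * ((1/2) ^ n)\<^sup>2)"
      by (intro ennreal_leI mult_left_mono power_mono F) auto
    also have "2 ^ n * ((1/2 :: real) ^ n)\<^sup>2 = (1/2) ^ n"
      by (simp add: power2_eq_square power_mult_distrib[symmetric] flip: power_mult_distrib)
    finally show "(\<integral>\<^sup>+t. ennreal (2 ^ n * (?h n t)\<^sup>2) \<partial>circ) \<le> ennreal ((1/2) ^ n)" .
  qed auto
  also have "\<dots> < \<infinity>"
    by (subst suminf_ennreal2) (auto simp: ennreal_less_top)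
  finally have "AE t in circ. (\<Sum>n. ennreal (2 ^ n * (?h n t)\<^sup>2)) \<noteq> \<infinity>"
    by (intro nn_integral_PInf_AE) (auto simp: less_top)
  moreover have "AE t in circ. \<forall>n. rep_L2 (F (Suc n) - F n) t = rep_L2 (F (Suc n)) t - rep_L2 (F n) t"
    unfolding AE_all_countable using rep_L2_diff by blast
  ultimately have conv: "AE t in circ. convergent (\<lambda>n. rep_L2 (F n) t)"
  proof eventually_elim
    fix t
    assume fin: "(\<Sum>n. ennreal (2 ^ n * (?h n t)\<^sup>2)) \<noteq> \<infinity>"
      and eq: "\<forall>n. rep_L2 (F (Suc n) - F n) t = rep_L2 (F (Suc n)) t - rep_L2 (F n) t"
    have "summable (\<lambda>n. 2 ^ n * (?h n t)\<^sup>2)"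
      using fin by (intro summable_suminf_not_top) auto
    then have s: "summable (\<lambda>n. 2 ^ n * (?h n t)\<^sup>2 + (1/2) ^ n)"
      by (intro summable_add) auto
    have "summable (\<lambda>n. ?h n t)"
    proof (rule summable_comparison_test'[OF s])
      fix n
      have "?h n t \<le> 2 ^ n * (?h n t)\<^sup>2 + (1/2) ^ n"
      proof (cases "?h n t \<le> (1/2) ^ n")
        case False
        then have "1 \<le> 2 ^ n * ?h n t"
          by (simp add: power_divide field_simps)
        then have "1 * ?h n t \<le> (2 ^ n * ?h n t) * ?h n t"
          by (intro mult_right_mono) auto
        moreover have "0 \<le> (1/2 :: real) ^ n"
          by simp
        ultimately show ?thesis
          by (simp add: power2_eq_square mult.assoc add_increasing2)
      qed (simp add: add_increasing)
      then show "norm (?h n t) \<le> 2 ^ n * (?h n t)\<^sup>2 + (1/2) ^ n"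
        by simp
    qed
    then have "summable (\<lambda>n. norm (rep_L2 (F (Suc n)) t - rep_L2 (F n) t))"
      using eq by simp
    then have "summable (\<lambda>n. rep_L2 (F (Suc n)) t - rep_L2 (F n) t)"
      by (rule summable_norm_cancel)
    then have "convergent (\<lambda>n. \<Sum>i<n. rep_L2 (F (Suc i)) t - rep_L2 (F i) t)"
      by (simp add: summable_iff_convergent)
    then have "convergent (\<lambda>n. rep_L2 (F n) t - rep_L2 (F 0) t)"
      unfolding sum_lessThan_telescope[of "\<lambda>n. rep_L2 (F n) t"] .
    then show "convergent (\<lambda>n. rep_L2 (F n) t)"
      using convergent_diff_const_right_iff[of "\<lambda>n. rep_L2 (F n) t" "rep_L2 (F 0) t"] by simp
  qed
  define u where "u t = lim (\<lambda>n. rep_L2 (F n) t)" for t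
  have [measurable]: "u \<in> borel_measurable circ"
    unfolding u_def by measurable
  have lim: "AE t in circ. (\<lambda>n. rep_L2 (F n) t) \<longlonglongrightarrow> u t"
    using conv by eventually_elim (simp add: u_def convergent_LIMSEQ_iff)
  have diff: "(\<integral>\<^sup>+t. ennreal ((norm (u t - rep_L2 (F n) t))\<^sup>2) \<partial>circ) \<le> ennreal ((2 * (1/2) ^ n)\<^sup>2)" for n
  proof -
    have "AE t in circ. \<forall>k. rep_L2 (F (n + k) - F n) t = rep_L2 (F (n + k)) t - rep_L2 (F n) t"
      unfolding AE_all_countable using rep_L2_diff by blast
    with lim have "AE t in circ. ennreal ((norm (u t - rep_L2 (F n) t))\<^sup>2)
        = liminf (\<lambda>k. ennreal ((norm (rep_L2 (F (n + k) - F n) t))\<^sup>2))"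
    proof eventually_elim
      fix t
      assume l: "(\<lambda>n. rep_L2 (F n) t) \<longlonglongrightarrow> u t"
        and eq: "\<forall>k. rep_L2 (F (n + k) - F n) t = rep_L2 (F (n + k)) t - rep_L2 (F n) t"
      have "(\<lambda>k. rep_L2 (F (k + n)) t) \<longlonglongrightarrow> u t"
        by (rule LIMSEQ_ignore_initial_segment[OF l])
      then have "(\<lambda>k. ennreal ((norm (rep_L2 (F (n + k) - F n) t))\<^sup>2))
          \<longlonglongrightarrow> ennreal ((norm (u t - rep_L2 (F n) t))\<^sup>2)"
        using eq by (intro tendsto_ennrealI tendsto_intros) (simp add: add.commute tendsto_diff)
      then show "ennreal ((norm (u t - rep_L2 (F n) t))\<^sup>2)
          = liminf (\<lambda>k. ennreal ((norm (rep_L2 (F (n + k) - F n) t))\<^sup>2))"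
        using lim_imp_Liminf[OF sequentially_bot] by metis
    qed
    then have "(\<integral>\<^sup>+t. ennreal ((norm (u t - rep_L2 (F n) t))\<^sup>2) \<partial>circ)
        = (\<integral>\<^sup>+t. liminf (\<lambda>k. ennreal ((norm (rep_L2 (F (n + k) - F n) t))\<^sup>2)) \<partial>circ)"
      by (rule nn_integral_cong_AE)
    also have "\<dots> \<le> liminf (\<lambda>k. \<integral>\<^sup>+t. ennreal ((norm (rep_L2 (F (n + k) - F n) t))\<^sup>2) \<partial>circ)"
      by (rule nn_integral_liminf) measurable
    also have "\<dots> \<le> ennreal ((2 * (1/2) ^ n)\<^sup>2)"
    proof (rule Liminf_le)
      show "\<forall>\<^sub>F k in sequentially. (\<integral>\<^sup>+t. ennreal ((norm (rep_L2 (F (n + k) - F n) t))\<^sup>2) \<partial>circ)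
          \<le> ennreal ((2 * (1/2) ^ n)\<^sup>2)"
        unfolding nn_integral_norm_rep_L2_sq
        by (intro always_eventually allI ennreal_leI power_mono F_dist norm_ge_zero)
    qed simp
    finally show ?thesis .
  qed
  have s: "sq_integrable (\<lambda>t. u t - rep_L2 (F n) t)" for n
    by (rule sq_integrable_abs_L2_norm(1)[OF _ diff]) auto
  have us: "sq_integrable u"
    using sq_integrable_add[OF s[of 0] rep_L2_sq_integrable[of "F 0"]] by simp
  have "norm (abs_L2 u - F n) \<le> 2 * (1/2) ^ n" for n
  proof -
    have "abs_L2 u - F n = abs_L2 (\<lambda>t. u t - rep_L2 (F n) t)"
      using minus_L2.abs_eq[of u "rep_L2 (F n)"] us rep_L2_sq_integrable[of "F n"]
      by (simp add: L2_eq_def)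
    then show ?thesis
      using sq_integrable_abs_L2_norm(2)[OF _ diff, of n] by simp
  qed
  then have le: "norm (F n - abs_L2 u) \<le> 2 * (1/2) ^ n" for n
    by (subst norm_minus_commute)
  have "(\<lambda>n. 2 * (1/2 :: real) ^ n) \<longlonglongrightarrow> 2 * 0"
    by (intro tendsto_mult tendsto_const LIMSEQ_realpow_zero) auto
  then have "(\<lambda>n. 2 * (1/2 :: real) ^ n) \<longlonglongrightarrow> 0"
    by (simp only: mult_zero_right)
  then have "(\<lambda>n. F n - abs_L2 u) \<longlonglongrightarrow> 0"
    by (rule Lim_null_comparison[OF always_eventually[OF allI[OF le]]])
  then have "F \<longlonglongrightarrow> abs_L2 u"
    by (rule LIM_zero_cancel)
  moreover have "AE t in circ. (\<lambda>n. rep_L2 (F n) t) \<longlonglongrightarrow> rep_L2 (abs_L2 u) t"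
    using lim rep_abs_L2[OF us] by eventually_elim simp
  ultimately show thesis
    by (rule that)
qed

lemma L2_tendsto_subseq_AE:
  fixes F :: "nat \<Rightarrow> 'a :: chilbert_space L2"
  assumes F: "Cauchy F"
  obtains r G where "strict_mono r" "(\<lambda>n. F (r n)) \<longlonglongrightarrow> G"
    "AE t in circ. (\<lambda>n. rep_L2 (F (r n)) t) \<longlonglongrightarrow> rep_L2 G t"
proof -
  have "\<exists>M. \<forall>i\<ge>M. \<forall>j\<ge>M. dist (F i) (F j) < (1/2) ^ n" for n
    using F by (simp add: Cauchy_def)
  then obtain M where M: "\<And>n i j. M n \<le> i \<Longrightarrow> M n \<le> j \<Longrightarrow> dist (F i) (F j) < (1/2) ^ n"
    by metis
  define r where "r = rec_nat (M 0) (\<lambda>n k. max (Suc k) (M (Suc n)))"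
  have r: "r n < r (Suc n)" "M n \<le> r n" for n
  proof -
    have Suc: "r (Suc n) = max (Suc (r n)) (M (Suc n))" for n
      by (simp add: r_def)
    then show "r n < r (Suc n)"
      by (simp add: less_max_iff_disj)
    show "M n \<le> r n"
      by (cases n) (simp add: r_def, simp add: Suc)
  qed
  have mono: "strict_mono r"
    using r(1) by (simp add: strict_mono_Suc_iff)
  have "norm (F (r (Suc n)) - F (r n)) \<le> (1/2) ^ n" for n
    using M[of n "r (Suc n)" "r n"] r[of n] by (simp add: dist_norm)
  then obtain G where "(\<lambda>n. F (r n)) \<longlonglongrightarrow> G" "AE t in circ. (\<lambda>n. rep_L2 (F (r n)) t) \<longlonglongrightarrow> rep_L2 G t"
    by (rule L2_fast_Cauchy)
  with mono that show thesis
    by blast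
qed

instance L2 :: (chilbert_space) complex_hilbert
proof
  fix F :: "nat \<Rightarrow> 'a L2"
  assume F: "Cauchy F"
  then obtain r G where "strict_mono r" "(\<lambda>n. F (r n)) \<longlonglongrightarrow> G"
    by (rule L2_tendsto_subseq_AE)
  then have "F \<longlonglongrightarrow> G"
    using F Cauchy_converges_subseq[OF F, of r G] by (simp add: o_def)
  then show "convergent F"
    by (auto simp: convergent_def)
qed

lemma closed_csubspace_L2_on:
  fixes E :: "'a :: chilbert_space set"
  assumes E: "closed_csubspace E"
  shows "closed_csubspace (L2_on E)"
  unfolding closed_csubspace_def
proof (intro conjI ballI allI)
  show "closed (L2_on E)"
    unfolding closed_sequential_limits
  proof (intro allI impI)
    fix F l
    assume F: "(\<forall>n. F n \<in> L2_on E) \<and> F \<longlonglongrightarrow> l"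
    then have "Cauchy F"
      using LIMSEQ_imp_Cauchy by blast
    then obtain r G where r: "strict_mono r" "(\<lambda>n. F (r n)) \<longlonglongrightarrow> G"
      "AE t in circ. (\<lambda>n. rep_L2 (F (r n)) t) \<longlonglongrightarrow> rep_L2 G t"
      by (rule L2_tendsto_subseq_AE)
    have "(\<lambda>n. F (r n)) \<longlonglongrightarrow> l"
      using F r(1) LIMSEQ_subseq_LIMSEQ[of F l r] by (simp add: o_def)
    then have "G = l"
      using r(2) LIMSEQ_unique by blast
    have "AE t in circ. \<forall>n. rep_L2 (F (r n)) t \<in> E"
      using F unfolding AE_all_countable L2_on_def by blast
    with r(3) have "AE t in circ. rep_L2 G t \<in> E"
      by eventually_elim (rule closed_sequentially[OF closed_csubspaceD(1)[OF E]], auto)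
    then show "l \<in> L2_on E"
      by (simp add: L2_on_def \<open>G = l\<close>)
  qed
  show "0 \<in> L2_on E"
    unfolding L2_on_def mem_Collect_eq using rep_L2_zero[where 'a = 'a]
    by eventually_elim (simp add: closed_csubspaceD(2)[OF E])
  show "f + g \<in> L2_on E" if "f \<in> L2_on E" "g \<in> L2_on E" for f g
    using that rep_L2_add[of f g] unfolding L2_on_def mem_Collect_eq
    by eventually_elim (simp add: closed_csubspaceD(3)[OF E])
  show "c *\<^sub>C f \<in> L2_on E" if "f \<in> L2_on E" for c f
    using that rep_L2_scaleC[of c f] unfolding L2_on_def mem_Collect_eq
    by eventually_elim (simp add: closed_csubspaceD(4)[OF E])
qed

section \<open>Multiplication by boundary values\<close>

text \<open>The operator families are only controlled on \<open>E\<close>; cut off to \<open>0\<close> outside \<open>E\<close> they give Borel functions, which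
  makes the compositions with \<open>f\<close> and their limit measurable.\<close>

lemma sq_integrable_pointwise_limit:
  fixes K :: "nat \<Rightarrow> real \<Rightarrow> 'a :: chilbert_space \<Rightarrow> 'b :: chilbert_space"
  assumes E: "closed_csubspace E"
    and K: "\<And>n. continuous_on ({0..2 * pi} \<times> E) (\<lambda>p. K n (fst p) (snd p))"
    and lim: "AE t in circ. \<forall>x\<in>E. (\<lambda>n. K n t x) \<longlonglongrightarrow> W t x"
    and W: "AE t in circ. \<forall>x\<in>E. norm (W t x) \<le> norm x" and f: "f \<in> L2_on E"
  shows "sq_integrable (\<lambda>t. W t (rep_L2 f t))" "norm (abs_L2 (\<lambda>t. W t (rep_L2 f t))) \<le> norm f"
proof -
  define k where "k n p = (if p \<in> {0..2 * pi} \<times> E then K n (fst p) (snd p) else 0)" for n p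
  have fE: "AE t in circ. rep_L2 f t \<in> E"
    using f by (simp add: L2_on_def)
  have "k n \<in> borel_measurable borel" for n
    unfolding k_def
    by (rule borel_measurable_continuous_on_if[OF borel_closed K continuous_on_const])
      (intro closed_Times closed_csubspaceD(1)[OF E] closed_atLeastAtMost)
  moreover have "(\<lambda>t. t) \<in> borel_measurable circ"
    by (intro measurable_restrict_space1 measurable_completion) simp
  then have "(\<lambda>t. (t, rep_L2 f t)) \<in> borel_measurable circ"
    by (intro borel_measurable_Pair rep_L2_measurable)
  ultimately have km: "(\<lambda>t. k n (t, rep_L2 f t)) \<in> borel_measurable circ" for n
    by (rule measurable_compose[rotated])
  define u where "u t = lim (\<lambda>n. k n (t, rep_L2 f t))" for t
  have u: "u \<in> borel_measurable circ"
    unfolding u_def by (rule borel_measurable_lim_metric[OF km])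
  have "AE t in circ. t \<in> {0..2 * pi}"
    using AE_space[of circ] by simp
  with fE lim have "AE t in circ. u t = W t (rep_L2 f t)"
    by eventually_elim (auto simp: u_def k_def intro!: limI)
  then have Wm: "(\<lambda>t. W t (rep_L2 f t)) \<in> borel_measurable circ"
    by (rule borel_measurable_circ_AE[OF u])
  have "(\<integral>\<^sup>+t. ennreal ((norm (W t (rep_L2 f t)))\<^sup>2) \<partial>circ) \<le> (\<integral>\<^sup>+t. ennreal ((norm (rep_L2 f t))\<^sup>2) \<partial>circ)"
    by (rule nn_integral_mono_AE) (use fE W in eventually_elim, auto intro!: ennreal_leI power_mono)
  then have le: "(\<integral>\<^sup>+t. ennreal ((norm (W t (rep_L2 f t)))\<^sup>2) \<partial>circ) \<le> ennreal ((norm f)\<^sup>2)"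
    by (simp add: nn_integral_norm_rep_L2_sq)
  show "sq_integrable (\<lambda>t. W t (rep_L2 f t))" "norm (abs_L2 (\<lambda>t. W t (rep_L2 f t))) \<le> norm f"
    by (rule sq_integrable_abs_L2_norm[OF Wm le norm_ge_zero])+
qed

text \<open>Measurability needs limits along a sequence; any sequence in \<open>[0, 1)\<close> that tends to \<open>1\<close> serves.\<close>

definition radii :: "nat \<Rightarrow> real" where
  "radii n = 1 - 1 / real (n + 2)"

lemma radii: "0 \<le> radii n" "radii n < 1"
  by (auto simp: radii_def)

lemma filterlim_radii: "filterlim radii (at_left 1) sequentially"
  unfolding filterlim_at
proof
  have "(\<lambda>n. 1 - 1 / real (n + 2)) \<longlonglongrightarrow> 1 - 0"
    using LIMSEQ_ignore_initial_segment[OF lim_1_over_n[where 'a = real], of 2]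
    by (intro tendsto_intros) (simp add: algebra_simps)
  then show "radii \<longlonglongrightarrow> 1"
    by (simp add: radii_def[abs_def])
qed (use radii in \<open>auto simp: less_imp_neq\<close>)

lemma contractive_analytic_contraction:
  assumes "contractive_analytic E F \<Theta>" "0 \<le> r" "r < 1"
  shows "contraction_on E F (\<Theta> (complex_of_real r * cis t))"
  using assms by (auto simp: contractive_analytic_def norm_mult)

lemma contractive_analytic_continuous:
  assumes \<Theta>: "contractive_analytic E F \<Theta>" and x: "x \<in> E"
  shows "continuous_on (ball 0 1) (\<lambda>z. \<Theta> z x)"
  unfolding continuous_on_eq_continuous_at[OF open_ball] isCont_def
proof
  fix z :: complex
  assume "z \<in> ball 0 1"
  then obtain G where "\<forall>\<epsilon>>0. \<forall>\<^sub>F w in at z. \<forall>x\<in>E.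
      norm (\<Theta> w x - \<Theta> z x - (w - z) *\<^sub>C G x) \<le> \<epsilon> * cmod (w - z) * norm x"
    using \<Theta> unfolding contractive_analytic_def analytic_op_fun_def by blast
  then have G: "\<forall>\<^sub>F w in at z. norm (\<Theta> w x - \<Theta> z x - (w - z) *\<^sub>C G x) \<le> cmod (w - z) * norm x"
    using x by (auto elim!: allE[of _ 1] eventually_mono)
  have "((\<lambda>w. cmod (w - z) * (norm x + norm (G x))) \<longlongrightarrow> cmod (z - z) * (norm x + norm (G x))) (at z)"
    by (intro tendsto_intros)
  then have lim0: "((\<lambda>w. cmod (w - z) * (norm x + norm (G x))) \<longlongrightarrow> 0) (at z)"
    by simp
  have "((\<lambda>w. \<Theta> w x - \<Theta> z x) \<longlongrightarrow> 0) (at z)"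
  proof (rule Lim_null_comparison[OF _ lim0])
    show "\<forall>\<^sub>F w in at z. norm (\<Theta> w x - \<Theta> z x) \<le> cmod (w - z) * (norm x + norm (G x))"
      using G
    proof eventually_elim
      case (elim w)
      then show ?case
        using norm_triangle_sub[of "\<Theta> w x - \<Theta> z x" "(w - z) *\<^sub>C G x"]
        by (simp add: norm_scaleC distrib_left)
    qed
  qed
  then show "((\<lambda>w. \<Theta> w x) \<longlongrightarrow> \<Theta> z x) (at z)"
    by (rule LIM_zero_cancel)
qed

lemma contractive_analytic_jointly_continuous:
  fixes g :: "real \<Rightarrow> real" and E :: "'a :: chilbert_space set"
  assumes \<Theta>: "contractive_analytic E F \<Theta>" and r: "0 \<le> r" "r < 1" and g: "continuous_on UNIV g"
  shows "continuous_on (S \<times> E) (\<lambda>p. \<Theta> (complex_of_real r * cis (g (fst p))) (snd p))"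
  unfolding continuous_on_def
proof
  fix p
  assume p: "p \<in> S \<times> E"
  let ?z = "\<lambda>p :: real \<times> 'a. complex_of_real r * cis (g (fst p))"
  have xE: "snd p \<in> E"
    using p by auto
  have E: "closed_csubspace E"
    using \<Theta> by (simp add: contractive_analytic_def)
  have "continuous_on UNIV ?z"
    by (intro continuous_intros continuous_on_compose2[OF g]) auto
  then have "continuous_on UNIV (\<lambda>q. \<Theta> (?z q) (snd p))"
    using r by (intro continuous_on_compose2[OF contractive_analytic_continuous[OF \<Theta> xE]])
      (auto simp: norm_mult)
  then have "((\<lambda>q. \<Theta> (?z q) (snd p)) \<longlongrightarrow> \<Theta> (?z p) (snd p)) (at p within S \<times> E)"
    by (meson UNIV_I continuous_on_def subset_UNIV tendsto_within_subset)
  then have 1: "((\<lambda>q. norm (\<Theta> (?z q) (snd p) - \<Theta> (?z p) (snd p))) \<longlongrightarrow> 0) (at p within S \<times> E)"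
    by (intro tendsto_norm_zero LIM_zero)
  have 2: "((\<lambda>q. norm (snd q - snd p)) \<longlongrightarrow> 0) (at p within S \<times> E)"
    by (intro tendsto_norm_zero LIM_zero tendsto_snd tendsto_ident_at)
  have "((\<lambda>q. \<Theta> (?z q) (snd q) - \<Theta> (?z p) (snd p)) \<longlongrightarrow> 0) (at p within S \<times> E)"
  proof (rule Lim_null_comparison)
    show "((\<lambda>q. norm (snd q - snd p) + norm (\<Theta> (?z q) (snd p) - \<Theta> (?z p) (snd p))) \<longlongrightarrow> 0)
        (at p within S \<times> E)"
      using tendsto_add[OF 2 1] by simp
    have "norm (\<Theta> (?z q) (snd q) - \<Theta> (?z p) (snd p))
        \<le> norm (snd q - snd p) + norm (\<Theta> (?z q) (snd p) - \<Theta> (?z p) (snd p))" if "q \<in> S \<times> E" for q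
    proof -
      have c: "contraction_on E F (\<Theta> (?z q))"
        by (rule contractive_analytic_contraction[OF \<Theta> r])
      have qE: "snd q \<in> E"
        using that by auto
      have "norm (\<Theta> (?z q) (snd q) - \<Theta> (?z q) (snd p)) \<le> norm (snd q - snd p)"
        using c closed_csubspace_more(2)[OF E qE xE] clinear_on_more(3)[OF E _ qE xE]
        unfolding contraction_on_def by metis
      then show ?thesis
        using norm_triangle_ineq[of "\<Theta> (?z q) (snd q) - \<Theta> (?z q) (snd p)" "\<Theta> (?z q) (snd p) - \<Theta> (?z p) (snd p)"]
        by simp
    qed
    then show "\<forall>\<^sub>F q in at p within S \<times> E. norm (\<Theta> (?z q) (snd q) - \<Theta> (?z p) (snd p))
        \<le> norm (snd q - snd p) + norm (\<Theta> (?z q) (snd p) - \<Theta> (?z p) (snd p))"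
      by (simp add: eventually_at_filter)
  qed
  then show "((\<lambda>q. \<Theta> (?z q) (snd q)) \<longlongrightarrow> \<Theta> (?z p) (snd p)) (at p within S \<times> E)"
    by (rule LIM_zero_cancel)
qed

lemma eventually_at_left_1: "\<forall>\<^sub>F r in at_left (1 :: real). 0 \<le> r \<and> r < 1"
  using eventually_at_left_real[of 0 1] by (auto elim: eventually_mono)

lemma contraction_on_limit:
  assumes Fl: "Fl \<noteq> bot" and F: "closed_csubspace F" and c: "\<forall>\<^sub>F r in Fl. contraction_on E F (f r)"
    and E: "closed_csubspace E" and lim: "\<And>x. x \<in> E \<Longrightarrow> ((\<lambda>r. f r x) \<longlongrightarrow> g x) Fl"
  shows "contraction_on E F g"
  unfolding contraction_on_def clinear_on_def
proof (intro conjI ballI allI image_subsetI)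
  show "g x \<in> F" if "x \<in> E" for x
    by (rule Lim_in_closed_set[OF closed_csubspaceD(1)[OF F] _ Fl lim[OF that]])
      (use c that in \<open>auto simp: contraction_on_def clinear_on_def elim!: eventually_mono\<close>)
  show "g (x + y) = g x + g y" if x: "x \<in> E" and y: "y \<in> E" for x y
  proof (rule tendsto_unique[OF Fl])
    show "((\<lambda>r. f r x + f r y) \<longlongrightarrow> g x + g y) Fl"
      by (intro tendsto_add lim x y)
    have "\<forall>\<^sub>F r in Fl. f r (x + y) = f r x + f r y"
      using c x y by (auto simp: contraction_on_def clinear_on_def elim!: eventually_mono)
    then show "((\<lambda>r. f r x + f r y) \<longlongrightarrow> g (x + y)) Fl"
      using lim[OF closed_csubspaceD(3)[OF E x y]] by (rule Lim_transform_eventually[rotated])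
  qed
  show "g (a *\<^sub>C x) = a *\<^sub>C g x" if x: "x \<in> E" for a x
  proof (rule tendsto_unique[OF Fl])
    show "((\<lambda>r. a *\<^sub>C f r x) \<longlongrightarrow> a *\<^sub>C g x) Fl"
      by (intro bounded_linear.tendsto[OF bounded_linear_scaleC] lim x)
    have "\<forall>\<^sub>F r in Fl. f r (a *\<^sub>C x) = a *\<^sub>C f r x"
      using c x by (auto simp: contraction_on_def clinear_on_def elim!: eventually_mono)
    then show "((\<lambda>r. a *\<^sub>C f r x) \<longlongrightarrow> g (a *\<^sub>C x)) Fl"
      using lim[OF closed_csubspaceD(4)[OF E x]] by (rule Lim_transform_eventually[rotated])
  qed
  show "norm (g x) \<le> norm x" if "x \<in> E" for x
    by (rule tendsto_upperbound[OF tendsto_norm[OF lim[OF that]] _ Fl])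
      (use c that in \<open>auto simp: contraction_on_def elim!: eventually_mono\<close>)
qed

text \<open>By Fatou's theorem radial limits exist for all contractive analytic functions. As an assumption they only
  have to be established for characteristic functions: constants have them, and products inherit them.\<close>

locale boundary_contraction =
  fixes E :: "'a :: chilbert_space set" and F :: "'b :: chilbert_space set" and \<Theta>
  assumes analytic: "contractive_analytic E F \<Theta>"
    and radial_limits: "AE t in circ. \<forall>x\<in>E. \<exists>l. ((\<lambda>r. \<Theta> (complex_of_real r * cis t) x) \<longlongrightarrow> l) (at_left 1)"
begin

lemma E: "closed_csubspace E" and F: "closed_csubspace F"
  using analytic by (auto simp: contractive_analytic_def)

lemma boundary_value_tendsto:
  "AE t in circ. \<forall>x\<in>E. ((\<lambda>r. \<Theta> (complex_of_real r * cis t) x) \<longlongrightarrow> boundary_value \<Theta> t x) (at_left 1)"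
  using radial_limits
proof eventually_elim
  case (elim t)
  then show ?case
    unfolding boundary_value_def using tendsto_Lim[OF trivial_limit_at_left_real] by metis
qed

lemma boundary_value_contraction: "AE t in circ. contraction_on E F (boundary_value \<Theta> t)"
  using boundary_value_tendsto
proof eventually_elim
  case (elim t)
  show ?case
  proof (rule contraction_on_limit[OF trivial_limit_at_left_real F _ E])
    show "\<forall>\<^sub>F r in at_left 1. contraction_on E F (\<Theta> (complex_of_real r * cis t))"
      using eventually_at_left_1 contractive_analytic_contraction[OF analytic]
      by (auto elim: eventually_mono)
  qed (use elim in blast)
qed

lemma mult_op:
  assumes f: "f \<in> L2_on E"
  shows rep_mult_op: "AE t in circ. rep_L2 (mult_op \<Theta> f) t = boundary_value \<Theta> t (rep_L2 f t)"
    and norm_mult_op_le: "norm (mult_op \<Theta> f) \<le> norm f"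
proof -
  have lim: "AE t in circ. \<forall>x\<in>E. (\<lambda>n. \<Theta> (complex_of_real (radii n) * cis t) x) \<longlonglongrightarrow> boundary_value \<Theta> t x"
    using boundary_value_tendsto by eventually_elim (use filterlim_compose filterlim_radii in blast)
  have le: "AE t in circ. \<forall>x\<in>E. norm (boundary_value \<Theta> t x) \<le> norm x"
    using boundary_value_contraction by eventually_elim (simp add: contraction_on_def)
  note * = sq_integrable_pointwise_limit[OF E
      contractive_analytic_jointly_continuous[OF analytic radii continuous_on_id] lim le f]
  show "AE t in circ. rep_L2 (mult_op \<Theta> f) t = boundary_value \<Theta> t (rep_L2 f t)"
    unfolding mult_op_def by (rule rep_abs_L2[OF *(1)])
  show "norm (mult_op \<Theta> f) \<le> norm f"
    unfolding mult_op_def by (rule *(2))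
qed

lemma mult_op_contraction: "contraction_on (L2_on E) (L2_on F) (mult_op \<Theta>)"
  unfolding contraction_on_def clinear_on_def
proof (intro conjI ballI allI image_subsetI)
  note L2E = closed_csubspace_L2_on[OF E]
  have inE: "AE t in circ. rep_L2 f t \<in> E" if "f \<in> L2_on E" for f
    using that by (simp add: L2_on_def)
  show "mult_op \<Theta> f \<in> L2_on F" if f: "f \<in> L2_on E" for f
    unfolding L2_on_def mem_Collect_eq using rep_mult_op[OF f] boundary_value_contraction inE[OF f]
    by eventually_elim (auto simp: contraction_on_def clinear_on_def)
  show "mult_op \<Theta> (f + g) = mult_op \<Theta> f + mult_op \<Theta> g" if f: "f \<in> L2_on E" and g: "g \<in> L2_on E" for f g
    by (rule L2_eqI)
      (use rep_mult_op[OF f] rep_mult_op[OF g] rep_mult_op[OF closed_csubspaceD(3)[OF L2E f g]]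
        rep_L2_add[of f g] rep_L2_add[of "mult_op \<Theta> f" "mult_op \<Theta> g"] boundary_value_contraction
        inE[OF f] inE[OF g] in eventually_elim, simp add: contraction_on_def clinear_on_def)
  show "mult_op \<Theta> (c *\<^sub>C f) = c *\<^sub>C mult_op \<Theta> f" if f: "f \<in> L2_on E" for c f
    by (rule L2_eqI)
      (use rep_mult_op[OF f] rep_mult_op[OF closed_csubspaceD(4)[OF L2E f, of c]]
        rep_L2_scaleC[of c f] rep_L2_scaleC[of c "mult_op \<Theta> f"] boundary_value_contraction
        inE[OF f] in eventually_elim, simp add: contraction_on_def clinear_on_def)
  show "norm (mult_op \<Theta> f) \<le> norm f" if "f \<in> L2_on E" for f
    by (rule norm_mult_op_le[OF that])
qed

lemma mult_op_subspace_contraction: "subspace_contraction (L2_on E) (L2_on F) (mult_op \<Theta>)"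
  by (intro subspace_contraction.intro closed_csubspace_L2_on E F mult_op_contraction)

end

lemma norm_L2_eqI:
  assumes "AE t in circ. norm (rep_L2 f t) = norm (rep_L2 g t)"
  shows "norm f = norm g"
proof -
  have "(norm f)\<^sup>2 = (norm g)\<^sup>2"
    unfolding norm_L2_sq
    by (rule integral_cong_AE) (use assms in \<open>auto elim: eventually_mono\<close>)
  then show ?thesis
    by simp
qed

lemma cinner_L2_eqI:
  assumes "AE t in circ. cinner (rep_L2 f t) (rep_L2 g t) = cinner (rep_L2 f' t) (rep_L2 g' t)"
  shows "cinner f g = cinner f' g'"
  unfolding cinner_L2_eq
  by (rule integral_cong_AE)
    (use assms in \<open>auto intro: borel_measurable_integrable integrable_cinner rep_L2_sq_integrable\<close>)

lemma boundary_value_const [simp]: "boundary_value (\<lambda>_. R) t x = R x"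
  unfolding boundary_value_def by (rule tendsto_Lim[OF trivial_limit_at_left_real tendsto_const])

lemma contractive_analytic_const:
  assumes "closed_csubspace E" "closed_csubspace F" "contraction_on E F R"
  shows "contractive_analytic E F (\<lambda>_. R)"
  unfolding contractive_analytic_def analytic_op_fun_def
proof (intro conjI ballI assms contraction_on_bounded[OF assms(3)])
  show "\<exists>G. bounded_clinear_on E F G \<and> (\<forall>\<epsilon>>0. \<forall>\<^sub>F w in at z. \<forall>x\<in>E.
      norm (R x - R x - (w - z) *\<^sub>C G x) \<le> \<epsilon> * cmod (w - z) * norm x)" for z
    by (rule exI[of _ "\<lambda>_. 0"])
      (auto simp: bounded_clinear_on_def clinear_on_def closed_csubspaceD(2)[OF assms(2)]
        intro!: exI[of _ "1 :: real"])
qed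

lemma boundary_contraction_const:
  assumes "closed_csubspace E" "closed_csubspace F" "contraction_on E F R"
  shows "boundary_contraction E F (\<lambda>_. R)"
  by (intro boundary_contraction.intro contractive_analytic_const assms) (auto intro: exI[of _ "R _"])

lemma contraction_tendsto_comp:
  assumes c: "\<forall>\<^sub>F r in Fl. contraction_on F G (g r)" and F: "closed_csubspace F"
    and f: "\<forall>\<^sub>F r in Fl. f r \<in> F" "(f \<longlongrightarrow> l) Fl" and l: "l \<in> F" "((\<lambda>r. g r l) \<longlongrightarrow> m) Fl"
  shows "((\<lambda>r. g r (f r)) \<longlongrightarrow> m) Fl"
proof -
  have "((\<lambda>r. g r (f r) - g r l) \<longlongrightarrow> 0) Fl"
  proof (rule Lim_null_comparison)
    show "\<forall>\<^sub>F r in Fl. norm (g r (f r) - g r l) \<le> norm (f r - l)"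
      using c f(1)
    proof eventually_elim
      case (elim r)
      then show ?case
        using closed_csubspace_more(2)[OF F elim(2) l(1)] clinear_on_more(3)[OF F _ elim(2) l(1)]
        unfolding contraction_on_def by metis
    qed
    show "((\<lambda>r. norm (f r - l)) \<longlongrightarrow> 0) Fl"
      by (intro tendsto_norm_zero LIM_zero f)
  qed
  from tendsto_add[OF this l(2)] show ?thesis
    by simp
qed

text \<open>Contractivity allows strong limits to be composed. So radial limits of the factors give those of the product,
  and multiplication operators multiply.\<close>

lemma boundary_contraction_comp3:
  assumes \<Theta>1: "boundary_contraction E1 E2 \<Theta>1" and \<Theta>2: "boundary_contraction E2 E3 \<Theta>2"
    and \<Theta>3: "boundary_contraction E3 E4 \<Theta>3" and \<Theta>: "contractive_analytic E1 E4 \<Theta>"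
    and fact: "\<And>z x. z \<in> ball 0 1 \<Longrightarrow> x \<in> E1 \<Longrightarrow> \<Theta> z x = \<Theta>3 z (\<Theta>2 z (\<Theta>1 z x))"
  shows "boundary_contraction E1 E4 \<Theta>"
    and "\<And>f. f \<in> L2_on E1 \<Longrightarrow> mult_op \<Theta> f = mult_op \<Theta>3 (mult_op \<Theta>2 (mult_op \<Theta>1 f))"
proof -
  interpret \<Theta>1: boundary_contraction E1 E2 \<Theta>1 by (rule \<Theta>1)
  interpret \<Theta>2: boundary_contraction E2 E3 \<Theta>2 by (rule \<Theta>2)
  interpret \<Theta>3: boundary_contraction E3 E4 \<Theta>3 by (rule \<Theta>3)
  have lim: "AE t in circ. \<forall>x\<in>E1. ((\<lambda>r. \<Theta> (complex_of_real r * cis t) x)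
      \<longlongrightarrow> boundary_value \<Theta>3 t (boundary_value \<Theta>2 t (boundary_value \<Theta>1 t x))) (at_left 1)"
    using \<Theta>1.boundary_value_tendsto \<Theta>1.boundary_value_contraction
      \<Theta>2.boundary_value_tendsto \<Theta>2.boundary_value_contraction \<Theta>3.boundary_value_tendsto
  proof eventually_elim
    case (elim t)
    show ?case
    proof
      fix x
      assume x: "x \<in> E1"
      let ?z = "\<lambda>r. complex_of_real r * cis t"
      have c1: "\<forall>\<^sub>F r in at_left 1. contraction_on E1 E2 (\<Theta>1 (?z r))"
        and c2: "\<forall>\<^sub>F r in at_left 1. contraction_on E2 E3 (\<Theta>2 (?z r))"
        and c3: "\<forall>\<^sub>F r in at_left 1. contraction_on E3 E4 (\<Theta>3 (?z r))"
        using eventually_at_left_1 contractive_analytic_contraction[OF \<Theta>1.analytic]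
          contractive_analytic_contraction[OF \<Theta>2.analytic]
          contractive_analytic_contraction[OF \<Theta>3.analytic]
        by (auto elim!: eventually_mono)
      have x1: "boundary_value \<Theta>1 t x \<in> E2"
        using elim x by (auto simp: contraction_on_def clinear_on_def)
      then have x2: "boundary_value \<Theta>2 t (boundary_value \<Theta>1 t x) \<in> E3"
        using elim by (auto simp: contraction_on_def clinear_on_def)
      have e1: "\<forall>\<^sub>F r in at_left 1. \<Theta>1 (?z r) x \<in> E2"
        using c1 x by (auto simp: contraction_on_def clinear_on_def elim!: eventually_mono)
      have e2: "\<forall>\<^sub>F r in at_left 1. \<Theta>2 (?z r) (\<Theta>1 (?z r) x) \<in> E3"
        using c2 e1 by eventually_elim (auto simp: contraction_on_def clinear_on_def)
      have "((\<lambda>r. \<Theta>2 (?z r) (\<Theta>1 (?z r) x)) \<longlongrightarrow> boundary_value \<Theta>2 t (boundary_value \<Theta>1 t x)) (at_left 1)"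
        using elim x x1 by (intro contraction_tendsto_comp[OF c2 \<Theta>2.E e1]) auto
      then have "((\<lambda>r. \<Theta>3 (?z r) (\<Theta>2 (?z r) (\<Theta>1 (?z r) x)))
          \<longlongrightarrow> boundary_value \<Theta>3 t (boundary_value \<Theta>2 t (boundary_value \<Theta>1 t x))) (at_left 1)"
        using elim x2 by (intro contraction_tendsto_comp[OF c3 \<Theta>3.E e2]) auto
      moreover have "\<forall>\<^sub>F r in at_left 1. \<Theta>3 (?z r) (\<Theta>2 (?z r) (\<Theta>1 (?z r) x)) = \<Theta> (?z r) x"
        using eventually_at_left_1 by eventually_elim (use x in \<open>auto simp: fact norm_mult\<close>)
      ultimately show "((\<lambda>r. \<Theta> (?z r) x)
          \<longlongrightarrow> boundary_value \<Theta>3 t (boundary_value \<Theta>2 t (boundary_value \<Theta>1 t x))) (at_left 1)"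
        by (rule Lim_transform_eventually)
    qed
  qed
  show bc: "boundary_contraction E1 E4 \<Theta>"
    by (intro boundary_contraction.intro \<Theta>) (use lim in eventually_elim, blast)
  interpret \<Theta>: boundary_contraction E1 E4 \<Theta> by (rule bc)
  show "mult_op \<Theta> f = mult_op \<Theta>3 (mult_op \<Theta>2 (mult_op \<Theta>1 f))" if f: "f \<in> L2_on E1" for f
  proof (rule L2_eqI)
    have f1: "mult_op \<Theta>1 f \<in> L2_on E2"
      using \<Theta>1.mult_op_contraction f by (auto simp: contraction_on_def clinear_on_def)
    then have f2: "mult_op \<Theta>2 (mult_op \<Theta>1 f) \<in> L2_on E3"
      using \<Theta>2.mult_op_contraction by (auto simp: contraction_on_def clinear_on_def)
    have "AE t in circ. rep_L2 f t \<in> E1"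
      using f by (simp add: L2_on_def)
    with lim \<Theta>.boundary_value_tendsto \<Theta>.rep_mult_op[OF f] \<Theta>1.rep_mult_op[OF f]
      \<Theta>2.rep_mult_op[OF f1] \<Theta>3.rep_mult_op[OF f2]
    show "AE t in circ. rep_L2 (mult_op \<Theta> f) t = rep_L2 (mult_op \<Theta>3 (mult_op \<Theta>2 (mult_op \<Theta>1 f))) t"
    proof eventually_elim
      case (elim t)
      then show ?case
        using tendsto_unique[OF trivial_limit_at_left_real] by metis
    qed
  qed
qed

section \<open>A criterion for regularity\<close>

text \<open>Suppose that the middle factor is isometric. Then \<open>\<Delta>\<^sub>2 = 0\<close>, and the range of \<open>Z\<^sub>3\<close> is dense as
  soon as orthogonality of \<open>(\<Delta>\<^sub>3 \<Theta>\<^sub>2 \<Theta>\<^sub>1 f, \<Delta>\<^sub>1 f)\<close> to \<open>(g, h)\<close> for all \<open>f\<close> forces \<open>\<Delta>\<^sub>3 g = 0\<close>: the defect operators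
  are injective on their defect spaces, so \<open>g = 0\<close>, then \<open>\<Delta>\<^sub>1 h = 0\<close> and \<open>h = 0\<close>.\<close>

lemma regular_factorization3I:
  assumes \<Theta>1: "boundary_contraction E1 E2 \<Theta>1" and \<Theta>2: "boundary_contraction E2 E3 \<Theta>2"
    and \<Theta>3: "boundary_contraction E3 E4 \<Theta>3" and \<Theta>: "contractive_analytic E1 E4 \<Theta>"
    and fact: "\<And>z x. z \<in> ball 0 1 \<Longrightarrow> x \<in> E1 \<Longrightarrow> \<Theta> z x = \<Theta>3 z (\<Theta>2 z (\<Theta>1 z x))"
    and iso2: "\<And>f. f \<in> L2_on E2 \<Longrightarrow> norm (mult_op \<Theta>2 f) = norm f"
    and crit: "\<And>g h. g \<in> L2_on E3 \<Longrightarrow> h \<in> L2_on E1 \<Longrightarrow>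
      (\<And>f. f \<in> L2_on E1 \<Longrightarrow>
        cinner (mult_op \<Theta>2 (mult_op \<Theta>1 f)) (Delta E3 E4 \<Theta>3 g) + cinner (Delta E1 E2 \<Theta>1 f) h = 0) \<Longrightarrow>
      Delta E3 E4 \<Theta>3 g = 0"
  shows "regular_factorization3 E1 E2 E3 E4 \<Theta> \<Theta>3 \<Theta>2 \<Theta>1"
proof -
  interpret \<Theta>1: boundary_contraction E1 E2 \<Theta>1 by (rule \<Theta>1)
  interpret \<Theta>2: boundary_contraction E2 E3 \<Theta>2 by (rule \<Theta>2)
  interpret \<Theta>3: boundary_contraction E3 E4 \<Theta>3 by (rule \<Theta>3)
  have \<Theta>_bc: "boundary_contraction E1 E4 \<Theta>"
    by (rule boundary_contraction_comp3(1)[OF \<Theta>1 \<Theta>2 \<Theta>3 \<Theta>]) (rule fact)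
  have comp: "mult_op \<Theta> f = mult_op \<Theta>3 (mult_op \<Theta>2 (mult_op \<Theta>1 f))" if "f \<in> L2_on E1" for f
    by (rule boundary_contraction_comp3(2)[OF \<Theta>1 \<Theta>2 \<Theta>3 \<Theta> _ that]) (rule fact)
  interpret M: subspace_contraction "L2_on E1" "L2_on E4" "mult_op \<Theta>"
    by (rule boundary_contraction.mult_op_subspace_contraction[OF \<Theta>_bc])
  interpret M1: subspace_contraction "L2_on E1" "L2_on E2" "mult_op \<Theta>1"
    by (rule \<Theta>1.mult_op_subspace_contraction)
  interpret M2: subspace_contraction "L2_on E2" "L2_on E3" "mult_op \<Theta>2"
    by (rule \<Theta>2.mult_op_subspace_contraction)
  interpret M3: subspace_contraction "L2_on E3" "L2_on E4" "mult_op \<Theta>3"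
    by (rule \<Theta>3.mult_op_subspace_contraction)
  have Delta: "Delta E1 E4 \<Theta> = M.D" "Delta E1 E2 \<Theta>1 = M1.D" "Delta E2 E3 \<Theta>2 = M2.D" "Delta E3 E4 \<Theta>3 = M3.D"
    by (simp_all add: Delta_def)
  have Delta_space: "Delta_space E1 E4 \<Theta> = closure (M.D ` L2_on E1)"
    "Delta_space E1 E2 \<Theta>1 = defect_space_on (L2_on E1) (L2_on E2) (mult_op \<Theta>1)"
    "Delta_space E2 E3 \<Theta>2 = defect_space_on (L2_on E2) (L2_on E3) (mult_op \<Theta>2)"
    "Delta_space E3 E4 \<Theta>3 = defect_space_on (L2_on E3) (L2_on E4) (mult_op \<Theta>3)"
    by (simp_all add: Delta_space_def Delta_def defect_space_on_def)
  define V where "V = Delta_space E3 E4 \<Theta>3 \<times> Delta_space E2 E3 \<Theta>2 \<times> Delta_space E1 E2 \<Theta>1"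
  define G where "G f = (M3.D (mult_op \<Theta>2 (mult_op \<Theta>1 f)), M2.D (mult_op \<Theta>1 f), M1.D f)" for f
  have V: "closed_csubspace V"
    unfolding V_def Delta_space
    by (intro closed_csubspace_Times M1.defect_space M2.defect_space M3.defect_space)
  note lin = clinear_onD[OF M1.T_clinear] clinear_onD[OF M2.T_clinear]
    clinear_onD[OF M1.D_clinear] clinear_onD[OF M2.D_clinear] clinear_onD[OF M3.D_clinear]
  have GV: "clinear_on (L2_on E1) V G"
    unfolding clinear_on_def G_def V_def Delta_space
    by (auto simp: lin scaleC_prod_def
        intro!: M1.D_in_defect_space M2.D_in_defect_space M3.D_in_defect_space M1.T_in M2.T_in)
  have iso: "norm (M.D f) = norm (G f)" if f: "f \<in> L2_on E1" for f
  proof -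
    have "(norm (M.D f))\<^sup>2 = (norm (G f))\<^sup>2"
      using f by (simp add: G_def norm_prod_sq M.D_norm_sq comp M1.D_norm_sq M2.D_norm_sq
          M3.D_norm_sq M1.T_in M2.T_in)
    then show ?thesis
      by simp
  qed
  have dense: "closure (G ` L2_on E1) = V"
  proof (rule dense_range_if_orthogonal_trivial[OF M.E V GV])
    fix w
    assume w: "w \<in> V" and orth: "\<And>f. f \<in> L2_on E1 \<Longrightarrow> cinner (G f) w = 0"
    obtain g e h where ghe: "w = (g, e, h)"
      by (cases w) auto
    have g: "g \<in> defect_space_on (L2_on E3) (L2_on E4) (mult_op \<Theta>3)"
      and e: "e \<in> defect_space_on (L2_on E2) (L2_on E3) (mult_op \<Theta>2)"
      and h: "h \<in> defect_space_on (L2_on E1) (L2_on E2) (mult_op \<Theta>1)"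
      using w by (auto simp: V_def ghe Delta_space)
    have g': "g \<in> L2_on E3" and e': "e \<in> L2_on E2" and h': "h \<in> L2_on E1"
      using g e h M1.defect_space(2) M2.defect_space(2) M3.defect_space(2) by auto
    have D2: "M2.D f = 0" if "f \<in> L2_on E2" for f
      using M2.D_norm_sq[OF that] iso2[OF that] by simp
    have e0: "e = 0"
      by (rule M2.D_injective_on_defect_space[OF e D2[OF e']])
    have sum0: "cinner (mult_op \<Theta>2 (mult_op \<Theta>1 f)) (M3.D g) + cinner (M1.D f) h = 0" if f: "f \<in> L2_on E1" for f
      using orth[OF f] M3.D_selfadj[OF M2.T_in[OF M1.T_in[OF f]] g']
      by (simp add: G_def ghe cinner_prod_def e0)
    have D3g: "M3.D g = 0"
      using crit[OF g' h'] sum0 unfolding Delta by blast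
    then have g0: "g = 0"
      by (rule M3.D_injective_on_defect_space[OF g])
    have "cinner (M1.D h) (M1.D h) = 0"
      using sum0[OF M1.D_in[OF h']] D3g M1.D_selfadj[OF M1.D_in[OF h'] h'] by simp
    then have "M1.D h = 0"
      by (simp add: cinner_self)
    then have "h = 0"
      by (rule M1.D_injective_on_defect_space[OF h])
    with g0 e0 show "w = 0"
      by (simp add: ghe zero_prod_def)
  qed
  have "unitary_on (Delta_space E1 E4 \<Theta>) V (Z3 E1 E2 E3 E4 \<Theta> \<Theta>3 \<Theta>2 \<Theta>1)"
    using unitary_on_isometric_extension[OF M.E M.E V M.D_clinear GV iso dense]
    unfolding Z3_def Delta_space(1) Delta G_def .
  then show ?thesis
    unfolding regular_factorization3_def V_def
    using \<Theta> \<Theta>1.analytic \<Theta>2.analytic \<Theta>3.analytic fact by blast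
qed

section \<open>Characteristic functions\<close>

lemma bounded_clinear_on_imp_bounded_linear:
  assumes "bounded_clinear_on UNIV F f"
  shows "bounded_linear f"
proof -
  obtain K where "\<And>x. norm (f x) \<le> K * norm x" and lin: "clinear_on UNIV F f"
    using assms by (auto simp: bounded_clinear_on_def)
  then show ?thesis
    by (intro bounded_linear_intro[where K = K])
      (auto simp: clinear_onD[OF lin] scaleR_scaleC mult.commute)
qed

lemma (in subspace_contraction) codefect_adjoint: "codefect_on F E Ts = D"
  unfolding codefect_on_def defect_on_def by (rule psqrt_on_cong) (simp add: adj_adj)

locale contraction_operator =
  fixes T :: "'a :: chilbert_space \<Rightarrow> 'a"
  assumes contraction: "contraction_on UNIV UNIV T"
begin

sublocale subspace_contraction UNIV UNIV T
  by unfold_locales (simp_all add: contraction)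

lemma adj_contraction_operator: "contraction_operator Ts"
  by (rule contraction_operator.intro) (rule subspace_contraction.T[OF adjoint_contraction])

lemma adj_adj_eq: "adj Ts = T"
  by (rule ext) (simp add: adj_adj)

lemmas lin = clinear_onD(2,3)[OF Ts_clinear UNIV_I] clinear_onD(2,3)[OF T_clinear UNIV_I]
  clinear_onD(2,3)[OF D_clinear UNIV_I] clinear_onD(2,3)[OF Ds_clinear UNIV_I]

lemma Ts_iterate_norm: "norm ((Ts ^^ n) x) \<le> norm x"
  by (induction n) (auto intro: order_trans[OF Ts_norm])

text \<open>The resolvent \<open>(I - z T*)\<^sup>-\<^sup>1\<close> as a Neumann series.\<close>

definition res :: "complex \<Rightarrow> 'a \<Rightarrow> 'a" where
  "res z x = pseries (\<lambda>n. (Ts ^^ n) x) z"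

lemma res_summable:
  assumes z: "cmod z < 1"
  shows "summable (\<lambda>n. z ^ n *\<^sub>C (Ts ^^ n) x)"
proof (rule summable_norm_cancel, rule summable_comparison_test')
  show "summable (\<lambda>n. cmod z ^ n * norm x)"
    using z by (intro summable_mult2 summable_geometric) simp
  show "norm (norm (z ^ n *\<^sub>C (Ts ^^ n) x)) \<le> cmod z ^ n * norm x" for n
    using Ts_iterate_norm[of n x] by (simp add: norm_scaleC norm_power mult_left_mono)
qed

lemma bounded_linear_Ts: "bounded_linear Ts" and bounded_linear_Ds: "bounded_linear Ds"
proof -
  show "bounded_linear Ts"
    using contraction_on_bounded[OF subspace_contraction.T[OF adjoint_contraction]]
    by (rule bounded_clinear_on_imp_bounded_linear)
  have "contraction_on UNIV UNIV Ds"
    using Ds_clinear Ds_norm by (simp add: contraction_on_def)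
  then show "bounded_linear Ds"
    by (rule bounded_clinear_on_imp_bounded_linear[OF contraction_on_bounded])
qed

lemma res_eq:
  assumes z: "cmod z < 1"
  shows "res z x - z *\<^sub>C Ts (res z x) = x"
proof -
  have "z *\<^sub>C Ts (res z x) = (\<Sum>n. z *\<^sub>C Ts (z ^ n *\<^sub>C (Ts ^^ n) x))"
    unfolding res_def pseries_def
    using bounded_linear.suminf[OF bounded_linear_compose[OF bounded_linear_scaleC bounded_linear_Ts]
        res_summable[OF z]] by simp
  also have "\<dots> = (\<Sum>n. z ^ Suc n *\<^sub>C (Ts ^^ Suc n) x)"
    by (simp add: lin scaleC_scaleC)
  also have "\<dots> = res z x - x"
    using suminf_split_head[OF res_summable[OF z, of x]] by (simp add: res_def pseries_def)
  finally show ?thesis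
    by simp
qed

lemma norm_le_resolvent: "(1 - cmod z) * norm u \<le> norm (u - z *\<^sub>C Ts u)"
proof -
  have "norm u \<le> norm (u - z *\<^sub>C Ts u) + norm (z *\<^sub>C Ts u)"
    using norm_triangle_ineq[of "u - z *\<^sub>C Ts u" "z *\<^sub>C Ts u"] by simp
  moreover have "norm (z *\<^sub>C Ts u) \<le> cmod z * norm u"
    by (simp add: norm_scaleC mult_left_mono Ts_norm)
  ultimately show ?thesis
    by (simp add: left_diff_distrib)
qed

lemma res_unique:
  assumes z: "cmod z < 1" and u: "u - z *\<^sub>C Ts u = x"
  shows "res z x = u"
proof -
  let ?d = "res z x - u"
  have "?d - z *\<^sub>C Ts ?d = (res z x - z *\<^sub>C Ts (res z x)) - (u - z *\<^sub>C Ts u)"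
    by (simp add: clinear_on_more(3)[OF closed_csubspace_UNIV Ts_clinear] scaleC_diff_right)
  then have "?d - z *\<^sub>C Ts ?d = 0"
    by (simp add: res_eq[OF z] u)
  then have "(1 - cmod z) * norm ?d \<le> 0"
    using norm_le_resolvent[of z ?d] by simp
  then have "norm ?d \<le> 0"
    using z by (simp add: mult_le_0_iff)
  then show ?thesis
    by simp
qed

lemma res_add: "cmod z < 1 \<Longrightarrow> res z (x + y) = res z x + res z y"
proof (rule res_unique)
  assume z: "cmod z < 1"
  have "res z x + res z y - z *\<^sub>C Ts (res z x + res z y)
      = (res z x - z *\<^sub>C Ts (res z x)) + (res z y - z *\<^sub>C Ts (res z y))"
    by (simp add: lin scaleC_add_right)
  then show "res z x + res z y - z *\<^sub>C Ts (res z x + res z y) = x + y"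
    by (simp add: res_eq[OF z])
qed

lemma res_scaleC: "cmod z < 1 \<Longrightarrow> res z (c *\<^sub>C x) = c *\<^sub>C res z x"
proof (rule res_unique)
  assume z: "cmod z < 1"
  have "c *\<^sub>C res z x - z *\<^sub>C Ts (c *\<^sub>C res z x) = c *\<^sub>C (res z x - z *\<^sub>C Ts (res z x))"
    by (simp add: lin scaleC_scaleC scaleC_diff_right mult.commute)
  then show "c *\<^sub>C res z x - z *\<^sub>C Ts (c *\<^sub>C res z x) = c *\<^sub>C x"
    by (simp add: res_eq[OF z])
qed

lemma norm_res_le: "cmod z < 1 \<Longrightarrow> norm (res z x) \<le> norm x / (1 - cmod z)"
  using norm_le_resolvent[of z "res z x"] by (simp add: res_eq pos_le_divide_eq mult.commute)

lemma char_fun_eq: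
  assumes z: "cmod z < 1"
  shows "char_fun T z x = - T x + z *\<^sub>C Ds (res z (D x))"
proof -
  have "inj (\<lambda>u. u - z *\<^sub>C Ts u)"
    by (rule injI) (metis res_unique[OF z])
  then have "inv (\<lambda>u. u - z *\<^sub>C Ts u) (D x) = res z (D x)"
    by (rule inv_f_eq) (rule res_eq[OF z])
  then show ?thesis
    by (simp add: char_fun_def)
qed

text \<open>With \<open>u = (I - z T*)\<^sup>-\<^sup>1 D\<^sub>T x\<close> the Julia operator maps \<open>(z u, x)\<close> to \<open>(u, \<Theta>\<^sub>T(z) x)\<close>, and it is isometric.\<close>

lemma norm_char_fun_sq:
  assumes z: "cmod z < 1"
  shows "(norm (char_fun T z x))\<^sup>2 = (norm x)\<^sup>2 - (1 - (cmod z)\<^sup>2) * (norm (res z (D x)))\<^sup>2"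
proof -
  let ?u = "res z (D x)"
  have "Ts (z *\<^sub>C ?u) + D x = ?u"
    using res_eq[OF z, of "D x"] by (simp add: lin algebra_simps)
  moreover have "Ds (z *\<^sub>C ?u) - T x = char_fun T z x"
    by (simp add: char_fun_eq[OF z] lin)
  ultimately have "(norm ?u)\<^sup>2 + (norm (char_fun T z x))\<^sup>2 = (norm (z *\<^sub>C ?u))\<^sup>2 + (norm x)\<^sup>2"
    using julia_norm[of "z *\<^sub>C ?u" x] by simp
  then show ?thesis
    by (simp add: norm_scaleC power_mult_distrib algebra_simps)
qed

lemma char_fun_norm_le:
  assumes z: "cmod z < 1"
  shows "norm (char_fun T z x) \<le> norm x"
proof (rule power2_le_imp_le)
  have "0 \<le> (1 - (cmod z)\<^sup>2) * (norm (res z (D x)))\<^sup>2"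
    using z by (intro mult_nonneg_nonneg) (auto simp: power_le_one)
  then show "(norm (char_fun T z x))\<^sup>2 \<le> (norm x)\<^sup>2"
    by (simp add: norm_char_fun_sq[OF z])
qed simp

lemma char_fun_contraction:
  assumes z: "cmod z < 1"
  shows "contraction_on UNIV UNIV (char_fun T z)"
  unfolding contraction_on_def
proof
  show "clinear_on UNIV UNIV (char_fun T z)"
    by (auto simp: clinear_on_def char_fun_eq[OF z] lin res_add[OF z] res_scaleC[OF z]
        scaleC_add_right scaleC_diff_right scaleC_scaleC mult.commute)
qed (simp add: char_fun_norm_le[OF z])

lemma char_fun_in:
  assumes z: "cmod z < 1" and x: "x \<in> defect_space T"
  shows "char_fun T z x \<in> codefect_space T"
  unfolding char_fun_eq[OF z]
  by (intro closed_csubspaceD[OF codefect_space(1)] closed_csubspace_more[OF codefect_space(1)]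
      T_defect_space x Ds_in_codefect_space UNIV_I)

lemma char_fun_contraction_on:
  assumes z: "cmod z < 1"
  shows "contraction_on (defect_space T) (codefect_space T) (char_fun T z)"
  using char_fun_contraction[OF z] char_fun_in[OF z] by (auto simp: contraction_on_def clinear_on_def)

text \<open>For \<open>R(z) = (I - z T*)\<^sup>-\<^sup>1\<close> this combines \<open>w R(w) - z R(z) = (w - z) R(w) R(z)\<close> with
  \<open>R(w) - R(z) = (w - z) R(w) T* R(z)\<close>. The derivative at \<open>z\<close> is therefore \<open>D\<^bsub>T*\<^esub> R(z)\<^sup>2 D\<^sub>T\<close>.\<close>

lemma char_fun_difference:
  assumes z: "cmod z < 1" and w: "cmod w < 1"
  shows "char_fun T w x - char_fun T z x - (w - z) *\<^sub>C Ds (res z (res z (D x)))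
    = (w - z)\<^sup>2 *\<^sub>C Ds (res w (Ts (res z (res z (D x)))))"
proof -
  note sub = clinear_on_more(3)[OF closed_csubspace_UNIV Ts_clinear UNIV_I UNIV_I]
  have "res w y = y + w *\<^sub>C Ts (res w y)" "res z y = y + z *\<^sub>C Ts (res z y)" for y
    using res_eq[OF w, of y] res_eq[OF z, of y] by (simp_all add: algebra_simps)
  have first: "w *\<^sub>C res w y = z *\<^sub>C res z y + (w - z) *\<^sub>C res w (res z y)" for y
  proof -
    have *: "Ts (res z y) = Ts y + z *\<^sub>C Ts (Ts (res z y))"
      using arg_cong[OF res_eq[OF z, of y], of Ts] by (simp add: sub lin algebra_simps)
    have "res w (w *\<^sub>C y - (w - z) *\<^sub>C res z y) = z *\<^sub>C res z y"
    proof (rule res_unique[OF w])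
      have "w *\<^sub>C y = w *\<^sub>C res z y - (w * z) *\<^sub>C Ts (res z y)"
        using arg_cong[OF res_eq[OF z, of y], of "\<lambda>v. w *\<^sub>C v"]
        by (simp add: scaleC_diff_right scaleC_scaleC)
      then show "z *\<^sub>C res z y - w *\<^sub>C Ts (z *\<^sub>C res z y) = w *\<^sub>C y - (w - z) *\<^sub>C res z y"
        by (simp add: lin scaleC_scaleC scaleC_diff_left)
    qed
    moreover have "res w (w *\<^sub>C y) = res w (w *\<^sub>C y - (w - z) *\<^sub>C res z y) + res w ((w - z) *\<^sub>C res z y)"
      by (simp flip: res_add[OF w])
    ultimately show ?thesis
      by (simp add: res_scaleC[OF w])
  qed
  have second: "res w v = res z v + (w - z) *\<^sub>C res w (Ts (res z v))" for v
  proof -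
    have "res w (v - (w - z) *\<^sub>C Ts (res z v)) = res z v"
      by (rule res_unique[OF w]) (use res_eq[OF z, of v] in \<open>simp add: scaleC_diff_left algebra_simps\<close>)
    moreover have "res w v = res w (v - (w - z) *\<^sub>C Ts (res z v)) + res w ((w - z) *\<^sub>C Ts (res z v))"
      by (simp flip: res_add[OF w])
    ultimately show ?thesis
      by (simp add: res_scaleC[OF w])
  qed
  have "char_fun T w x - char_fun T z x = Ds (w *\<^sub>C res w (D x)) - Ds (z *\<^sub>C res z (D x))"
    by (simp add: char_fun_eq[OF z] char_fun_eq[OF w] lin)
  also have "\<dots> = (w - z) *\<^sub>C Ds (res w (res z (D x)))"
    by (simp add: first[of "D x"] lin)
  also have "\<dots> = (w - z) *\<^sub>C Ds (res z (res z (D x)))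
      + (w - z)\<^sup>2 *\<^sub>C Ds (res w (Ts (res z (res z (D x)))))"
    by (simp add: second[of "res z (D x)"] lin scaleC_add_right scaleC_scaleC power2_eq_square)
  finally show ?thesis
    by simp
qed

lemma char_fun_analytic: "contractive_analytic (defect_space T) (codefect_space T) (char_fun T)"
  unfolding contractive_analytic_def analytic_op_fun_def
proof (intro conjI ballI defect_space codefect_space)
  fix z :: complex
  assume "z \<in> ball 0 1"
  then have z: "cmod z < 1"
    by simp
  show "contraction_on (defect_space T) (codefect_space T) (char_fun T z)"
    by (rule char_fun_contraction_on[OF z])
  then show "bounded_clinear_on (defect_space T) (codefect_space T) (char_fun T z)"
    by (rule contraction_on_bounded)
  let ?G = "\<lambda>x. Ds (res z (res z (D x)))"
  have rr: "norm (res z (res z (D x))) \<le> norm x / (1 - cmod z) / (1 - cmod z)" for x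
  proof -
    have "norm (res z (res z (D x))) \<le> norm (res z (D x)) / (1 - cmod z)"
      by (rule norm_res_le[OF z])
    also have "norm (res z (D x)) \<le> norm (D x) / (1 - cmod z)"
      by (rule norm_res_le[OF z])
    also have "norm (D x) \<le> norm x"
      by (simp add: D_norm)
    finally show ?thesis
      using z by (simp add: divide_right_mono)
  qed
  show "\<exists>G. bounded_clinear_on (defect_space T) (codefect_space T) G \<and>
      (\<forall>\<epsilon>>0. \<forall>\<^sub>F w in at z. \<forall>x\<in>defect_space T.
        norm (char_fun T w x - char_fun T z x - (w - z) *\<^sub>C G x) \<le> \<epsilon> * cmod (w - z) * norm x)"
  proof (intro exI[of _ ?G] conjI allI impI)
    have "norm (?G x) \<le> (1 / (1 - cmod z) / (1 - cmod z)) * norm x" for x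
      using order_trans[OF Ds_norm[OF UNIV_I] rr] by simp
    moreover have "clinear_on (defect_space T) (codefect_space T) ?G"
      by (auto simp: clinear_on_def lin res_add[OF z] res_scaleC[OF z] intro: Ds_in_codefect_space)
    ultimately show "bounded_clinear_on (defect_space T) (codefect_space T) ?G"
      unfolding bounded_clinear_on_def by blast
    fix \<epsilon> :: real
    assume \<epsilon>: "\<epsilon> > 0"
    let ?b = "\<lambda>w. cmod (w - z) / (1 - cmod w) / (1 - cmod z) / (1 - cmod z)"
    have "(?b \<longlongrightarrow> cmod (z - z) / (1 - cmod z) / (1 - cmod z) / (1 - cmod z)) (at z)"
      using z by (intro tendsto_intros) auto
    then have "\<forall>\<^sub>F w in at z. ?b w < \<epsilon>"
      using \<epsilon> by (intro order_tendstoD) auto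
    moreover have "((\<lambda>w. cmod w) \<longlongrightarrow> cmod z) (at z)"
      by (intro tendsto_intros)
    then have "\<forall>\<^sub>F w in at z. cmod w < 1"
      using z by (rule order_tendstoD)
    ultimately show "\<forall>\<^sub>F w in at z. \<forall>x\<in>defect_space T.
        norm (char_fun T w x - char_fun T z x - (w - z) *\<^sub>C ?G x) \<le> \<epsilon> * cmod (w - z) * norm x"
    proof eventually_elim
      case (elim w)
      show ?case
      proof
        fix x
        have "norm (Ds (res w (Ts (res z (res z (D x)))))) \<le> norm (res w (Ts (res z (res z (D x)))))"
          by (simp add: Ds_norm)
        also have "\<dots> \<le> norm (Ts (res z (res z (D x)))) / (1 - cmod w)"
          by (rule norm_res_le[OF elim(2)])
        also have "\<dots> \<le> (norm x / (1 - cmod z) / (1 - cmod z)) / (1 - cmod w)"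
          using elim(2) by (intro divide_right_mono order_trans[OF Ts_norm rr]) auto
        finally have "cmod (w - z) * norm (Ds (res w (Ts (res z (res z (D x))))))
            \<le> cmod (w - z) * ((norm x / (1 - cmod z) / (1 - cmod z)) / (1 - cmod w))"
          by (intro mult_left_mono) auto
        also have "\<dots> = ?b w * norm x"
          by simp
        also have "\<dots> \<le> \<epsilon> * norm x"
          using elim(1) by (intro mult_right_mono) auto
        finally have "cmod (w - z) * (cmod (w - z) * norm (Ds (res w (Ts (res z (res z (D x)))))))
            \<le> cmod (w - z) * (\<epsilon> * norm x)"
          by (intro mult_left_mono) auto
        then show "norm (char_fun T w x - char_fun T z x - (w - z) *\<^sub>C ?G x) \<le> \<epsilon> * cmod (w - z) * norm x"
          by (simp add: char_fun_difference[OF z elim(2)] norm_scaleC norm_mult power2_eq_square mult_ac)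
      qed
    qed
  qed
qed

text \<open>The Taylor coefficients of \<open>\<Theta>\<^sub>T(z) x\<close> at \<open>0\<close>.\<close>

definition coeff :: "'a \<Rightarrow> nat \<Rightarrow> 'a" where
  "coeff x n = (case n of 0 \<Rightarrow> - T x | Suc k \<Rightarrow> Ds ((Ts ^^ k) (D x)))"

text \<open>Telescoping by \<open>\<parallel>D\<^bsub>T*\<^esub> y\<parallel>\<^sup>2 = \<parallel>y\<parallel>\<^sup>2 - \<parallel>T* y\<parallel>\<^sup>2\<close>.\<close>

lemma sum_norm_coeff_sq: "(\<Sum>n<Suc N. (norm (coeff x n))\<^sup>2) = (norm x)\<^sup>2 - (norm ((Ts ^^ N) (D x)))\<^sup>2"
proof (induction N)
  case 0
  then show ?case
    by (simp add: coeff_def D_norm_sq)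
next
  case (Suc N)
  then show ?case
    by (simp add: coeff_def Ds_norm_sq)
qed

lemma summable_norm_coeff_sq: "summable (\<lambda>n. (norm (coeff x n))\<^sup>2)"
proof (rule bounded_imp_summable)
  show "(\<Sum>n\<le>N. (norm (coeff x n))\<^sup>2) \<le> (norm x)\<^sup>2" for N
    unfolding lessThan_Suc_atMost[symmetric] sum_norm_coeff_sq by simp
qed simp

lemma char_fun_pseries:
  assumes z: "cmod z < 1"
  shows "char_fun T z x = pseries (coeff x) z"
proof -
  have "pseries (coeff x) z = coeff x 0 + (\<Sum>n. z ^ Suc n *\<^sub>C coeff x (Suc n))"
    unfolding pseries_def
    using suminf_split_head[OF pseries_terms_summable_disc(2)[OF summable_norm_coeff_sq z]] by simp
  also have "(\<Sum>n. z ^ Suc n *\<^sub>C coeff x (Suc n)) = (\<Sum>n. z *\<^sub>C Ds (z ^ n *\<^sub>C (Ts ^^ n) (D x)))"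
    by (simp add: coeff_def lin scaleC_scaleC)
  also have "\<dots> = z *\<^sub>C Ds (res z (D x))"
    unfolding res_def pseries_def
    using bounded_linear.suminf[OF bounded_linear_compose[OF bounded_linear_scaleC bounded_linear_Ds]
        res_summable[OF z], of z] by simp
  finally have "pseries (coeff x) z = coeff x 0 + z *\<^sub>C Ds (res z (D x))" .
  moreover have "coeff x 0 = - T x"
    by (simp add: coeff_def)
  ultimately show ?thesis
    by (simp add: char_fun_eq[OF z])
qed

text \<open>Fatou's theorem applies to each vector of a countable dense set; contractivity of \<open>\<Theta>\<^sub>T(z)\<close> extends the
  limits to all vectors off one common null set.\<close>

lemma char_fun_radial_limits:
  "AE t in circ. \<forall>x. \<exists>l. ((\<lambda>r. char_fun T (complex_of_real r * cis t) x) \<longlongrightarrow> l) (at_left 1)"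
proof -
  obtain A :: "'a set" where A: "countable A" "\<And>U. open U \<Longrightarrow> U \<noteq> {} \<Longrightarrow> \<exists>d\<in>A. d \<in> U"
    using countable_dense_exists by blast
  let ?f = "\<lambda>t x r. char_fun T (complex_of_real r * cis t) x"
  have "AE t in circ. \<exists>l. (?f t x \<longlongrightarrow> l) (at_left 1)" for x
    using pseries_radial_limit[OF summable_norm_coeff_sq[of x]]
  proof eventually_elim
    case (elim t)
    then obtain l where l: "((\<lambda>r. pseries (coeff x) (complex_of_real r * cis t)) \<longlongrightarrow> l) (at_left 1)"
      by blast
    have "\<forall>\<^sub>F r in at_left 1. pseries (coeff x) (complex_of_real r * cis t) = ?f t x r"
      using eventually_at_left_1 by eventually_elim (simp add: char_fun_pseries norm_mult)
    from Lim_transform_eventually[OF l this] show ?case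
      by blast
  qed
  then have "AE t in circ. \<forall>d\<in>A. \<exists>l. (?f t d \<longlongrightarrow> l) (at_left 1)"
    by (intro AE_ball_countable'[OF _ A(1)])
  then show ?thesis
  proof eventually_elim
    case (elim t)
    show ?case
    proof (intro allI convergent_at_left_if_Cauchy)
      fix x and m :: nat
      define e where "e = 1 / real (Suc m) / 4"
      have e: "e > 0"
        by (simp add: e_def)
      obtain d where d: "d \<in> A" "dist x d < e"
        using A(2)[of "ball x e"] e by auto
      obtain l where "(?f t d \<longlongrightarrow> l) (at_left 1)"
        using elim d by blast
      then have "\<forall>\<^sub>F r in at_left 1. dist (?f t d r) l < e"
        using e by (rule tendstoD)
      then obtain r0 where r0: "r0 < 1" "\<And>r. r0 < r \<Longrightarrow> r < 1 \<Longrightarrow> dist (?f t d r) l < e"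
        unfolding eventually_at_left_field by auto
      have near: "dist (?f t x r) (?f t d r) \<le> dist x d" if "0 \<le> r" "r < 1" for r
      proof -
        have c: "contraction_on UNIV UNIV (char_fun T (complex_of_real r * cis t))"
          using that by (intro char_fun_contraction) (simp add: norm_mult)
        then have "clinear_on UNIV UNIV (char_fun T (complex_of_real r * cis t))"
          by (simp add: contraction_on_def)
        then have "?f t x r - ?f t d r = ?f t (x - d) r"
          by (rule clinear_on_more(3)[OF closed_csubspace_UNIV _ UNIV_I UNIV_I, symmetric])
        then show ?thesis
          using c by (simp add: contraction_on_def dist_norm)
      qed
      have "dist (?f t x r) (?f t x s) \<le> 1 / real (Suc m)"
        if r: "max r0 0 < r" "r < 1" and s: "max r0 0 < s" "s < 1" for r s
      proof -
        have "dist (?f t x r) (?f t x s) \<le> dist (?f t x r) (?f t d r) + dist (?f t d r) l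
            + (dist (?f t d s) l + dist (?f t x s) (?f t d s))"
          using dist_triangle[of "?f t x r" "?f t x s" l] dist_triangle[of "?f t x r" l "?f t d r"]
            dist_triangle[of "?f t x s" l "?f t d s"] by (simp add: dist_commute)
        also have "\<dots> \<le> e + e + (e + e)"
          using near[of r] near[of s] r0(2)[of r] r0(2)[of s] d r s by (intro add_mono) auto
        also have "\<dots> = 1 / real (Suc m)"
          unfolding e_def by linarith
        finally show ?thesis .
      qed
      then show "\<exists>d<1. \<forall>r s. d < r \<and> r < 1 \<and> d < s \<and> s < 1 \<longrightarrow> dist (?f t x r) (?f t x s) \<le> 1 / real (Suc m)"
        using r0(1) by (intro exI[of _ "max r0 0"]) auto
    qed
  qed
qed

lemma char_fun_boundary_contraction: "boundary_contraction (defect_space T) (codefect_space T) (char_fun T)"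
  by (intro boundary_contraction.intro char_fun_analytic)
    (use char_fun_radial_limits in eventually_elim, blast)

lemma pure_imp_sums:
  assumes "pure_contraction T"
  shows "(\<lambda>n. (norm (coeff x n))\<^sup>2) sums (norm x)\<^sup>2"
proof -
  have "(\<lambda>N. (norm x)\<^sup>2 - (norm ((Ts ^^ N) (D x)))\<^sup>2) \<longlonglongrightarrow> (norm x)\<^sup>2 - 0\<^sup>2"
    using assms unfolding pure_contraction_def by (intro tendsto_intros) auto
  then have "(\<lambda>N. \<Sum>n<Suc N. (norm (coeff x n))\<^sup>2) \<longlonglongrightarrow> (norm x)\<^sup>2"
    unfolding sum_norm_coeff_sq by simp
  then show ?thesis
    unfolding sums_def by (rule LIMSEQ_imp_Suc)
qed

text \<open>By Parseval's identity the mean square of the boundary function is the square sum of the coefficients, that is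
  \<open>\<parallel>x\<parallel>\<^sup>2\<close>, while its norm is at most \<open>\<parallel>x\<parallel>\<close> everywhere.\<close>

lemma pure_imp_inner_at:
  assumes pure: "pure_contraction T"
  shows "AE t in circ. \<forall>l. ((\<lambda>r. char_fun T (complex_of_real r * cis t) x) \<longlongrightarrow> l) (at_left 1) \<longrightarrow> norm l = norm x"
proof -
  let ?f = "\<lambda>n t. pseries (coeff x) (complex_of_real (radii n) * cis t)"
  define g where "g t = lim (\<lambda>n. ?f n t)" for t
  have rad: "cmod (complex_of_real (radii n)) < 1" for n
    using radii[of n] by simp
  define b where "b n k = complex_of_real (radii n) ^ k *\<^sub>C coeff x k" for n k
  have b: "summable (\<lambda>k. norm (b n k))" for n
    unfolding b_def by (rule pseries_terms_summable_disc(1)[OF summable_norm_coeff_sq rad])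
  have f_b: "?f n t = pseries (b n) (cis t)" for n t
    by (simp add: pseries_def b_def scaleC_scaleC power_mult_distrib mult.commute)
  have f_char: "?f n t = char_fun T (complex_of_real (radii n) * cis t) x" for n t
    using radii[of n] by (intro char_fun_pseries[symmetric]) (simp add: norm_mult)
  have f_le: "norm (?f n t) \<le> norm x" for n t
    unfolding f_char using radii[of n] by (intro char_fun_norm_le) (simp add: norm_mult)
  have cont: "continuous_on {0..2 * pi} (?f n)" for n
    unfolding f_b by (rule continuous_on_pseries_cis[OF b])
  have f_meas: "?f n \<in> borel_measurable circ" for n
    by (rule continuous_imp_measurable_on_sets_lebesgue[OF cont]) simp
  then have g_meas: "g \<in> borel_measurable circ"
    unfolding g_def by (rule borel_measurable_lim_metric)
  have lim_g: "AE t in circ. (\<lambda>n. ?f n t) \<longlonglongrightarrow> g t \<and>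
      (\<forall>l. ((\<lambda>r. char_fun T (complex_of_real r * cis t) x) \<longlongrightarrow> l) (at_left 1) \<longrightarrow> l = g t)"
    using char_fun_radial_limits
  proof eventually_elim
    case (elim t)
    then obtain l where l: "((\<lambda>r. char_fun T (complex_of_real r * cis t) x) \<longlongrightarrow> l) (at_left 1)"
      by blast
    have "(\<lambda>n. ?f n t) \<longlonglongrightarrow> l"
      unfolding f_char by (rule filterlim_compose[OF l filterlim_radii])
    moreover from this have "g t = l"
      unfolding g_def by (rule limI)
    ultimately show ?case
      using tendsto_unique[OF trivial_limit_at_left_real l] by auto
  qed
  have const: "integrable circ (\<lambda>t. (norm x)\<^sup>2)"
    by (rule finite_measure.integrable_const[OF finite_measure_lebesgue_on]) simp
  have int_f: "integrable circ (\<lambda>t. (norm (?f n t))\<^sup>2)" for n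
    using f_meas[of n] f_le[of n]
    by (intro Bochner_Integration.integrable_bound[OF const]) (auto intro!: power_mono)
  have g_le: "AE t in circ. norm (g t) \<le> norm x"
    using lim_g by eventually_elim (use f_le in \<open>auto intro!: tendsto_upperbound[OF tendsto_norm]\<close>)
  have int_g: "integrable circ (\<lambda>t. (norm (g t))\<^sup>2)"
    using g_meas g_le
    by (intro Bochner_Integration.integrable_bound[OF const]) (auto intro!: power_mono elim: eventually_mono)
  have f_val: "2 * pi * (\<Sum>k<N. (radii n) ^ (2 * k) * (norm (coeff x k))\<^sup>2) \<le> (LINT t|circ. (norm (?f n t))\<^sup>2)" for n N
  proof -
    obtain S where S: "(\<lambda>k. (norm (b n k))\<^sup>2) sums S"
      "((\<lambda>t. (norm (pseries (b n) (cis t)))\<^sup>2) has_integral 2 * pi * S) {0..0 + 2 * pi}"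
      by (rule parseval_pseries[OF b])
    have "(LINT t|circ. (norm (?f n t))\<^sup>2) = integral {0..2 * pi} (\<lambda>t. (norm (?f n t))\<^sup>2)"
      by (rule lebesgue_integral_eq_integral[OF int_f]) simp
    also have "\<dots> = 2 * pi * S"
      unfolding f_b by (rule integral_unique) (use S(2) in simp)
    finally have "(LINT t|circ. (norm (?f n t))\<^sup>2) = 2 * pi * S" .
    moreover have "(\<Sum>k<N. (norm (b n k))\<^sup>2) \<le> S"
      using S(1) sum_le_suminf[of "\<lambda>k. (norm (b n k))\<^sup>2" "{..<N}"] by (auto simp: sums_iff)
    moreover have "(norm (b n k))\<^sup>2 = (radii n) ^ (2 * k) * (norm (coeff x k))\<^sup>2" for k
      using radii[of n] by (simp add: b_def norm_scaleC norm_power power_mult_distrib power_mult mult.commute)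
    ultimately show ?thesis
      by simp
  qed
  have lim_int: "(\<lambda>n. LINT t|circ. (norm (?f n t))\<^sup>2) \<longlonglongrightarrow> (LINT t|circ. (norm (g t))\<^sup>2)"
  proof (rule integral_dominated_convergence[where w = "\<lambda>t. (norm x)\<^sup>2"])
    show "AE t in circ. (\<lambda>n. (norm (?f n t))\<^sup>2) \<longlonglongrightarrow> (norm (g t))\<^sup>2"
      using lim_g by eventually_elim (auto intro!: tendsto_intros)
    show "AE t in circ. norm ((norm (?f n t))\<^sup>2) \<le> (norm x)\<^sup>2" for n
      using f_le[of n] by (auto intro!: power_mono)
  qed (use int_g int_f const in \<open>auto intro: borel_measurable_integrable\<close>)
  have radii_1: "radii \<longlonglongrightarrow> 1"
    using filterlim_radii by (simp add: filterlim_at)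
  have partial_le: "2 * pi * (\<Sum>k<N. (norm (coeff x k))\<^sup>2) \<le> (LINT t|circ. (norm (g t))\<^sup>2)" for N
  proof (rule LIMSEQ_le[OF _ lim_int])
    have "(\<lambda>n. 2 * pi * (\<Sum>k<N. (radii n) ^ (2 * k) * (norm (coeff x k))\<^sup>2))
        \<longlonglongrightarrow> 2 * pi * (\<Sum>k<N. 1 ^ (2 * k) * (norm (coeff x k))\<^sup>2)"
      by (intro tendsto_intros radii_1)
    then show "(\<lambda>n. 2 * pi * (\<Sum>k<N. (radii n) ^ (2 * k) * (norm (coeff x k))\<^sup>2))
        \<longlonglongrightarrow> 2 * pi * (\<Sum>k<N. (norm (coeff x k))\<^sup>2)"
      by simp
  qed (use f_val in blast)
  have "(\<lambda>N. 2 * pi * (\<Sum>k<N. (norm (coeff x k))\<^sup>2)) \<longlonglongrightarrow> 2 * pi * (norm x)\<^sup>2"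
    using pure_imp_sums[OF pure, of x] unfolding sums_def by (intro tendsto_intros)
  then have le: "2 * pi * (norm x)\<^sup>2 \<le> (LINT t|circ. (norm (g t))\<^sup>2)"
    by (rule LIMSEQ_le_const2) (use partial_le in blast)
  have int_const: "(LINT t|circ. (norm x)\<^sup>2) = 2 * pi * (norm x)\<^sup>2"
    using lebesgue_integral_eq_integral[OF const] by simp
  have nonneg: "AE t in circ. 0 \<le> (norm x)\<^sup>2 - (norm (g t))\<^sup>2"
    using g_le by eventually_elim (simp add: power_mono)
  have "(LINT t|circ. (norm x)\<^sup>2 - (norm (g t))\<^sup>2) \<le> 0"
    unfolding Bochner_Integration.integral_diff[OF const int_g] int_const using le by linarith
  moreover have "0 \<le> (LINT t|circ. (norm x)\<^sup>2 - (norm (g t))\<^sup>2)"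
    by (rule integral_nonneg_AE[OF nonneg])
  ultimately have "AE t in circ. (norm x)\<^sup>2 - (norm (g t))\<^sup>2 = 0"
    by (subst integral_nonneg_eq_0_iff_AE[symmetric, OF _ nonneg]) (use const int_g in auto)
  with lim_g show ?thesis
    by eventually_elim auto
qed

text \<open>One null set for all vectors, again by density.\<close>

lemma pure_imp_inner:
  assumes pure: "pure_contraction T"
  shows "AE t in circ. \<forall>x l. ((\<lambda>r. char_fun T (complex_of_real r * cis t) x) \<longlongrightarrow> l) (at_left 1) \<longrightarrow> norm l = norm x"
proof -
  obtain A :: "'a set" where A: "countable A" "\<And>U. open U \<Longrightarrow> U \<noteq> {} \<Longrightarrow> \<exists>d\<in>A. d \<in> U"
    using countable_dense_exists by blast
  let ?f = "\<lambda>t x r. char_fun T (complex_of_real r * cis t) x"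
  have "AE t in circ. \<forall>d\<in>A. \<forall>l. (?f t d \<longlongrightarrow> l) (at_left 1) \<longrightarrow> norm l = norm d"
    by (intro AE_ball_countable'[OF _ A(1)] pure_imp_inner_at[OF pure])
  with char_fun_radial_limits show ?thesis
  proof eventually_elim
    case (elim t)
    define W where "W x = Lim (at_left 1) (?f t x)" for x
    have W: "(?f t x \<longlongrightarrow> W x) (at_left 1)" for x
      using elim(1) tendsto_Lim[OF trivial_limit_at_left_real] unfolding W_def by metis
    have Wc: "contraction_on UNIV UNIV W"
      by (rule contraction_on_limit[OF trivial_limit_at_left_real closed_csubspace_UNIV _ closed_csubspace_UNIV W])
        (use eventually_at_left_1 in eventually_elim, auto intro!: char_fun_contraction simp: norm_mult)
    have "norm (W x) = norm x" for x
    proof (rule antisym)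
      show "norm (W x) \<le> norm x"
        using Wc by (simp add: contraction_on_def)
      show "norm x \<le> norm (W x)"
      proof (rule field_le_epsilon)
        fix e :: real
        assume "e > 0"
        then obtain d where d: "d \<in> A" "dist x d < e / 2"
          using A(2)[of "ball x (e / 2)"] by auto
        have "norm (W d) = norm d"
          using elim(2) d W by blast
        moreover have "norm (W (d - x)) \<le> norm (d - x)"
          using Wc by (simp add: contraction_on_def)
        moreover have "W (d - x) = W d - W x"
          using Wc by (intro clinear_on_more(3)[OF closed_csubspace_UNIV]) (auto simp: contraction_on_def)
        ultimately show "norm x \<le> norm (W x) + e"
          using norm_triangle_ineq2[of "W d" "W x"] norm_triangle_ineq2[of x d] d(2)
          by (simp add: dist_norm norm_minus_commute)
      qed
    qed
    then show ?case
      using tendsto_unique[OF trivial_limit_at_left_real W] by metis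
  qed
qed

lemma cinner_char_fun:
  assumes z: "cmod z < 1"
  shows "cinner (char_fun T z x) y = cinner x (char_fun Ts (cnj z) y)"
proof -
  interpret adjoint: contraction_operator Ts
    by (rule adj_contraction_operator)
  have cz: "cmod (cnj z) < 1"
    using z by simp
  define u where "u = res z (D x)"
  define v where "v = adjoint.res (cnj z) (Ds y)"
  have u: "D x = u - z *\<^sub>C Ts u"
    unfolding u_def by (rule res_eq[OF z, symmetric])
  have v: "Ds y = v - cnj z *\<^sub>C T v"
    using adjoint.res_eq[OF cz, of "Ds y"] by (simp add: v_def adj_adj_eq)
  have "cinner u (Ds y) = cinner (u - z *\<^sub>C Ts u) v"
    unfolding v by (simp add: cinner_diff_left cinner_diff_right cinner_scaleC_left cinner_scaleC_right Ts_cinner')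
  then have *: "cinner (Ds u) y = cinner x (D v)"
    by (simp add: Ds_selfadj u[symmetric] D_selfadj)
  have "char_fun Ts (cnj z) y = - Ts y + cnj z *\<^sub>C D v"
    using adjoint.char_fun_eq[OF cz, of y] by (simp add: v_def codefect_eq[symmetric] codefect_adjoint)
  then show ?thesis
    using * by (simp add: char_fun_eq[OF z] u_def[symmetric] cinner_add_left cinner_diff_left
        cinner_add_right cinner_diff_right cinner_scaleC_left cinner_scaleC_right Ts_cinner)
qed

end

text \<open>The relation \<open>\<Theta>\<^sub>T(z)* = \<Theta>\<^bsub>T*\<^esub>(cnj z)\<close> pairs boundary values at \<open>t\<close> with those at \<open>2\<pi> - t\<close>.\<close>

lemma AE_circ_reflect:
  assumes "AE t in circ. P t"
  shows "AE t in circ. P (2 * pi - t)"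
proof (rule AE_circI)
  let ?N = "{t \<in> {0..2 * pi}. \<not> P t}"
  have "AE t in lebesgue. t \<in> {0..2 * pi} \<longrightarrow> P t"
    using assms by (subst (asm) AE_restrict_space_iff) auto
  then have "{t \<in> space lebesgue. \<not> (t \<in> {0..2 * pi} \<longrightarrow> P t)} \<in> null_sets lebesgue"
    by (simp only: completion.AE_iff_null_sets)
  then have "negligible {t \<in> space lebesgue. \<not> (t \<in> {0..2 * pi} \<longrightarrow> P t)}"
    by (simp only: negligible_iff_null_sets)
  then have "negligible ?N"
    by (rule negligible_subset) auto
  then have "negligible ((\<lambda>t. 2 * pi - t) ` ?N)"
    by (intro negligible_differentiable_image_negligible)
      (auto intro!: differentiable_on_diff differentiable_on_const differentiable_on_ident)
  moreover have "{t \<in> {0..2 * pi}. \<not> P (2 * pi - t)} \<subseteq> (\<lambda>t. 2 * pi - t) ` ?N"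
    by (auto intro!: image_eqI[where x = "2 * pi - _"])
  ultimately show "negligible {t \<in> {0..2 * pi}. \<not> P (2 * pi - t)}"
    by (rule negligible_subset)
qed

lemma cis_reflect: "cis (2 * pi - t) = cnj (cis t)"
  by (simp add: complex_eq_iff cos_2pi_minus sin_2pi_minus)

section \<open>The three factors\<close>

lemma unitary_on_inv_into:
  assumes E: "closed_csubspace E" and U: "unitary_on E F U"
  shows "\<And>y. y \<in> F \<Longrightarrow> U (inv_into E U y) = y" "\<And>x. x \<in> E \<Longrightarrow> inv_into E U (U x) = x"
    and "unitary_on F E (inv_into E U)"
proof -
  have lin: "clinear_on E F U" and norm: "\<And>x. x \<in> E \<Longrightarrow> norm (U x) = norm x" and im: "U ` E = F"
    using U by (auto simp: unitary_on_def)
  have inj: "inj_on U E"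
  proof (rule inj_onI)
    fix x y
    assume xy: "x \<in> E" "y \<in> E" "U x = U y"
    then have "norm (x - y) = 0"
      using norm[OF closed_csubspace_more(2)[OF E xy(1,2)]] clinear_on_more(3)[OF E lin xy(1,2)] by simp
    then show "x = y"
      by simp
  qed
  show r: "U (inv_into E U y) = y" if "y \<in> F" for y
    using that im by (simp add: f_inv_into_f)
  show l: "inv_into E U (U x) = x" if "x \<in> E" for x
    using that inj by simp
  have i: "inv_into E U y \<in> E" if "y \<in> F" for y
    using that im by (simp add: inv_into_into)
  have "inv_into E U (x + y) = inv_into E U x + inv_into E U y" if "x \<in> F" "y \<in> F" for x y
    using l[OF closed_csubspaceD(3)[OF E i[OF that(1)] i[OF that(2)]]]
    by (simp add: clinear_onD(2)[OF lin] i r that)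
  moreover have "inv_into E U (c *\<^sub>C x) = c *\<^sub>C inv_into E U x" if "x \<in> F" for c x
    using l[OF closed_csubspaceD(4)[OF E i[OF that], of c]] by (simp add: clinear_onD(3)[OF lin] i r that)
  moreover have "norm (inv_into E U y) = norm y" if "y \<in> F" for y
    using norm[OF i[OF that]] r[OF that] by simp
  moreover have "inv_into E U ` F = E"
    using i l clinear_onD(1)[OF lin] by force
  ultimately show "unitary_on F E (inv_into E U)"
    using i by (auto simp: unitary_on_def clinear_on_def)
qed

lemma unitary_on_contraction: "unitary_on E F U \<Longrightarrow> contraction_on E F U"
  by (auto simp: unitary_on_def contraction_on_def)

lemma contraction_on_id: "contraction_on E E (\<lambda>x. x)"
  by (auto simp: contraction_on_def clinear_on_def)

lemma norm_Pair_le: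
  assumes "norm a \<le> norm c"
  shows "norm (a, b) \<le> norm (c, b)"
  unfolding norm_Pair using assms by (intro real_sqrt_le_mono add_mono power_mono) auto

text \<open>The outer factors have the form \<open>R (\<Theta>(z) \<oplus> I) S\<close> with constant contractions \<open>R\<close> and \<open>S\<close>.\<close>

lemma boundary_contraction_sandwich:
  assumes \<Theta>: "boundary_contraction E F \<Theta>" and E': "closed_csubspace E'" and F': "closed_csubspace F'"
    and G: "closed_csubspace G" and S: "contraction_on E' (E \<times> G) S" and R: "contraction_on (F \<times> G) F' R"
  defines "\<Psi> \<equiv> \<lambda>z x. R (\<Theta> z (fst (S x)), snd (S x))"
  shows "boundary_contraction E' F' \<Psi>"
    and "AE t in circ. \<forall>x\<in>E'. boundary_value \<Psi> t x = R (boundary_value \<Theta> t (fst (S x)), snd (S x))"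
proof -
  interpret \<Theta>: boundary_contraction E F \<Theta> by (rule \<Theta>)
  have FG: "closed_csubspace (F \<times> G)"
    by (rule closed_csubspace_Times[OF \<Theta>.F G])
  have Rl: "clinear_on (F \<times> G) F' R" and Rn: "\<And>p. p \<in> F \<times> G \<Longrightarrow> norm (R p) \<le> norm p"
    using R by (auto simp: contraction_on_def)
  have Sl: "clinear_on E' (E \<times> G) S" and Sn: "\<And>x. x \<in> E' \<Longrightarrow> norm (S x) \<le> norm x"
    using S by (auto simp: contraction_on_def)
  have S1: "fst (S x) \<in> E" "snd (S x) \<in> G" if "x \<in> E'" for x
    using clinear_onD(1)[OF Sl that] by auto
  have sum: "contraction_on (E \<times> G) (F \<times> G) (\<lambda>p. (f (fst p), snd p))" if "contraction_on E F f" for f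
    using that by (auto simp: contraction_on_def clinear_on_def scaleC_prod_def intro: norm_Pair_le)
  have comp: "contraction_on E' F' (\<lambda>x. R (f (fst (S x)), snd (S x)))" if "contraction_on E F f" for f
    using contraction_on_comp[OF contraction_on_comp[OF S sum[OF that]] R] .
  have analytic: "contractive_analytic E' F' \<Psi>"
    unfolding contractive_analytic_def analytic_op_fun_def
  proof (intro conjI ballI E' F')
    fix z :: complex
    assume z: "z \<in> ball 0 1"
    have cz: "contraction_on E F (\<Theta> z)" if "z \<in> ball 0 1" for z
      using \<Theta>.analytic that by (simp add: contractive_analytic_def)
    show "contraction_on E' F' (\<Psi> z)"
      unfolding \<Psi>_def by (rule comp[OF cz[OF z]])
    then show "bounded_clinear_on E' F' (\<Psi> z)"
      by (rule contraction_on_bounded)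
    obtain H where H: "bounded_clinear_on E F H" "\<And>\<epsilon>. \<epsilon> > 0 \<Longrightarrow> \<forall>\<^sub>F w in at z. \<forall>x\<in>E.
        norm (\<Theta> w x - \<Theta> z x - (w - z) *\<^sub>C H x) \<le> \<epsilon> * cmod (w - z) * norm x"
      using \<Theta>.analytic z unfolding contractive_analytic_def analytic_op_fun_def by blast
    then obtain K where Hl: "clinear_on E F H" and K: "\<And>x. x \<in> E \<Longrightarrow> norm (H x) \<le> K * norm x"
      unfolding bounded_clinear_on_def by blast
    have H0: "(H x, 0) \<in> F \<times> G" if "x \<in> E" for x
      using clinear_onD(1)[OF Hl that] closed_csubspaceD(2)[OF G] by simp
    have fst_le: "norm (fst (S x)) \<le> norm x" if "x \<in> E'" for x
      using order_trans[OF norm_fst_le[of "fst (S x)" "snd (S x)"], of "norm x"] Sn[OF that] by simp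
    let ?H = "\<lambda>x. R (H (fst (S x)), 0)"
    show "\<exists>H. bounded_clinear_on E' F' H \<and> (\<forall>\<epsilon>>0. \<forall>\<^sub>F w in at z. \<forall>x\<in>E'.
        norm (\<Psi> w x - \<Psi> z x - (w - z) *\<^sub>C H x) \<le> \<epsilon> * cmod (w - z) * norm x)"
    proof (intro exI[of _ ?H] conjI allI impI)
      have "?H (x + y) = ?H x + ?H y" if "x \<in> E'" "y \<in> E'" for x y
        using clinear_onD(2)[OF Rl H0[OF S1(1)[OF that(1)]] H0[OF S1(1)[OF that(2)]]]
        by (simp add: clinear_onD(2)[OF Sl that] clinear_onD(2)[OF Hl] S1 that)
      moreover have "?H (c *\<^sub>C x) = c *\<^sub>C ?H x" if "x \<in> E'" for c x
        using clinear_onD(3)[OF Rl H0[OF S1(1)[OF that]], of c]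
        by (simp add: clinear_onD(3)[OF Sl that] clinear_onD(3)[OF Hl] S1 that scaleC_prod_def)
      moreover have "norm (?H x) \<le> \<bar>K\<bar> * norm x" if x: "x \<in> E'" for x
      proof -
        have "norm (?H x) \<le> norm (H (fst (S x)))"
          using Rn[OF H0[OF S1(1)[OF x]]] by simp
        also have "\<dots> \<le> K * norm (fst (S x))"
          by (rule K[OF S1(1)[OF x]])
        also have "\<dots> \<le> \<bar>K\<bar> * norm x"
          using fst_le[OF x] by (intro mult_mono) auto
        finally show ?thesis .
      qed
      moreover have "?H x \<in> F'" if "x \<in> E'" for x
        by (intro clinear_onD(1)[OF Rl] H0 S1 that)
      ultimately show "bounded_clinear_on E' F' ?H"
        unfolding bounded_clinear_on_def clinear_on_def image_subset_iff by blast
      fix \<epsilon> :: real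
      assume \<epsilon>: "\<epsilon> > 0"
      have "\<forall>\<^sub>F w in at z. w \<in> ball 0 1"
        by (rule eventually_at_in_open'[OF open_ball z])
      with H(2)[OF \<epsilon>] show "\<forall>\<^sub>F w in at z. \<forall>x\<in>E'.
          norm (\<Psi> w x - \<Psi> z x - (w - z) *\<^sub>C ?H x) \<le> \<epsilon> * cmod (w - z) * norm x"
      proof eventually_elim
        case (elim w)
        show ?case
        proof
          fix x
          assume x: "x \<in> E'"
          define u v where "u = fst (S x)" and "v = snd (S x)"
          have u: "u \<in> E" and v: "v \<in> G"
            using S1[OF x] by (auto simp: u_def v_def)
          have mem: "(\<Theta> w u, v) \<in> F \<times> G" "(\<Theta> z u, v) \<in> F \<times> G"
            using cz[OF z] cz[OF elim(2)] u v by (auto simp: contraction_on_def clinear_on_def)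
          have "\<Psi> w x - \<Psi> z x - (w - z) *\<^sub>C ?H x = R ((\<Theta> w u, v) - (\<Theta> z u, v) - (w - z) *\<^sub>C (H u, 0))"
            using clinear_on_more(3)[OF FG Rl mem]
              clinear_on_more(3)[OF FG Rl closed_csubspace_more(2)[OF FG mem] closed_csubspaceD(4)[OF FG H0[OF u]]]
              clinear_onD(3)[OF Rl H0[OF u]]
            by (simp add: \<Psi>_def u_def v_def)
          also have "norm \<dots> \<le> norm ((\<Theta> w u, v) - (\<Theta> z u, v) - (w - z) *\<^sub>C (H u, 0))"
            by (intro Rn closed_csubspace_more(2)[OF FG] closed_csubspaceD(4)[OF FG] mem H0 u)
          also have "\<dots> = norm (\<Theta> w u - \<Theta> z u - (w - z) *\<^sub>C H u)"
            by (simp add: scaleC_prod_def)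
          also have "\<dots> \<le> \<epsilon> * cmod (w - z) * norm u"
            using elim(1) u by blast
          also have "\<dots> \<le> \<epsilon> * cmod (w - z) * norm x"
            using fst_le[OF x] \<epsilon> by (intro mult_left_mono) (auto simp: u_def)
          finally show "norm (\<Psi> w x - \<Psi> z x - (w - z) *\<^sub>C ?H x) \<le> \<epsilon> * cmod (w - z) * norm x" .
        qed
      qed
    qed
  qed
  have lim: "AE t in circ. \<forall>x\<in>E'. ((\<lambda>r. \<Psi> (complex_of_real r * cis t) x)
      \<longlongrightarrow> R (boundary_value \<Theta> t (fst (S x)), snd (S x))) (at_left 1)"
    using \<Theta>.boundary_value_tendsto \<Theta>.boundary_value_contraction
  proof eventually_elim
    case (elim t)
    show ?case
      unfolding \<Psi>_def
    proof
      fix x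
      assume x: "x \<in> E'"
      have 1: "((\<lambda>r. (\<Theta> (complex_of_real r * cis t) (fst (S x)), snd (S x)))
          \<longlongrightarrow> (boundary_value \<Theta> t (fst (S x)), snd (S x))) (at_left 1)"
        using elim(1) S1[OF x] by (intro tendsto_Pair) auto
      have 2: "(boundary_value \<Theta> t (fst (S x)), snd (S x)) \<in> F \<times> G"
        using elim(2) S1[OF x] by (auto simp: contraction_on_def clinear_on_def)
      have 3: "\<forall>\<^sub>F r in at_left 1. (\<Theta> (complex_of_real r * cis t) (fst (S x)), snd (S x)) \<in> F \<times> G"
        using eventually_at_left_1
      proof eventually_elim
        case (elim r)
        then show ?case
          using contractive_analytic_contraction[OF \<Theta>.analytic, of r t] S1[OF x]
          by (auto simp: contraction_on_def clinear_on_def)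
      qed
      show "((\<lambda>r. R (\<Theta> (complex_of_real r * cis t) (fst (S x)), snd (S x)))
          \<longlongrightarrow> R (boundary_value \<Theta> t (fst (S x)), snd (S x))) (at_left 1)"
        by (rule contraction_tendsto_comp[OF always_eventually FG 3 1 2]) (use R in auto)
    qed
  qed
  show "boundary_contraction E' F' \<Psi>"
    by (intro boundary_contraction.intro analytic) (use lim in eventually_elim, blast)
  show "AE t in circ. \<forall>x\<in>E'. boundary_value \<Psi> t x = R (boundary_value \<Theta> t (fst (S x)), snd (S x))"
    using lim unfolding boundary_value_def[of \<Psi>]
    by eventually_elim (auto intro!: tendsto_Lim trivial_limit_at_left_real)
qed

text \<open>The middle factor is the unitary Julia operator of the coupling operator; its inverse is the Julia
  operator of the adjoint.\<close>

context subspace_contraction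
begin

definition julia :: "'b \<times> 'a \<Rightarrow> 'a \<times> 'b" where
  "julia = (\<lambda>(u, v). (Ts u + D v, Ds u - T v))"

definition julia_inv :: "'a \<times> 'b \<Rightarrow> 'b \<times> 'a" where
  "julia_inv = (\<lambda>(p, q). (T p + Ds q, D p - Ts q))"

lemma norm_julia: "x \<in> F \<times> E \<Longrightarrow> norm (julia x) = norm x"
  using julia_norm[of "fst x" "snd x"]
  by (auto simp: julia_def norm_Pair split: prod.splits)

lemma norm_julia_inv: "x \<in> E \<times> F \<Longrightarrow> norm (julia_inv x) = norm x"
  using subspace_contraction.julia_norm[OF adjoint_contraction, of "fst x" "snd x"]
  by (auto simp: julia_inv_def norm_Pair adj_adj codefect_eq[symmetric] codefect_adjoint split: prod.splits)

lemma contraction_on_julia: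
  "contraction_on (F \<times> defect_space_on E F T) (E \<times> codefect_space_on E F T) julia"
proof -
  have sub: "x \<in> E" if "x \<in> defect_space_on E F T" for x
    using that defect_space(2) by blast
  have mem: "julia x \<in> E \<times> codefect_space_on E F T" if "x \<in> F \<times> defect_space_on E F T" for x
    using that sub by (auto simp: julia_def Ts_in D_in closed_csubspaceD(3)[OF E]
        intro!: closed_csubspace_more(2)[OF codefect_space(1)] Ds_in_codefect_space T_defect_space)
  show ?thesis
    unfolding contraction_on_def
  proof
    show "clinear_on (F \<times> defect_space_on E F T) (E \<times> codefect_space_on E F T) julia"
      unfolding clinear_on_def using mem sub
      by (auto simp: julia_def clinear_onD[OF Ts_clinear] clinear_onD[OF D_clinear] clinear_onD[OF Ds_clinear]
          clinear_onD[OF T_clinear] scaleC_prod_def scaleC_add_right scaleC_diff_right)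
    show "\<forall>x\<in>F \<times> defect_space_on E F T. norm (julia x) \<le> norm x"
      using norm_julia sub by auto
  qed
qed

lemma contraction_on_julia_inv:
  "contraction_on (E \<times> codefect_space_on E F T) (F \<times> defect_space_on E F T) julia_inv"
proof -
  have sub: "x \<in> F" if "x \<in> codefect_space_on E F T" for x
    using that codefect_space(2) by blast
  have mem: "julia_inv x \<in> F \<times> defect_space_on E F T" if "x \<in> E \<times> codefect_space_on E F T" for x
    using that sub by (auto simp: julia_inv_def T_in Ds_in closed_csubspaceD(3)[OF F]
        intro!: closed_csubspace_more(2)[OF defect_space(1)] D_in_defect_space Ts_codefect_space)
  show ?thesis
    unfolding contraction_on_def
  proof
    show "clinear_on (E \<times> codefect_space_on E F T) (F \<times> defect_space_on E F T) julia_inv"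
      unfolding clinear_on_def using mem sub
      by (auto simp: julia_inv_def clinear_onD[OF Ts_clinear] clinear_onD[OF D_clinear] clinear_onD[OF Ds_clinear]
          clinear_onD[OF T_clinear] scaleC_prod_def scaleC_add_right scaleC_diff_right)
    show "\<forall>x\<in>E \<times> codefect_space_on E F T. norm (julia_inv x) \<le> norm x"
      using norm_julia_inv sub by auto
  qed
qed

lemma julia_julia_inv:
  assumes "x \<in> E \<times> F"
  shows "julia (julia_inv x) = x"
proof -
  obtain p q where x: "x = (p, q)" and p: "p \<in> E" and q: "q \<in> F"
    using assms by auto
  note mem = T_in[OF p] Ds_in[OF q] D_in[OF p] Ts_in[of q]
  have "Ts (T p + Ds q) + D (D p - Ts q) = p"
    using mem by (simp add: clinear_onD[OF Ts_clinear] clinear_on_more(3)[OF E D_clinear] D_square p Ts_Ds q)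
  moreover have "Ds (T p + Ds q) - T (D p - Ts q) = q"
    using mem by (simp add: clinear_onD[OF Ds_clinear] clinear_on_more(3)[OF E T_clinear] Ds_square q T_D p)
  ultimately show ?thesis
    by (simp add: julia_def julia_inv_def x)
qed

text \<open>\<open>D x = 0\<close> means \<open>T*T x = x\<close>, so that \<open>T\<close> is isometric at \<open>x\<close> and \<open>T*\<close> is isometric at \<open>T x\<close>; strictness
  of either one excludes this for \<open>x \<noteq> 0\<close>.\<close>

lemma D_injective_if_strict:
  assumes strict: "(\<forall>y\<in>F. y \<noteq> 0 \<longrightarrow> norm (Ts y) < norm y) \<or> (\<forall>x\<in>E. x \<noteq> 0 \<longrightarrow> norm (T x) < norm x)"
    and x: "x \<in> E" and Dx: "D x = 0"
  shows "x = 0"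
proof (rule ccontr)
  assume x0: "x \<noteq> 0"
  have norm: "norm (T x) = norm x"
    using D_norm_sq[OF x] Dx by simp
  have "Ts (T x) = x"
    using D_square[OF x] Dx clinear_on_more(1)[OF E D_clinear] by simp
  moreover have "T x \<noteq> 0"
    using norm x0 by auto
  ultimately show False
    using strict x x0 norm T_in[OF x] by (metis less_irrefl)
qed

end

text \<open>If \<open>T*\<close> is pure, then \<open>\<Theta>\<^bsub>T*\<^esub>\<close> is inner, and \<open>\<Theta>\<^sub>T(z)* = \<Theta>\<^bsub>T*\<^esub>(cnj z)\<close> shows that the boundary values of \<open>\<Theta>\<^bsub>T*\<^esub>\<close> at
  \<open>2\<pi> - t\<close> are isometric right inverses of those of \<open>\<Theta>\<^sub>T\<close> at \<open>t\<close>.\<close>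

lemma (in contraction_operator) boundary_value_right_inverse:
  assumes pure: "pure_contraction Ts"
  shows "AE t in circ. \<forall>v\<in>codefect_space T.
    boundary_value (char_fun Ts) (2 * pi - t) v \<in> defect_space T \<and>
    norm (boundary_value (char_fun Ts) (2 * pi - t) v) = norm v \<and>
    boundary_value (char_fun T) t (boundary_value (char_fun Ts) (2 * pi - t) v) = v"
proof -
  interpret adjoint: contraction_operator Ts
    by (rule adj_contraction_operator)
  interpret bc: boundary_contraction "defect_space T" "codefect_space T" "char_fun T"
    by (rule char_fun_boundary_contraction)
  have spaces: "defect_space Ts = codefect_space T" "codefect_space Ts = defect_space T"
    by (rule codefect_space_eq[symmetric])
      (simp add: codefect_space_on_def defect_space_on_def codefect_adjoint)
  interpret abc: boundary_contraction "codefect_space T" "defect_space T" "char_fun Ts"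
    using adjoint.char_fun_boundary_contraction by (simp add: spaces)
  from AE_circ_reflect[OF abc.boundary_value_tendsto] AE_circ_reflect[OF abc.boundary_value_contraction]
    AE_circ_reflect[OF adjoint.pure_imp_inner[OF pure]] bc.boundary_value_tendsto bc.boundary_value_contraction
  show ?thesis
  proof eventually_elim
    case (elim t)
    show ?case
    proof
      fix v
      assume v: "v \<in> codefect_space T"
      define w where "w = boundary_value (char_fun Ts) (2 * pi - t) v"
      have w_lim: "((\<lambda>r. char_fun Ts (complex_of_real r * cis (2 * pi - t)) v) \<longlongrightarrow> w) (at_left 1)"
        using elim(1) v by (simp add: w_def)
      have w: "w \<in> defect_space T"
        using elim(2) v by (auto simp: w_def contraction_on_def clinear_on_def)
      have nw: "norm w = norm v"
        using elim(3) w_lim by blast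
      let ?b = "boundary_value (char_fun T) t w"
      have "((\<lambda>r. cinner (char_fun T (complex_of_real r * cis t) w) v) \<longlongrightarrow> cinner ?b v) (at_left 1)"
        using elim(4) w by (intro bounded_linear.tendsto[OF bounded_linear_cinner_left]) blast
      moreover have "\<forall>\<^sub>F r in at_left 1. cinner (char_fun T (complex_of_real r * cis t) w) v
          = cinner w (char_fun Ts (complex_of_real r * cis (2 * pi - t)) v)"
        using eventually_at_left_1 by eventually_elim (simp add: cinner_char_fun norm_mult cis_reflect)
      ultimately have "((\<lambda>r. cinner w (char_fun Ts (complex_of_real r * cis (2 * pi - t)) v))
          \<longlongrightarrow> cinner ?b v) (at_left 1)"
        by (rule Lim_transform_eventually)
      moreover have "((\<lambda>r. cinner w (char_fun Ts (complex_of_real r * cis (2 * pi - t)) v))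
          \<longlongrightarrow> cinner w w) (at_left 1)"
        by (intro bounded_linear.tendsto[OF bounded_linear_cinner_right] w_lim)
      ultimately have "cinner ?b v = cinner w w"
        by (rule tendsto_unique[OF trivial_limit_at_left_real])
      then have "(norm (?b - v))\<^sup>2 = (norm ?b)\<^sup>2 - (norm w)\<^sup>2"
        by (simp add: norm_diff_sq cinner_self nw)
      moreover have "norm ?b \<le> norm w"
        using elim(5) w by (simp add: contraction_on_def)
      ultimately have "(norm (?b - v))\<^sup>2 \<le> 0"
        by (simp add: power_mono)
      then have "?b = v"
        by simp
      with w nw show "boundary_value (char_fun Ts) (2 * pi - t) v \<in> defect_space T \<and>
          norm (boundary_value (char_fun Ts) (2 * pi - t) v) = norm v \<and>
          boundary_value (char_fun T) t (boundary_value (char_fun Ts) (2 * pi - t) v) = v"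
        by (simp add: w_def)
    qed
  qed
qed

section \<open>Regularity of the factorization\<close>

locale triangular_factorization =
  A: contraction_operator A + B: contraction_operator B + T: contraction_operator T +
  L: subspace_contraction "defect_space B" "codefect_space A" L
  for A :: "'a :: chilbert_space \<Rightarrow> 'a" and B :: "'b :: chilbert_space \<Rightarrow> 'b" and T :: "'a \<times> 'b \<Rightarrow> 'a \<times> 'b"
    and L :: "'b \<Rightarrow> 'a" +
  fixes \<tau> :: "'a \<times> 'b \<Rightarrow> 'a \<times> 'b" and \<tau>' :: "'a \<times> 'b \<Rightarrow> 'b \<times> 'a"
  assumes \<tau>: "unitary_on (defect_space T)
      (defect_space A \<times> defect_space_on (defect_space B) (codefect_space A) L) \<tau>"
    and \<tau>': "unitary_on (codefect_space T)
      (codefect_space B \<times> codefect_space_on (defect_space B) (codefect_space A) L) \<tau>'"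
    and factorization: "\<And>z x. z \<in> ball 0 1 \<Longrightarrow> x \<in> defect_space T \<Longrightarrow>
      char_fun T z x = Theta3' B (codefect_space T) \<tau>' z
        (Theta2' (defect_space B) (codefect_space A) L z (Theta1' A \<tau> z x))"
begin

abbreviation "DL \<equiv> defect_space_on (defect_space B) (codefect_space A) L"
abbreviation "DLs \<equiv> codefect_space_on (defect_space B) (codefect_space A) L"
abbreviation "E1 \<equiv> defect_space T"
abbreviation "E2 \<equiv> codefect_space A \<times> DL"
abbreviation "E3 \<equiv> defect_space B \<times> DLs"
abbreviation "E4 \<equiv> codefect_space T"
abbreviation "\<Theta>1 \<equiv> Theta1' A \<tau>"
abbreviation "\<Theta>2 \<equiv> Theta2' (defect_space B) (codefect_space A) L"
abbreviation "\<Theta>3 \<equiv> Theta3' B E4 \<tau>'"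
abbreviation "\<tau>inv \<equiv> inv_into E1 \<tau>"
abbreviation "\<tau>'inv \<equiv> inv_into E4 \<tau>'"

lemmas E1 = T.defect_space(1) and E4 = T.codefect_space(1)
lemmas E2 = closed_csubspace_Times[OF A.codefect_space(1) L.defect_space(1)]
lemmas E3 = closed_csubspace_Times[OF B.defect_space(1) L.codefect_space(1)]
lemmas \<tau>inv = unitary_on_inv_into[OF E1 \<tau>] and \<tau>'inv = unitary_on_inv_into[OF E4 \<tau>']

lemma zero_in: "0 \<in> defect_space A" "0 \<in> codefect_space A" "0 \<in> defect_space B" "0 \<in> codefect_space B"
  "0 \<in> DL" "0 \<in> DLs"
  by (intro closed_csubspaceD(2) A.defect_space A.codefect_space B.defect_space B.codefect_space
      L.defect_space L.codefect_space)+

lemma DL_sub: "x \<in> DL \<Longrightarrow> x \<in> defect_space B" and DLs_sub: "y \<in> DLs \<Longrightarrow> y \<in> codefect_space A"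
  using L.defect_space(2) L.codefect_space(2) by blast+

lemma \<Theta>1: "boundary_contraction E1 E2 \<Theta>1"
  and bv1: "AE t in circ. \<forall>x\<in>E1. boundary_value \<Theta>1 t x = (boundary_value (char_fun A) t (fst (\<tau> x)), snd (\<tau> x))"
proof -
  have "\<Theta>1 = (\<lambda>z x. (char_fun A z (fst (\<tau> x)), snd (\<tau> x)))"
    by (intro ext) (simp add: Theta1'_def split_beta)
  then show "boundary_contraction E1 E2 \<Theta>1"
    "AE t in circ. \<forall>x\<in>E1. boundary_value \<Theta>1 t x = (boundary_value (char_fun A) t (fst (\<tau> x)), snd (\<tau> x))"
    using boundary_contraction_sandwich[OF A.char_fun_boundary_contraction E1 E2 L.defect_space(1)
        unitary_on_contraction[OF \<tau>] contraction_on_id] by simp_all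
qed

lemma \<Theta>3: "boundary_contraction E3 E4 \<Theta>3"
  and bv3: "AE t in circ. \<forall>x\<in>E3. boundary_value \<Theta>3 t x = \<tau>'inv (boundary_value (char_fun B) t (fst x), snd x)"
proof -
  have "\<Theta>3 = (\<lambda>z x. \<tau>'inv (char_fun B z (fst x), snd x))"
    by (intro ext) (simp add: Theta3'_def split_beta)
  then show "boundary_contraction E3 E4 \<Theta>3"
    "AE t in circ. \<forall>x\<in>E3. boundary_value \<Theta>3 t x = \<tau>'inv (boundary_value (char_fun B) t (fst x), snd x)"
    using boundary_contraction_sandwich[OF B.char_fun_boundary_contraction E3 E4 L.codefect_space(1)
        contraction_on_id unitary_on_contraction[OF \<tau>'inv(3)]] by simp_all
qed

lemma \<Theta>2_eq: "\<Theta>2 = (\<lambda>_. L.julia)"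
  by (rule ext) (simp add: Theta2'_def L.julia_def)

lemma \<Theta>2: "boundary_contraction E2 E3 \<Theta>2"
  unfolding \<Theta>2_eq by (rule boundary_contraction_const[OF E2 E3 L.contraction_on_julia])

sublocale \<Theta>1: boundary_contraction E1 E2 \<Theta>1
  by (rule \<Theta>1)

sublocale \<Theta>2: boundary_contraction E2 E3 \<Theta>2
  by (rule \<Theta>2)

sublocale \<Theta>3: boundary_contraction E3 E4 \<Theta>3
  by (rule \<Theta>3)

sublocale M1: subspace_contraction "L2_on E1" "L2_on E2" "mult_op \<Theta>1"
  by (rule \<Theta>1.mult_op_subspace_contraction)

sublocale M3: subspace_contraction "L2_on E3" "L2_on E4" "mult_op \<Theta>3"
  by (rule \<Theta>3.mult_op_subspace_contraction)

lemma rep_in: "f \<in> L2_on E \<Longrightarrow> AE t in circ. rep_L2 f t \<in> E"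
  by (simp add: L2_on_def)

lemma rep_mult_op2:
  assumes "f \<in> L2_on E2"
  shows "AE t in circ. rep_L2 (mult_op \<Theta>2 f) t = L.julia (rep_L2 f t)"
  using \<Theta>2.rep_mult_op[OF assms] by (simp add: \<Theta>2_eq)

lemma norm_mult_op2:
  assumes f: "f \<in> L2_on E2"
  shows "norm (mult_op \<Theta>2 f) = norm f"
  by (rule norm_L2_eqI)
    (use rep_mult_op2[OF f] rep_in[OF f] in eventually_elim, auto intro!: L.norm_julia dest: DL_sub)

text \<open>The criterion in terms of \<open>k = \<Delta>\<^sub>3 g\<close>: it suffices to test with those \<open>f\<close> on which \<open>\<Theta>'\<^sub>1\<close> is isometric, because
  these are annihilated by \<open>\<Delta>\<^sub>1\<close>.\<close>

lemma regularI:
  assumes "\<And>g. g \<in> L2_on E3 \<Longrightarrow>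
      (\<And>f. f \<in> L2_on E1 \<Longrightarrow> norm (mult_op \<Theta>1 f) = norm f \<Longrightarrow>
        cinner (mult_op \<Theta>2 (mult_op \<Theta>1 f)) (M3.D g) = 0) \<Longrightarrow> M3.D g = 0"
  shows "regular_factorization3 E1 E2 E3 E4 (char_fun T) \<Theta>3 \<Theta>2 \<Theta>1"
proof (rule regular_factorization3I[OF \<Theta>1 \<Theta>2 \<Theta>3 T.char_fun_analytic factorization norm_mult_op2])
  fix g h
  assume g: "g \<in> L2_on E3"
    and orth: "\<And>f. f \<in> L2_on E1 \<Longrightarrow>
      cinner (mult_op \<Theta>2 (mult_op \<Theta>1 f)) (Delta E3 E4 \<Theta>3 g) + cinner (Delta E1 E2 \<Theta>1 f) h = 0"
  show "Delta E3 E4 \<Theta>3 g = 0"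
    unfolding Delta_def
  proof (rule assms[OF g])
    fix f
    assume f: "f \<in> L2_on E1" "norm (mult_op \<Theta>1 f) = norm f"
    then have "M1.D f = 0"
      using M1.D_norm_sq[OF f(1)] by simp
    then show "cinner (mult_op \<Theta>2 (mult_op \<Theta>1 f)) (M3.D g) = 0"
      using orth[OF f(1)] by (simp add: Delta_def)
  qed
qed

text \<open>As \<open>\<Theta>\<^sub>B\<close> is inner, \<open>\<Theta>'\<^sub>3\<close> is isometric and \<open>\<Delta>\<^sub>3 = 0\<close>.\<close>

lemma regular_if_pure_B:
  assumes "pure_contraction B"
  shows "regular_factorization3 E1 E2 E3 E4 (char_fun T) \<Theta>3 \<Theta>2 \<Theta>1"
proof (rule regularI)
  fix g
  assume g: "g \<in> L2_on E3"
  interpret bB: boundary_contraction "defect_space B" "codefect_space B" "char_fun B"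
    by (rule B.char_fun_boundary_contraction)
  have "norm (mult_op \<Theta>3 g) = norm g"
  proof (rule norm_L2_eqI)
    show "AE t in circ. norm (rep_L2 (mult_op \<Theta>3 g) t) = norm (rep_L2 g t)"
      using \<Theta>3.rep_mult_op[OF g] rep_in[OF g] bv3 B.pure_imp_inner[OF assms]
        bB.boundary_value_tendsto bB.boundary_value_contraction
    proof eventually_elim
      case (elim t)
      let ?b = "boundary_value (char_fun B) t (fst (rep_L2 g t))"
      have x: "fst (rep_L2 g t) \<in> defect_space B" "snd (rep_L2 g t) \<in> DLs"
        using elim(2) by auto
      have "norm ?b = norm (fst (rep_L2 g t))"
        using elim(4,5) x by blast
      moreover have "?b \<in> codefect_space B"
        using elim(6) x by (auto simp: contraction_on_def clinear_on_def)
      ultimately show ?case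
        using elim(1,2,3) \<tau>'inv(3) x by (auto simp: unitary_on_def norm_Pair split: prod.splits)
    qed
  qed
  then show "M3.D g = 0"
    using M3.D_norm_sq[OF g] by simp
qed

text \<open>The boundary values of \<open>\<Theta>\<^bsub>A*\<^esub>\<close> provide, for any given \<open>y\<close>, an \<open>f\<close> with \<open>\<Theta>'\<^sub>1 f = y\<close> and \<open>\<parallel>f\<parallel> = \<parallel>y\<parallel>\<close>; take the \<open>y\<close> with
  \<open>\<Theta>'\<^sub>2 y = k\<close>.\<close>

lemma regular_if_pure_adj_A:
  assumes pure: "pure_contraction (adj A)"
  shows "regular_factorization3 E1 E2 E3 E4 (char_fun T) \<Theta>3 \<Theta>2 \<Theta>1"
proof (rule regularI)
  fix g
  assume g: "g \<in> L2_on E3"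
    and orth: "\<And>f. f \<in> L2_on E1 \<Longrightarrow> norm (mult_op \<Theta>1 f) = norm f \<Longrightarrow>
        cinner (mult_op \<Theta>2 (mult_op \<Theta>1 f)) (M3.D g) = 0"
  define k where "k = M3.D g"
  have k: "k \<in> L2_on E3"
    unfolding k_def by (rule M3.D_in[OF g])
  interpret J: boundary_contraction E3 E2 "\<lambda>_. L.julia_inv"
    by (rule boundary_contraction_const[OF E3 E2 L.contraction_on_julia_inv])
  define y where "y = mult_op (\<lambda>_ :: complex. L.julia_inv) k"
  have y: "y \<in> L2_on E2"
    using J.mult_op_contraction k by (auto simp: y_def contraction_on_def clinear_on_def)
  have "mult_op \<Theta>2 y = k"
  proof (rule L2_eqI)
    show "AE t in circ. rep_L2 (mult_op \<Theta>2 y) t = rep_L2 k t"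
      using rep_mult_op2[OF y] J.rep_mult_op[OF k] rep_in[OF k]
      by eventually_elim (auto simp: y_def intro!: L.julia_julia_inv dest: DLs_sub)
  qed
  interpret adjA: contraction_operator "adj A"
    by (rule A.adj_contraction_operator)
  have spaces: "defect_space (adj A) = codefect_space A" "codefect_space (adj A) = defect_space A"
    by (rule A.codefect_space_eq[symmetric])
      (simp add: codefect_space_on_def defect_space_on_def A.codefect_adjoint)
  have bc: "boundary_contraction (codefect_space A) (defect_space A) (char_fun (adj A))"
    using adjA.char_fun_boundary_contraction by (simp only: spaces)
  define \<Psi> where "\<Psi> = (\<lambda>z x. \<tau>inv (char_fun (adj A) z (fst x), snd x))"
  note sandwich = boundary_contraction_sandwich[OF bc E2 E1 L.defect_space(1) contraction_on_id
      unitary_on_contraction[OF \<tau>inv(3)], folded \<Psi>_def]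
  interpret \<Psi>: boundary_contraction E2 E1 \<Psi>
    by (rule sandwich(1))
  let ?W = "\<lambda>t. boundary_value \<Psi> (2 * pi - t)"
  define f where "f = abs_L2 (\<lambda>t. ?W t (rep_L2 y t))"
  have W_sq: "sq_integrable (\<lambda>t. ?W t (rep_L2 y t))"
  proof (rule sq_integrable_pointwise_limit(1)[OF E2 _ _ _ y,
        where K = "\<lambda>n t. \<Psi> (complex_of_real (radii n) * cis (2 * pi - t))"])
    show "continuous_on ({0..2 * pi} \<times> E2)
        (\<lambda>p. \<Psi> (complex_of_real (radii n) * cis (2 * pi - fst p)) (snd p))" for n
      by (rule contractive_analytic_jointly_continuous[OF \<Psi>.analytic radii]) (intro continuous_intros)
    show "AE t in circ. \<forall>x\<in>E2. (\<lambda>n. \<Psi> (complex_of_real (radii n) * cis (2 * pi - t)) x) \<longlonglongrightarrow> ?W t x"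
      using AE_circ_reflect[OF \<Psi>.boundary_value_tendsto]
      by eventually_elim (use filterlim_compose filterlim_radii in blast)
    show "AE t in circ. \<forall>x\<in>E2. norm (?W t x) \<le> norm x"
      using AE_circ_reflect[OF \<Psi>.boundary_value_contraction]
      by eventually_elim (simp add: contraction_on_def)
  qed
  have rep_f: "AE t in circ. rep_L2 f t = ?W t (rep_L2 y t)"
    unfolding f_def by (rule rep_abs_L2[OF W_sq])
  have f_prop: "AE t in circ. rep_L2 f t \<in> E1 \<and> norm (rep_L2 f t) = norm (rep_L2 y t) \<and>
      boundary_value \<Theta>1 t (rep_L2 f t) = rep_L2 y t"
    using rep_f rep_in[OF y] AE_circ_reflect[OF sandwich(2)] A.boundary_value_right_inverse[OF pure] bv1
  proof eventually_elim
    case (elim t)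
    obtain u v where uv: "rep_L2 y t = (u, v)"
      by (cases "rep_L2 y t")
    have u: "u \<in> codefect_space A" and v: "v \<in> DL"
      using elim(2) uv by auto
    let ?w = "boundary_value (char_fun (adj A)) (2 * pi - t) u"
    have w: "?w \<in> defect_space A" "norm ?w = norm u" "boundary_value (char_fun A) t ?w = u"
      using elim(4) u by auto
    have ft: "rep_L2 f t = \<tau>inv (?w, v)"
      using elim(1,2,3) uv by simp
    have mem: "(?w, v) \<in> defect_space A \<times> DL"
      using w v by simp
    have fE: "rep_L2 f t \<in> E1" "norm (rep_L2 f t) = norm (?w, v)"
      unfolding ft using \<tau>inv(3) mem by (auto simp: unitary_on_def clinear_on_def)
    moreover have "norm (?w, v) = norm (rep_L2 y t)"
      by (simp add: uv norm_Pair w(2))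
    moreover have "boundary_value \<Theta>1 t (rep_L2 f t) = rep_L2 y t"
      using elim(5) fE(1) \<tau>inv(1)[OF mem] w(3) by (simp add: ft uv)
    ultimately show ?case
      by simp
  qed
  have f: "f \<in> L2_on E1"
    unfolding L2_on_def mem_Collect_eq using f_prop by eventually_elim simp
  have M1f: "mult_op \<Theta>1 f = y"
    by (rule L2_eqI) (use \<Theta>1.rep_mult_op[OF f] f_prop in eventually_elim, simp)
  have "norm f = norm y"
    by (rule norm_L2_eqI) (use f_prop in eventually_elim, simp)
  then have "cinner (mult_op \<Theta>2 (mult_op \<Theta>1 f)) k = 0"
    using orth[OF f] unfolding k_def M1f by simp
  then have "cinner k k = 0"
    by (simp add: M1f \<open>mult_op \<Theta>2 y = k\<close>)
  then show "M3.D g = 0"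
    by (simp add: cinner_self k_def)
qed

text \<open>For a proper coupling operator \<open>D\<^sub>L\<close> is injective. The second component of \<open>k = \<Delta>\<^sub>3 g\<close> vanishes, because
  \<open>\<Theta>'\<^sub>3\<close> is isometric on \<open>(0, s)\<close>; testing with \<open>f = \<tau>\<^sup>-\<^sup>1(0, D\<^sub>L k\<^sub>1)\<close> gives \<open>D\<^sub>L k\<^sub>1 = 0\<close>.\<close>

lemma regular_if_proper_coupling:
  assumes strict: "(\<forall>x\<in>codefect_space A. x \<noteq> 0 \<longrightarrow> norm (L.Ts x) < norm x) \<or>
      (\<forall>y\<in>defect_space B. y \<noteq> 0 \<longrightarrow> norm (L y) < norm y)"
  shows "regular_factorization3 E1 E2 E3 E4 (char_fun T) \<Theta>3 \<Theta>2 \<Theta>1"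
proof (rule regularI)
  fix g
  assume g: "g \<in> L2_on E3"
    and orth: "\<And>f. f \<in> L2_on E1 \<Longrightarrow> norm (mult_op \<Theta>1 f) = norm f \<Longrightarrow>
        cinner (mult_op \<Theta>2 (mult_op \<Theta>1 f)) (M3.D g) = 0"
  interpret bA: boundary_contraction "defect_space A" "codefect_space A" "char_fun A"
    by (rule A.char_fun_boundary_contraction)
  interpret bB: boundary_contraction "defect_space B" "codefect_space B" "char_fun B"
    by (rule B.char_fun_boundary_contraction)
  define k where "k = M3.D g"
  have k: "k \<in> L2_on E3"
    unfolding k_def by (rule M3.D_in[OF g])
  define S where "S = (\<lambda>p :: 'b \<times> 'a. (0 :: 'b, snd p))"
  have S: "contraction_on E3 E3 S"
    by (auto simp: S_def contraction_on_def clinear_on_def scaleC_prod_def zero_in norm_Pair)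
  interpret S: boundary_contraction E3 E3 "\<lambda>_. S"
    by (rule boundary_contraction_const[OF E3 E3 S])
  define s where "s = mult_op (\<lambda>_ :: complex. S) k"
  have s: "s \<in> L2_on E3"
    using S.mult_op_contraction k by (auto simp: s_def contraction_on_def clinear_on_def)
  have rep_s: "AE t in circ. rep_L2 s t = (0, snd (rep_L2 k t))"
    using S.rep_mult_op[OF k] by (simp add: s_def S_def)
  have "norm (mult_op \<Theta>3 s) = norm s"
  proof (rule norm_L2_eqI)
    show "AE t in circ. norm (rep_L2 (mult_op \<Theta>3 s) t) = norm (rep_L2 s t)"
      using \<Theta>3.rep_mult_op[OF s] rep_s rep_in[OF s] bv3 bB.boundary_value_contraction
    proof eventually_elim
      case (elim t)
      have "boundary_value (char_fun B) t 0 = 0"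
        using elim(5) by (intro clinear_on_more(1)[OF B.defect_space(1)]) (auto simp: contraction_on_def)
      then show ?case
        using elim \<tau>'inv(3) zero_in by (auto simp: unitary_on_def)
    qed
  qed
  then have "M3.D s = 0"
    using M3.D_norm_sq[OF s] by simp
  then have "cinner k s = 0"
    using M3.D_selfadj[OF g s] by (simp add: k_def)
  moreover have "cinner k s = cinner s s"
    by (rule cinner_L2_eqI) (use rep_s in eventually_elim, simp add: cinner_prod_def)
  ultimately have "s = 0"
    by (simp add: cinner_self)
  then have "AE t in circ. rep_L2 s t = 0"
    by (simp add: rep_L2_zero)
  with rep_s have k2: "AE t in circ. snd (rep_L2 k t) = 0"
    by eventually_elim (simp add: zero_prod_def)
  define R where "R = (\<lambda>p :: 'b \<times> 'a. \<tau>inv (0, L.D (fst p)))"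
  have R_mem: "(0, L.D (fst p)) \<in> defect_space A \<times> DL" if "p \<in> E3" for p
    using that by (auto intro!: zero_in L.D_in_defect_space)
  have \<tau>inv_lin: "clinear_on (defect_space A \<times> DL) E1 \<tau>inv"
    and \<tau>inv_norm: "\<And>q. q \<in> defect_space A \<times> DL \<Longrightarrow> norm (\<tau>inv q) = norm q"
    using \<tau>inv(3) by (auto simp: unitary_on_def)
  have R_norm: "norm (\<tau>inv (0, L.D (fst p))) = norm (L.D (fst p))" if "p \<in> E3" for p
    using \<tau>inv_norm[OF R_mem[OF that]] by simp
  have R: "contraction_on E3 E1 R"
  proof -
    have "contraction_on E3 (defect_space A \<times> DL) (\<lambda>p. (0, L.D (fst p)))"
      unfolding contraction_on_def clinear_on_def
    proof (intro conjI ballI allI image_subsetI R_mem)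
      fix p q :: "'b \<times> 'a" and c
      assume p: "p \<in> E3"
      then have p1: "fst p \<in> defect_space B"
        by auto
      show "(0 :: 'a, L.D (fst (c *\<^sub>C p))) = c *\<^sub>C (0, L.D (fst p))"
        by (simp add: scaleC_prod_def clinear_onD(3)[OF L.D_clinear p1])
      show "norm (0 :: 'a, L.D (fst p)) \<le> norm p"
        using order_trans[OF L.D_norm[OF p1] norm_fst_le[of "fst p" "snd p"]] by simp
      assume "q \<in> E3"
      then have "fst q \<in> defect_space B"
        by auto
      then show "(0 :: 'a, L.D (fst (p + q))) = (0, L.D (fst p)) + (0, L.D (fst q))"
        by (simp add: clinear_onD(2)[OF L.D_clinear p1])
    qed
    from contraction_on_comp[OF this unitary_on_contraction[OF \<tau>inv(3)]] show ?thesis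
      by (simp add: R_def)
  qed
  interpret R: boundary_contraction E3 E1 "\<lambda>_. R"
    by (rule boundary_contraction_const[OF E3 E1 R])
  define f where "f = mult_op (\<lambda>_ :: complex. R) k"
  have f: "f \<in> L2_on E1"
    using R.mult_op_contraction k by (auto simp: f_def contraction_on_def clinear_on_def)
  have rep_f: "AE t in circ. rep_L2 f t = \<tau>inv (0, L.D (fst (rep_L2 k t)))"
    using R.rep_mult_op[OF k] by (simp add: f_def R_def)
  have rep_M1f: "AE t in circ. rep_L2 (mult_op \<Theta>1 f) t = (0, L.D (fst (rep_L2 k t)))"
    using \<Theta>1.rep_mult_op[OF f] rep_in[OF f] rep_f bv1 rep_in[OF k] bA.boundary_value_contraction
  proof eventually_elim
    case (elim t)
    have "boundary_value (char_fun A) t 0 = 0"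
      using elim(6) by (intro clinear_on_more(1)[OF A.defect_space(1)]) (auto simp: contraction_on_def)
    moreover have "\<tau> (rep_L2 f t) = (0, L.D (fst (rep_L2 k t)))"
      unfolding elim(3) by (rule \<tau>inv(1)[OF R_mem[OF elim(5)]])
    ultimately show ?case
      using elim(1,2,4) by simp
  qed
  have M1f: "mult_op \<Theta>1 f \<in> L2_on E2"
    by (rule M1.T_in[OF f])
  have "norm (mult_op \<Theta>1 f) = norm f"
    by (rule norm_L2_eqI)
      (use rep_M1f rep_f rep_in[OF k] in eventually_elim, simp only: R_norm norm_Pair1)
  then have "cinner (mult_op \<Theta>2 (mult_op \<Theta>1 f)) k = 0"
    using orth[OF f] by (simp add: k_def)
  moreover have "cinner (mult_op \<Theta>2 (mult_op \<Theta>1 f)) k = cinner (mult_op \<Theta>1 f) (mult_op \<Theta>1 f)"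
  proof (rule cinner_L2_eqI)
    show "AE t in circ. cinner (rep_L2 (mult_op \<Theta>2 (mult_op \<Theta>1 f)) t) (rep_L2 k t)
        = cinner (rep_L2 (mult_op \<Theta>1 f) t) (rep_L2 (mult_op \<Theta>1 f) t)"
      using rep_mult_op2[OF M1f] rep_M1f k2 rep_in[OF k]
    proof eventually_elim
      case (elim t)
      let ?p = "fst (rep_L2 k t)"
      have p: "?p \<in> defect_space B"
        using elim(4) by auto
      have "L.Ts 0 = 0"
        by (rule clinear_on_more(1)[OF A.codefect_space(1) L.Ts_clinear])
      then show ?case
        using elim L.D_selfadj[OF L.D_in[OF p] p] by (simp add: L.julia_def cinner_prod_def)
    qed
  qed
  ultimately have "mult_op \<Theta>1 f = 0"
    by (simp add: cinner_self)
  then have "AE t in circ. rep_L2 (mult_op \<Theta>1 f) t = 0"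
    by (simp add: rep_L2_zero)
  with rep_M1f have Dk: "AE t in circ. L.D (fst (rep_L2 k t)) = 0"
    by eventually_elim (simp add: zero_prod_def)
  have "k = 0"
  proof (rule L2_eqI)
    show "AE t in circ. rep_L2 k t = rep_L2 0 t"
      using Dk k2 rep_in[OF k] rep_L2_zero[where 'a = "'b \<times> 'a"]
    proof eventually_elim
      case (elim t)
      have "fst (rep_L2 k t) \<in> defect_space B"
        using elim(3) by auto
      then have "fst (rep_L2 k t) = 0"
        using L.D_injective_if_strict[OF strict] elim(1) by blast
      then show ?case
        using elim(2,4) by (simp add: prod_eq_iff)
    qed
  qed
  then show "M3.D g = 0"
    by (simp add: k_def)
qed

end

lemma upper_triangular_contractions:
  fixes A :: "'a :: complex_inner \<Rightarrow> 'a" and B :: "'b :: complex_inner \<Rightarrow> 'b"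
  assumes A: "bounded_clinear_on UNIV UNIV A" and B: "bounded_clinear_on UNIV UNIV B"
    and X: "bounded_clinear_on UNIV UNIV X" and T: "contraction_on UNIV UNIV (upper_triangular A X B)"
  shows "contraction_on UNIV UNIV A" "contraction_on UNIV UNIV B"
proof -
  have lin: "clinear_on UNIV UNIV A" "clinear_on UNIV UNIV B" "clinear_on UNIV UNIV X"
    using A B X by (auto simp: bounded_clinear_on_def)
  have T': "norm (upper_triangular A X B p) \<le> norm p" for p
    using T by (cases p) (simp add: contraction_on_def)
  have "norm (A x) \<le> norm x" for x
    using T'[of "(x, 0)"] clinear_on_more(1)[OF closed_csubspace_UNIV lin(2)]
      clinear_on_more(1)[OF closed_csubspace_UNIV lin(3)] by (simp add: upper_triangular_def)
  with lin show "contraction_on UNIV UNIV A"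
    by (simp add: contraction_on_def)
  have "norm (B y) \<le> norm y" for y
  proof -
    have "norm (B y) \<le> norm (upper_triangular A X B (0, y))"
      by (simp add: upper_triangular_def norm_snd_le)
    also have "\<dots> \<le> norm y"
      using T'[of "(0, y)"] by simp
    finally show ?thesis .
  qed
  with lin show "contraction_on UNIV UNIV B"
    by (simp add: contraction_on_def)
qed

text \<open>The second summand is invariant under \<open>T*\<close>, which acts on it as \<open>B*\<close>.\<close>

lemma pure_upper_triangular_imp_pure:
  fixes A :: "'a :: chilbert_space \<Rightarrow> 'a" and B :: "'b :: chilbert_space \<Rightarrow> 'b"
  assumes T: "pure_contraction (upper_triangular A X B)" and B: "contraction_on UNIV UNIV B"
  shows "pure_contraction B"
proof -
  let ?T = "upper_triangular A X B"
  have Tc: "contraction_on UNIV UNIV ?T"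
    using T by (simp add: pure_contraction_def)
  interpret B: contraction_operator B
    by (rule contraction_operator.intro[OF B])
  have adj: "adj ?T (0, y) = (0, adj B y)" for y
    by (rule adj_on_unique[OF closed_csubspace_UNIV contraction_on_bounded[OF Tc]])
      (auto simp: upper_triangular_def cinner_prod_def B.Ts_cinner)
  have "(adj ?T ^^ n) (0, y) = (0, (adj B ^^ n) y)" for n y
    by (induction n) (simp_all add: adj)
  then have "norm ((adj B ^^ n) y) = norm ((adj ?T ^^ n) (0, y))" for n y
    by simp
  then show ?thesis
    using T B by (simp add: pure_contraction_def)
qed

theorem theorem3p9:
  fixes A :: "'a :: chilbert_space \<Rightarrow> 'a" and B :: "'b :: chilbert_space \<Rightarrow> 'b"
    and X L :: "'b \<Rightarrow> 'a" and T :: "'a \<times> 'b \<Rightarrow> 'a \<times> 'b"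
    and \<tau> :: "'a \<times> 'b \<Rightarrow> 'a \<times> 'b" and \<tau>' :: "'a \<times> 'b \<Rightarrow> 'b \<times> 'a"
  assumes "bounded_clinear_on UNIV UNIV A"
    and "bounded_clinear_on UNIV UNIV B"
    and "bounded_clinear_on UNIV UNIV X"
    and "T = upper_triangular A X B"
    and "contraction_on UNIV UNIV T"
    and "contraction_on (defect_space B) (codefect_space A) L"
    and "\<forall>y. X y = codefect A (L (defect B y))"
    and "unitary_on (defect_space T)
      (defect_space A \<times> defect_space_on (defect_space B) (codefect_space A) L) \<tau>"
    and "unitary_on (codefect_space T)
      (codefect_space B \<times> codefect_space_on (defect_space B) (codefect_space A) L) \<tau>'"
    and "\<forall>z\<in>ball 0 1. \<forall>x\<in>defect_space T.
      char_fun T z x =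
        Theta3' B (codefect_space T) \<tau>' z
          (Theta2' (defect_space B) (codefect_space A) L z (Theta1' A \<tau> z x))"
    and "(pure_contraction (adj A) \<or> pure_contraction B) \<or>
      pure_contraction T \<or>
      ((\<forall>x\<in>codefect_space A. x \<noteq> 0 \<longrightarrow>
          norm (adj_on (defect_space B) (codefect_space A) L x) < norm x) \<or>
       (\<forall>y\<in>defect_space B. y \<noteq> 0 \<longrightarrow> norm (L y) < norm y))"
  shows "regular_factorization3
      (defect_space T)
      (codefect_space A \<times> defect_space_on (defect_space B) (codefect_space A) L)
      (defect_space B \<times> codefect_space_on (defect_space B) (codefect_space A) L)
      (codefect_space T)
      (char_fun T)
      (Theta3' B (codefect_space T) \<tau>')
      (Theta2' (defect_space B) (codefect_space A) L)
      (Theta1' A \<tau>)"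
proof -
  have cA: "contraction_on UNIV UNIV A" and cB: "contraction_on UNIV UNIV B"
    using upper_triangular_contractions[OF assms(1-3)] assms(4,5) by auto
  interpret A: contraction_operator A
    by (rule contraction_operator.intro[OF cA])
  interpret B: contraction_operator B
    by (rule contraction_operator.intro[OF cB])
  interpret triangular_factorization A B T L \<tau> \<tau>'
    using A.codefect_space(1) B.defect_space(1) assms(5,6,8-10) cA cB
    by unfold_locales auto
  have "pure_contraction B" if "pure_contraction T"
    using pure_upper_triangular_imp_pure[of A X B] that cB assms(4) by simp
  then show ?thesis
    using assms(11) regular_if_pure_B regular_if_pure_adj_A regular_if_proper_coupling by blast
qed

end
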